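(* Let $\alpha=-1$ and $\kappa>0$. For any $z^0=(u^0,\rho^0)\in H^s(\mathbb S)\times H^{s-1}(\mathbb S)$, $s>\frac52$, let $T$ be the maximal existence time of the solution $z=(u,\rho)$ of the generalized two-component Hunter–Saxton system with initial datum $z^0$. Then the solution blows up in finite time if and only if $$\liminf_{t\to T^-}\Big\{\inf_{x\in\mathbb S}u_x(t,x)\Big\}=-\infty .$$
   Context: $\mathbb S=\mathbb R/\mathbb Z$; $H^r(\mathbb S)$ are the $L^2$-based Sobolev spaces. For $(\alpha,\kappa)\in\mathbb R\times\mathbb R$, the generalized two-component Hunter–Saxton system is $$u_{txx}+(1-\alpha)u_xu_{xx}+uu_{xxx}-\kappa\rho\rho_x=0,\qquad \rho_t+u\rho_x=\alpha u_x\rho,\qquad t>0,\ x\in\mathbb R,$$ with $u(t,x+1)=u(t,x)$, $\rho(t,x+1)=\rho(t,x)$, $u(0,x)=u^0(x)$, $\rho(0,x)=\rho^0(x)$. Integrating the first equation twice in space gives $$u_t+uu_x=\partial_x^{-1}\Big(\tfrac{\kappa}{2}\rho^2+\tfrac{\alpha+2}{2}u_x^2+a(t)\Big)+h(t),\qquad \partial_x^{-1}f(x)=\int_0^x f(y)\,dy,$$ with $a(t)=-\frac{\kappa}{2}\int_{\mathbb S}\rho^2dx-\frac{\alpha+2}{2}\int_{\mathbb S}u_x^2dx$ and $h:[0,\infty)\to\mathbb R$ an arbitrary continuous function, which is fixed once and for all (e.g. $h\equiv0$); "the solution" means the solution of this integrated equation together with the $\rho$-equation. For $z^0\in H^s\times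 H^{s-1}$, $s\ge2$, there is a unique solution of class $C([0,T);H^s\times H^{s-1})\cap C^1([0,T);H^{s-1}\times H^{s-2})$ with maximal existence time $T=T(\|z^0\|_{H^s\times H^{s-1}})>0$. The solution "blows up in finite time" if $T<\infty$ and $\limsup_{t\to T^-}\|z(t)\|_{H^s\times H^{s-1}}=\infty$; the limit $t\to T^-$ in the criterion refers to a finite $T$. *)

theory Defs
  imports "HOL-Analysis.Analysis"
begin

text \<open>
  Functions on the circle \<open>\<real>/\<int>\<close> are represented by real functions of period one, and elements
  of \<open>L\<^sup>2\<close> by (Borel) representatives.
\<close>

definition fourier_coeff :: "(real \<Rightarrow> real) \<Rightarrow> int \<Rightarrow> complex" where
  "fourier_coeff f k =
     (LINT x:{0..1}|lborel. complex_of_real (f x) * cis (- (2 * pi * of_int k * x)))"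

definition sobolev_summand :: "real \<Rightarrow> (real \<Rightarrow> real) \<Rightarrow> int \<Rightarrow> real" where
  "sobolev_summand r f k = (1 + (2 * pi * of_int k)\<^sup>2) powr r * (cmod (fourier_coeff f k))\<^sup>2"

text \<open>
  The space \<open>H\<^sup>r\<close> of the circle for \<open>r \<ge> 0\<close> (for negative \<open>r\<close> it would have to contain
  distributions).
\<close>

definition sobolev :: "real \<Rightarrow> (real \<Rightarrow> real) set" where
  "sobolev r = {f. f \<in> borel_measurable borel \<and> (\<forall>x. f (x + 1) = f x) \<and>
                   set_integrable lborel {0..1} (\<lambda>x. (f x)\<^sup>2) \<and>
                   sobolev_summand r f summable_on UNIV}"

text \<open>Only meaningful on \<open>sobolev r\<close>: an infinite sum that does not exist is \<open>0\<close> by convention.\<close>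

definition sobolev_norm :: "real \<Rightarrow> (real \<Rightarrow> real) \<Rightarrow> real" where
  "sobolev_norm r f = sqrt (\<Sum>\<^sub>\<infinity>k. sobolev_summand r f k)"

definition pair_norm :: "real \<Rightarrow> (real \<Rightarrow> real) \<Rightarrow> (real \<Rightarrow> real) \<Rightarrow> real" where
  "pair_norm s u \<rho> = sqrt ((sobolev_norm s u)\<^sup>2 + (sobolev_norm (s - 1) \<rho>)\<^sup>2)"

definition time_interval :: "ereal \<Rightarrow> real set" where
  "time_interval T = {t. 0 \<le> t \<and> ereal t < T}"

definition C0_sobolev :: "real \<Rightarrow> real set \<Rightarrow> (real \<Rightarrow> real \<Rightarrow> real) \<Rightarrow> bool" where
  "C0_sobolev r I v \<longleftrightarrow>
     (\<forall>t\<in>I. v t \<in> sobolev r) \<and>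
     (\<forall>t\<in>I. ((\<lambda>\<tau>. sobolev_norm r (\<lambda>x. v \<tau> x - v t x)) \<longlongrightarrow> 0) (at t within I))"

text \<open>\<open>v\<close> is of class \<open>C\<^sup>1(I; H\<^sup>r)\<close> and its strong time derivative is \<open>v'\<close>.\<close>

definition C1_sobolev ::
  "real \<Rightarrow> real set \<Rightarrow> (real \<Rightarrow> real \<Rightarrow> real) \<Rightarrow> (real \<Rightarrow> real \<Rightarrow> real) \<Rightarrow> bool" where
  "C1_sobolev r I v v' \<longleftrightarrow>
     C0_sobolev r I v \<and> C0_sobolev r I v' \<and>
     (\<forall>t\<in>I. ((\<lambda>\<tau>. sobolev_norm r (\<lambda>x. (v \<tau> x - v t x) / (\<tau> - t) - v' t x)) \<longlongrightarrow> 0)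
               (at t within I))"

definition dx_inv :: "(real \<Rightarrow> real) \<Rightarrow> real \<Rightarrow> real" where
  "dx_inv f x = (LBINT y=0..x. f y)"

definition hs_a :: "real \<Rightarrow> real \<Rightarrow> (real \<Rightarrow> real) \<Rightarrow> (real \<Rightarrow> real) \<Rightarrow> real" where
  "hs_a \<alpha> \<kappa> u \<rho> =
     - (\<kappa> / 2) * (LBINT x=0..1. (\<rho> x)\<^sup>2) - ((\<alpha> + 2) / 2) * (LBINT x=0..1. (deriv u x)\<^sup>2)"

text \<open>
  \<open>(u, \<rho>)\<close> solves, on the time interval \<open>[0, T)\<close>, the generalized two-component Hunter--Saxton
  system, with the first equation integrated twice in space and \<open>h\<close> the resulting function of
  time, in \<open>C([0,T); H\<^sup>s \<times> H\<^sup>s\<^sup>-\<^sup>1) \<inter> C\<^sup>1([0,T); H\<^sup>s\<^sup>-\<^sup>1 \<times> H\<^sup>s\<^sup>-\<^sup>2)\<close>. For each time, \<open>u\<close>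
  and \<open>\<rho>\<close> are taken to be the continuous representatives of their classes, so that \<open>deriv\<close> is
  the weak space derivative: everywhere for \<open>u\<close>, and almost everywhere for \<open>\<rho>\<close>, as soon as
  \<open>s \<ge> 2\<close>. The equations are identities in \<open>L\<^sup>2\<close>, hence the quantifier \<open>AE\<close>.
\<close>

definition hs_solution ::
  "real \<Rightarrow> real \<Rightarrow> (real \<Rightarrow> real) \<Rightarrow> real \<Rightarrow> (real \<Rightarrow> real) \<Rightarrow> (real \<Rightarrow> real) \<Rightarrow> ereal \<Rightarrow>
   (real \<Rightarrow> real \<Rightarrow> real) \<Rightarrow> (real \<Rightarrow> real \<Rightarrow> real) \<Rightarrow> bool" where
  "hs_solution \<alpha> \<kappa> h s u0 \<rho>0 T u \<rho> \<longleftrightarrow>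
     0 < T \<and>
     (\<forall>t\<in>time_interval T. continuous_on UNIV (u t) \<and> continuous_on UNIV (\<rho> t)) \<and>
     C0_sobolev s (time_interval T) u \<and>
     C0_sobolev (s - 1) (time_interval T) \<rho> \<and>
     (AE x in lborel. u 0 x = u0 x) \<and>
     (AE x in lborel. \<rho> 0 x = \<rho>0 x) \<and>
     (\<exists>u' \<rho>'.
        C1_sobolev (s - 1) (time_interval T) u u' \<and>
        C1_sobolev (s - 2) (time_interval T) \<rho> \<rho>' \<and>
        (\<forall>t\<in>time_interval T.
           (AE x in lborel.
              u' t x + u t x * deriv (u t) x =
                dx_inv (\<lambda>y. \<kappa> / 2 * (\<rho> t y)\<^sup>2 + (\<alpha> + 2) / 2 * (deriv (u t) y)\<^sup>2
                              + hs_a \<alpha> \<kappa> (u t) (\<rho> t)) x + h t) \<and>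
           (AE x in lborel.
              \<rho>' t x + u t x * deriv (\<rho> t) x = \<alpha> * deriv (u t) x * \<rho> t x)))"

definition max_existence_time ::
  "real \<Rightarrow> real \<Rightarrow> (real \<Rightarrow> real) \<Rightarrow> real \<Rightarrow> (real \<Rightarrow> real) \<Rightarrow> (real \<Rightarrow> real) \<Rightarrow> ereal" where
  "max_existence_time \<alpha> \<kappa> h s u0 \<rho>0 = Sup {T. \<exists>u \<rho>. hs_solution \<alpha> \<kappa> h s u0 \<rho>0 T u \<rho>}"

definition blows_up_in_finite_time ::
  "real \<Rightarrow> ereal \<Rightarrow> (real \<Rightarrow> real \<Rightarrow> real) \<Rightarrow> (real \<Rightarrow> real \<Rightarrow> real) \<Rightarrow> bool" where
  "blows_up_in_finite_time s T u \<rho> \<longleftrightarrow>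
     T < \<infinity> \<and>
     Limsup (at_left (real_of_ereal T)) (\<lambda>t. ereal (pair_norm s (u t) (\<rho> t))) = \<infinity>"

end

theory Submission
  imports Defs
begin

text \<open>The proof takes place on the Fourier side and works with \<open>v = u\<^sub>x\<close> and \<open>\<rho>\<close>, which for
  \<open>\<alpha> = -1\<close> satisfy \<open>v\<^sub>t = - u v\<^sub>x - v\<^sup>2 / 2 + \<kappa> \<rho>\<^sup>2 / 2 + a(t)\<close> and \<open>\<rho>\<^sub>t = - u \<rho>\<^sub>x - v \<rho>\<close>.

  If the infimum of \<open>u\<^sub>x\<close> tends to \<open>-\<infinity>\<close> along a sequence of times, then the \<open>H\<^sup>s\<close> norm of \<open>u\<close> tends to
  infinity, since \<open>\<bar>u\<^sub>x\<bar>\<close> is at most the sum of the \<open>\<bar>2 \<pi> k u\<^sub>k\<bar>\<close>, which the norm controls (\<open>abs_v_le\<close>).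

  Conversely let \<open>u\<^sub>x \<ge> - M\<close> near a finite \<open>T\<close>. The coupling terms cancel in the energy of the
  gradients, \<open>d/dt \<integral> (v\<^sub>x\<^sup>2 + \<kappa> \<rho>\<^sub>x\<^sup>2) = - 3 \<integral> v (v\<^sub>x\<^sup>2 + \<kappa> \<rho>\<^sub>x\<^sup>2)\<close> (\<open>gradient_energy_identity\<close>), so the
  one-sided bound and Gronwall's inequality bound this energy up to time \<open>T\<close>. As \<open>v\<close> has mean zero
  and the mean of \<open>\<rho>\<close> is conserved, the sums of \<open>\<bar>v\<^sub>k\<bar>\<close> and \<open>\<bar>\<rho>\<^sub>k\<bar>\<close>, that is the norms in the Wiener
  algebra, are bounded as well. These norms govern the growth of all higher norms: for a weight
  \<open>\<omega>(k)\<close> growing like \<open>\<bar>k\<bar>\<^bsup>2 (s - 1)\<^esup>\<close> the energy \<open>\<Sum> \<omega>(k) (\<bar>v\<^sub>k\<bar>\<^sup>2 + \<bar>\<rho>\<^sub>k\<bar>\<^sup>2)\<close> grows at most exponentially,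
  at a rate given by the Wiener norms (\<open>cutoff_energy_growth\<close>), because in the transport terms
  the loss of a derivative is undone by antisymmetrising the symbol (\<open>transport_symmetrised\<close>,
  \<open>cutoff_commutator\<close>). The solution has too few derivatives to differentiate this energy, so the
  weight is truncated at a height \<open>N\<close> and the estimates are made uniform in \<open>N\<close>; truncated
  energies are differentiable by \<open>weighted_energy_has_derivative\<close>. The mean of \<open>u\<close>, which no such
  energy sees, is estimated separately (\<open>mean_u_le\<close>). Hence the norm stays bounded up to time \<open>T\<close>
  (\<open>bounded_if_gradient_bounded_below\<close>), and there is no blow-up.\<close>

section \<open>Fourier coefficients and absolutely convergent Fourier series\<close>

abbreviation (input) "\<F> \<equiv> fourier_coeff"

definition mode :: "int \<Rightarrow> real \<Rightarrow> complex" where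
  "mode k x = cis (2 * pi * of_int k * x)"

lemma mode_add: "mode (j + k) x = mode j x * mode k x"
  by (simp add: mode_def cis_mult algebra_simps)

lemma mode_0 [simp]: "mode 0 x = 1"
  by (simp add: mode_def)

lemma cnj_mode: "cnj (mode k x) = mode (- k) x"
  by (simp add: mode_def cis_cnj)

lemma norm_mode [simp]: "norm (mode k x) = 1"
  by (simp add: mode_def)

lemma mode_at_0 [simp]: "mode k 0 = 1"
  by (simp add: mode_def)

lemma cis_2pi_int: "cis (2 * pi * of_int k) = 1"
  by (auto simp: complex_eq_iff)

lemma mode_at_1 [simp]: "mode k 1 = 1"
  using cis_2pi_int by (simp add: mode_def)

lemma mode_periodic: "mode k (x + 1) = mode k x"
  using cis_2pi_int by (simp add: mode_def distrib_left flip: cis_mult)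

lemma continuous_on_mode [continuous_intros]: "continuous_on A (mode k)"
  unfolding mode_def by (intro continuous_intros)

lemma mode_has_vector_derivative:
  "(mode k has_vector_derivative (2 * pi * \<i> * of_int k * mode k x)) (at x within A)"
proof -
  have "(cis has_vector_derivative \<i> * cis y) (at y within B)" for y B
  proof -
    have "((\<lambda>y. exp (\<i> * of_real y)) has_vector_derivative (\<i> * exp (\<i> * of_real y))) (at y within B)"
      by (rule has_vector_derivative_real_field) (auto intro!: derivative_eq_intros)
    moreover have "cis = (\<lambda>y. exp (\<i> * of_real y))"
      by (simp add: fun_eq_iff cis_conv_exp)
    ultimately show ?thesis
      by (simp add: cis_conv_exp)
  qed
  then have *: "(cis has_derivative (\<lambda>h. h *\<^sub>R (\<i> * cis y))) (at y within B)" for y B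
    by (simp add: has_vector_derivative_def)
  show ?thesis
    unfolding mode_def has_vector_derivative_def
    by (rule has_derivative_eq_rhs, rule has_derivative_compose[OF _ *])
       (auto intro!: derivative_eq_intros simp: scaleR_conv_of_real)
qed

lemma fourier_coeff_eq:
  "\<F> f k = (LINT x:{0..1}|lborel. complex_of_real (f x) * mode (- k) x)"
  by (simp add: fourier_coeff_def mode_def)

lemma fourier_coeff_continuous:
  assumes "continuous_on UNIV f"
  shows "\<F> f k = integral {0..1} (\<lambda>x. complex_of_real (f x) * mode (- k) x)"
proof -
  have "set_integrable lborel {0..1} (\<lambda>x. complex_of_real (f x) * mode (- k) x)"
    by (intro borel_integrable_atLeastAtMost' continuous_intros)
       (auto intro: continuous_on_subset[OF assms])
  then show ?thesis
    unfolding fourier_coeff_eq by (rule set_borel_integral_eq_integral)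
qed

lemma abs_summable_mode:
  assumes "(\<lambda>k. norm (c k)) summable_on UNIV"
  shows "(\<lambda>k. c k * mode k x) summable_on UNIV"
  by (rule abs_summable_summable) (use assms in \<open>simp add: norm_mult\<close>)

lemma uniform_limit_mode_series:
  assumes "(\<lambda>k. norm (c k)) summable_on UNIV"
  shows "uniform_limit A (\<lambda>X x. \<Sum>k\<in>X. c k * mode k x) (\<lambda>x. \<Sum>\<^sub>\<infinity>k. c k * mode k x)
           (finite_subsets_at_top UNIV)"
  by (rule Weierstrass_m_test_general[OF _ assms]) (simp add: norm_mult)

lemma continuous_on_mode_series:
  assumes "(\<lambda>k. norm (c k)) summable_on UNIV"
  shows "continuous_on A (\<lambda>x. \<Sum>\<^sub>\<infinity>k. c k * mode k x)"
  by (rule uniform_limit_theorem[OF _ uniform_limit_mode_series[OF assms]])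
     (auto intro!: always_eventually continuous_intros)

text \<open>The series converges uniformly, so it may be integrated term by term against any continuous function.\<close>

lemma integral_mode_series:
  fixes \<phi> :: "real \<Rightarrow> complex"
  assumes c: "(\<lambda>k. norm (c k)) summable_on UNIV" and \<phi>: "continuous_on {a..b} \<phi>"
  shows "((\<lambda>k. c k * integral {a..b} (\<lambda>x. \<phi> x * mode k x)) has_sum
            integral {a..b} (\<lambda>x. \<phi> x * (\<Sum>\<^sub>\<infinity>k. c k * mode k x))) UNIV"
proof -
  from compact_imp_bounded[OF compact_continuous_image[OF \<phi> compact_Icc]]
  obtain B where B: "\<And>x. x \<in> {a..b} \<Longrightarrow> norm (\<phi> x) \<le> B"
    unfolding bounded_iff by blast
  have "uniform_limit {a..b} (\<lambda>X x. \<Sum>k\<in>X. \<phi> x * (c k * mode k x))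
          (\<lambda>x. \<Sum>\<^sub>\<infinity>k. \<phi> x * (c k * mode k x)) (finite_subsets_at_top UNIV)"
  proof (rule Weierstrass_m_test_general)
    show "(\<lambda>k. B * norm (c k)) summable_on UNIV"
      by (intro summable_on_cmult_right c)
    show "norm (\<phi> y * (c k * mode k y)) \<le> B * norm (c k)" if "y \<in> {a..b}" for k y
      using B[OF that] by (simp add: norm_mult mult_right_mono)
  qed
  moreover have "(\<Sum>\<^sub>\<infinity>k. \<phi> x * (c k * mode k x)) = \<phi> x * (\<Sum>\<^sub>\<infinity>k. c k * mode k x)" for x
    by (rule infsum_cmult_right) (use abs_summable_mode[OF c] in simp)
  ultimately have ul: "uniform_limit {a..b} (\<lambda>X x. \<Sum>k\<in>X. \<phi> x * (c k * mode k x))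
          (\<lambda>x. \<phi> x * (\<Sum>\<^sub>\<infinity>k. c k * mode k x)) (finite_subsets_at_top UNIV)"
    by simp
  obtain I J where I: "\<And>X. ((\<lambda>x. \<Sum>k\<in>X. \<phi> x * (c k * mode k x)) has_integral I X) {a..b}"
      and J: "((\<lambda>x. \<phi> x * (\<Sum>\<^sub>\<infinity>k. c k * mode k x)) has_integral J) {a..b}"
      and lim: "(I \<longlongrightarrow> J) (finite_subsets_at_top UNIV)"
    by (rule uniform_limit_integral[OF ul]) (auto intro!: continuous_intros \<phi>)
  have "I X = (\<Sum>k\<in>X. c k * integral {a..b} (\<lambda>x. \<phi> x * mode k x))" for X
  proof (cases "finite X")
    case True
    have "((\<lambda>x. c k * (\<phi> x * mode k x)) has_integral c k * integral {a..b} (\<lambda>x. \<phi> x * mode k x)) {a..b}" for k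
      by (intro has_integral_mult_right integrable_integral integrable_continuous_real
            continuous_intros \<phi>)
    from has_integral_sum[OF True this]
    have "((\<lambda>x. \<Sum>k\<in>X. \<phi> x * (c k * mode k x)) has_integral
        (\<Sum>k\<in>X. c k * integral {a..b} (\<lambda>x. \<phi> x * mode k x))) {a..b}"
      by (simp add: algebra_simps)
    then show ?thesis
      using I has_integral_unique by blast
  next
    case False
    then show ?thesis
      using I[of X] by (simp add: has_integral_0_eq)
  qed
  then have "I = (\<lambda>X. \<Sum>k\<in>X. c k * integral {a..b} (\<lambda>x. \<phi> x * mode k x))"
    by blast
  then show ?thesis
    using lim integral_unique[OF J] unfolding has_sum_def by simp
qed

lemma integral_mode: "integral {0..1} (mode k) = (if k = 0 then 1 else 0)"
proof (cases "k = 0")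
  case True
  moreover have "mode 0 = (\<lambda>x. 1)"
    by (simp add: fun_eq_iff)
  ultimately show ?thesis by simp
next
  case False
  define F where "F x = mode k x / (2 * pi * \<i> * of_int k)" for x
  have "(F has_vector_derivative mode k x) (at x within {0..1})" for x
  proof -
    have "(F has_vector_derivative (2 * pi * \<i> * of_int k * mode k x) * inverse (2 * pi * \<i> * of_int k))
        (at x within {0..1})"
      unfolding F_def divide_inverse
      by (rule has_vector_derivative_mult_left[OF mode_has_vector_derivative])
    also have "(2 * pi * \<i> * of_int k * mode k x) * inverse (2 * pi * \<i> * of_int k) = mode k x"
      using False by (simp add: field_simps)
    finally show ?thesis .
  qed
  then have "(mode k has_integral F 1 - F 0) {0..1}"
    by (intro fundamental_theorem_of_calculus) auto
  then show ?thesis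
    using False by (simp add: F_def integral_unique)
qed

lemma coeff_mode_series:
  assumes "(\<lambda>k. norm (c k)) summable_on UNIV"
  shows "integral {0..1} (\<lambda>x. mode (- j) x * (\<Sum>\<^sub>\<infinity>k. c k * mode k x)) = c j"
proof -
  have "((\<lambda>k. c k * integral {0..1} (\<lambda>x. mode (- j) x * mode k x)) has_sum
      integral {0..1} (\<lambda>x. mode (- j) x * (\<Sum>\<^sub>\<infinity>k. c k * mode k x))) UNIV"
    by (intro integral_mode_series assms continuous_intros)
  moreover have "integral {0..1} (\<lambda>x. mode (- j) x * mode k x) = (if k = j then 1 else 0)" for k
  proof -
    have "(\<lambda>x. mode (- j) x * mode k x) = mode (k - j)"
      by (simp add: fun_eq_iff flip: mode_add)
    then show ?thesis
      by (simp add: integral_mode)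
  qed
  moreover have "((\<lambda>k. c k * (if k = j then 1 else 0)) has_sum c j) UNIV"
    by (rule has_sum_finite_neutralI[of "{j}"]) auto
  ultimately show ?thesis
    using has_sum_unique by force
qed

lemma fourier_coeff_uminus: "\<F> f (- k) = cnj (\<F> f k)"
  unfolding fourier_coeff_eq set_lebesgue_integral_def
  by (subst Bochner_Integration.integral_cnj[symmetric]) (simp add: cnj_mode)

lemma fourier_coeff_cong_AE:
  assumes "AE x in lborel. f x = g x" "f \<in> borel_measurable borel" "g \<in> borel_measurable borel"
  shows "\<F> f k = \<F> g k"
proof -
  have [measurable]: "mode (- k) \<in> borel_measurable borel"
    by (intro borel_measurable_continuous_onI continuous_intros)
  note [measurable] = assms(2,3)
  show ?thesis
    unfolding fourier_coeff_eq set_lebesgue_integral_def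
    by (rule integral_cong_AE) (use assms(1) in auto)
qed

lemma set_integrable_mode:
  assumes "set_integrable lborel {0..1} f"
  shows "set_integrable lborel {0..1} (\<lambda>x. complex_of_real (f x) * mode k x)"
proof -
  have [measurable]: "mode k \<in> borel_measurable borel"
    by (intro borel_measurable_continuous_onI continuous_intros)
  have f: "integrable lborel (\<lambda>x. indicat_real {0..1} x *\<^sub>R f x)"
    using assms by (simp add: set_integrable_def)
  have [measurable]: "(\<lambda>x. indicat_real {0..1} x *\<^sub>R f x) \<in> borel_measurable lborel"
    using f by auto
  have "integrable lborel (\<lambda>x. complex_of_real (indicat_real {0..1} x *\<^sub>R f x) * mode k x)"
  proof (rule Bochner_Integration.integrable_bound[OF f])
    show "(\<lambda>x. complex_of_real (indicat_real {0..1} x *\<^sub>R f x) * mode k x) \<in> borel_measurable lborel"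
      by measurable
  qed (auto simp: norm_mult)
  then show ?thesis
    by (simp add: set_integrable_def scaleR_conv_of_real mult.assoc)
qed

lemma fourier_coeff_diff:
  assumes "set_integrable lborel {0..1} f" "set_integrable lborel {0..1} g"
  shows "\<F> (\<lambda>x. f x - g x) k = \<F> f k - \<F> g k"
  unfolding fourier_coeff_eq
  using set_integral_diff(2)[OF set_integrable_mode[OF assms(1)] set_integrable_mode[OF assms(2)]]
  by (simp add: left_diff_distrib)

lemma fourier_coeff_add:
  assumes "set_integrable lborel {0..1} f" "set_integrable lborel {0..1} g"
  shows "\<F> (\<lambda>x. f x + g x) k = \<F> f k + \<F> g k"
  unfolding fourier_coeff_eq
  using set_integral_add(2)[OF set_integrable_mode[OF assms(1)] set_integrable_mode[OF assms(2)]]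
  by (simp add: distrib_right)

lemma fourier_coeff_cmult:
  "\<F> (\<lambda>x. c * f x) k = complex_of_real c * \<F> f k"
  unfolding fourier_coeff_eq by (simp add: mult.assoc)

lemma fourier_coeff_const: "\<F> (\<lambda>x. c) k = (if k = 0 then of_real c else 0)"
  using integral_mode[of "- k"] by (subst fourier_coeff_continuous) auto

lemma set_integrable_continuous:
  fixes f :: "real \<Rightarrow> real"
  assumes "continuous_on UNIV f"
  shows "set_integrable lborel {a..b} f"
  by (intro borel_integrable_atLeastAtMost') (use assms continuous_on_subset in blast)

text \<open>Integration by parts; the boundary terms cancel by periodicity.\<close>

lemma fourier_coeff_deriv:
  assumes per: "f 1 = f 0"
    and f': "\<And>x. (f has_real_derivative f' x) (at x)" and cont: "continuous_on UNIV f'"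
  shows "\<F> f' k = 2 * pi * \<i> * of_int k * \<F> f k"
proof -
  have contf: "continuous_on UNIV f"
    using f' by (meson DERIV_continuous_on has_field_derivative_at_within)
  define F where "F x = complex_of_real (f x) * mode (- k) x" for x
  have d: "((\<lambda>x. complex_of_real (f x)) has_vector_derivative complex_of_real (f' x)) (at x within {0..1})" for x
    using f'[of x] by (intro has_vector_derivative_of_real)
      (auto simp: has_real_derivative_iff_has_vector_derivative intro: has_vector_derivative_at_within)
  have "(F has_vector_derivative
     (of_real (f x) * (2 * pi * \<i> * of_int (- k) * mode (- k) x) + of_real (f' x) * mode (- k) x)) (at x within {0..1})" for x
    unfolding F_def
    by (rule has_vector_derivative_mult[OF d mode_has_vector_derivative])
  then have "((\<lambda>x. of_real (f x) * (2 * pi * \<i> * of_int (- k) * mode (- k) x) + of_real (f' x) * mode (- k) x)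
      has_integral F 1 - F 0) {0..1}"
    by (intro fundamental_theorem_of_calculus) auto
  moreover have "F 1 - F 0 = 0"
    using per by (simp add: F_def)
  moreover have "(\<lambda>x. of_real (f x) * (2 * pi * \<i> * of_int (- k) * mode (- k) x) + of_real (f' x) * mode (- k) x)
      = (\<lambda>x. (- (2 * pi * \<i> * of_int k)) * (of_real (f x) * mode (- k) x) + of_real (f' x) * mode (- k) x)"
    by (simp add: fun_eq_iff)
  ultimately have A: "((\<lambda>x. (- (2 * pi * \<i> * of_int k)) * (of_real (f x) * mode (- k) x) + of_real (f' x) * mode (- k) x)
      has_integral 0) {0..1}"
    by simp
  have "continuous_on {0..1} f" "continuous_on {0..1} f'"
    using contf cont continuous_on_subset by blast+
  then have B: "((\<lambda>x. (- (2 * pi * \<i> * of_int k)) * (of_real (f x) * mode (- k) x) + of_real (f' x) * mode (- k) x)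
      has_integral (- (2 * pi * \<i> * of_int k)) * \<F> f k + \<F> f' k) {0..1}"
    unfolding fourier_coeff_continuous[OF contf] fourier_coeff_continuous[OF cont]
    by (intro has_integral_add has_integral_mult_right integrable_integral
        integrable_continuous_real continuous_intros)
  have "(- (2 * pi * \<i> * of_int k)) * \<F> f k + \<F> f' k = 0"
    by (rule has_integral_unique[OF B A])
  then have "\<F> f' k = - ((- (2 * pi * \<i> * of_int k)) * \<F> f k)"
    by (rule minus_unique[symmetric])
  then show ?thesis
    by simp
qed

section \<open>Uniqueness, inversion and products\<close>

lemma periodic_of_int:
  fixes f :: "real \<Rightarrow> 'a"
  assumes "\<And>x. f (x + 1) = f x"
  shows "f (x + of_int n) = f x"
proof (induction n rule: int_induct[of _ 0])
  case base
  then show ?case by simp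
next
  case (step1 i)
  then show ?case
    using assms[of "x + of_int i"] by (simp add: add.assoc)
next
  case (step2 i)
  then show ?case
    using assms[of "x + of_int (i - 1)"] by (simp add: algebra_simps)
qed

text \<open>
  The orthogonality to all modes survives multiplication by a polynomial in the coordinates of
  the circle, since the coordinates are combinations of the modes of index \<open>1\<close> and \<open>-1\<close>.
\<close>

lemma orthogonal_modes_mult_polynomial:
  assumes "real_polynomial_function p"
    and "continuous_on {0..1} \<phi>" and "\<And>k. integral {0..1} (\<lambda>x. \<phi> x * mode k x) = 0"
  shows "continuous_on {0..1} (\<lambda>x. \<phi> x * complex_of_real (p (mode 1 x))) \<and>
         (\<forall>k. integral {0..1} (\<lambda>x. \<phi> x * complex_of_real (p (mode 1 x)) * mode k x) = 0)"
  using assms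
proof (induction p arbitrary: \<phi>)
  case (linear p)
  define a b where "a = (p 1 - \<i> * p \<i>) / 2" and "b = (p 1 + \<i> * p \<i>) / 2"
  have p: "complex_of_real (p (mode 1 x)) = a * mode 1 x + b * mode (- 1) x" for x
  proof -
    have "p (mode 1 x) = p (Re (mode 1 x) *\<^sub>R 1 + Im (mode 1 x) *\<^sub>R \<i>)"
      by (simp add: complex_eq[symmetric] scaleR_conv_of_real mult.commute)
    also have "\<dots> = Re (mode 1 x) * p 1 + Im (mode 1 x) * p \<i>"
      by (simp add: linear_add linear_scale bounded_linear.linear[OF linear(1)])
    finally show ?thesis
      by (simp add: a_def b_def complex_eq_iff mode_def field_simps)
  qed
  have "integral {0..1} (\<lambda>x. \<phi> x * complex_of_real (p (mode 1 x)) * mode k x) = 0" for k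
  proof -
    have "(\<lambda>x. \<phi> x * complex_of_real (p (mode 1 x)) * mode k x)
      = (\<lambda>x. a * (\<phi> x * mode (1 + k) x) + b * (\<phi> x * mode (- 1 + k) x))"
      unfolding p mode_add by (simp add: algebra_simps)
    moreover have "((\<lambda>x. a * (\<phi> x * mode (1 + k) x) + b * (\<phi> x * mode (- 1 + k) x))
        has_integral a * 0 + b * 0) {0..1}"
      using linear(2) linear(3)[symmetric]
      by (intro has_integral_add has_integral_mult_right)
         (auto intro!: integrable_integral integrable_continuous_real continuous_intros
           simp: has_integral_iff)
    ultimately show ?thesis
      by (simp add: integral_unique)
  qed
  moreover have "continuous_on {0..1} (\<lambda>x. \<phi> x * complex_of_real (p (mode 1 x)))"
    unfolding p by (intro continuous_intros linear)
  ultimately show ?case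
    by blast
next
  case (const c)
  have "continuous_on {0..1} (\<lambda>x. \<phi> x * complex_of_real c)"
    by (intro continuous_intros const)
  moreover have "integral {0..1} (\<lambda>x. \<phi> x * complex_of_real c * mode k x) = 0" for k
    using const(2)[of k] integral_mult_right[of "{0..1}" "complex_of_real c" "\<lambda>x. \<phi> x * mode k x"]
    by (simp add: mult_ac)
  ultimately show ?case by blast
next
  case (add p q)
  note p = add.IH(1)[OF add.prems] and q = add.IH(2)[OF add.prems]
  have "integral {0..1} (\<lambda>x. \<phi> x * complex_of_real (p (mode 1 x)) * mode k x
         + \<phi> x * complex_of_real (q (mode 1 x)) * mode k x) = 0" for k
  proof -
    have "(\<lambda>x. \<phi> x * complex_of_real (p (mode 1 x)) * mode k x) integrable_on {0..1}"
      "(\<lambda>x. \<phi> x * complex_of_real (q (mode 1 x)) * mode k x) integrable_on {0..1}"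
      using p q by (auto intro!: integrable_continuous_real continuous_intros)
    then show ?thesis
      using p q by (simp add: integral_add)
  qed
  moreover have "continuous_on {0..1} (\<lambda>x. \<phi> x * complex_of_real (p (mode 1 x))
         + \<phi> x * complex_of_real (q (mode 1 x)))"
    using p q by (intro continuous_on_add) auto
  ultimately show ?case
    by (simp add: distrib_left distrib_right)
next
  case (mult p q)
  note p = mult.IH(1)[OF mult.prems]
  have "continuous_on {0..1} (\<lambda>x. \<phi> x * complex_of_real (p (mode 1 x)) * complex_of_real (q (mode 1 x)))
    \<and> (\<forall>k. integral {0..1} (\<lambda>x. \<phi> x * complex_of_real (p (mode 1 x)) * complex_of_real (q (mode 1 x)) * mode k x) = 0)"
    by (rule mult.IH(2)) (use p in auto)
  then show ?case
    by (simp add: mult.assoc)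
qed

text \<open>Each of the two branches of the argument is continuous off one half line, and by periodicity
  both branches give the same function on the circle.\<close>

lemma continuous_on_circle:
  fixes f :: "real \<Rightarrow> real"
  assumes f: "continuous_on UNIV f" and per: "\<And>x. f (x + 1) = f x"
  obtains F :: "complex \<Rightarrow> real" where "continuous_on (sphere 0 1) F" "\<And>x. F (mode 1 x) = f x"
proof
  define F where "F z = f (Arg z / (2 * pi))" for z
  have any: "f (a / (2 * pi)) = f (b / (2 * pi))" if "cis a = cis b" for a b
  proof -
    have "sin a = sin b \<and> cos a = cos b"
      using that by (simp add: complex_eq_iff)
    then obtain n :: int where "a = b + 2 * pi * n"
      unfolding sin_cos_eq_iff by blast
    then have "a / (2 * pi) = b / (2 * pi) + of_int n"
      by (simp add: field_simps)
    then show ?thesis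
      using periodic_of_int[of f, OF per] by simp
  qed
  have cis_Arg: "cis (Arg z) = z" "cis (Arg2pi z) = z" if "z \<in> sphere 0 1" for z
  proof -
    have "is_Arg z (Arg z)" "is_Arg z (Arg2pi z)"
      using that Arg2pi[of z] by (auto intro!: is_Arg_Arg)
    then show "cis (Arg z) = z" "cis (Arg2pi z) = z"
      using that by (auto simp: is_Arg_def cis_conv_exp)
  qed
  show "F (mode 1 x) = f x" for x
    using any[OF cis_Arg(1)[of "mode 1 x", unfolded mode_def[of 1]]]
    by (simp add: F_def mode_def)
  have isCont: "isCont f x" for x
    using f by (simp add: continuous_on_eq_continuous_at)
  have "continuous (at z within sphere 0 1) F" if z: "z \<in> sphere 0 1" for z
  proof (cases "z \<in> \<real>\<^sub>\<le>\<^sub>0")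
    case False
    have "isCont (\<lambda>z. f (Arg z / (2 * pi))) z"
      by (intro continuous_at_compose[OF _ isCont, unfolded o_def] continuous_intros
        continuous_at_Arg[OF False]) auto
    then show ?thesis
      unfolding F_def[abs_def] by (rule continuous_at_imp_continuous_at_within)
  next
    case True
    then have "z \<notin> \<real>\<^sub>\<ge>\<^sub>0"
      using z by (auto simp: complex_nonneg_Reals_iff complex_nonpos_Reals_iff cmod_def)
    then have "isCont (\<lambda>z. f (Arg2pi z / (2 * pi))) z"
      by (intro continuous_at_compose[OF _ isCont, unfolded o_def] continuous_intros
        continuous_at_Arg2pi) auto
    then have "continuous (at z within sphere 0 1) (\<lambda>z. f (Arg2pi z / (2 * pi)))"
      by (rule continuous_at_imp_continuous_at_within)
    then show ?thesis
      by (rule continuous_transform_within[where \<delta>=1])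
         (use z in \<open>auto simp: F_def cis_Arg intro!: any\<close>)
  qed
  then show "continuous_on (sphere 0 1) F"
    by (simp add: continuous_on_eq_continuous_within)
qed

text \<open>By the Stone--Weierstrass theorem \<open>f\<close> is a uniform limit of polynomials in the coordinates of
  the circle, and it is orthogonal to each of them; hence it is orthogonal to itself.\<close>

theorem fourier_uniqueness:
  fixes f :: "real \<Rightarrow> real"
  assumes f: "continuous_on UNIV f" and per: "\<And>x. f (x + 1) = f x"
    and zero: "\<And>k. \<F> f k = 0"
  shows "f x = 0"
proof -
  obtain F where F: "continuous_on (sphere 0 1) F" "\<And>x. F (mode 1 x) = f x"
    using continuous_on_circle[OF f per] by blast
  have cf: "continuous_on {0..1} f"
    using f continuous_on_subset by blast
  have small: "integral {0..1} (\<lambda>x. (f x)\<^sup>2) \<le> e * integral {0..1} (\<lambda>x. \<bar>f x\<bar>)" if e: "e > 0" for e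
  proof -
    obtain p where p: "real_polynomial_function p" "\<And>z. z \<in> sphere 0 1 \<Longrightarrow> \<bar>F z - p z\<bar> < e"
      by (rule Stone_Weierstrass_real_polynomial_function[OF compact_sphere F(1) e]) blast
    have "integral {0..1} (\<lambda>x. complex_of_real (f x) * mode k x) = 0" for k
      using zero[of "- k"] by (simp add: fourier_coeff_continuous[OF f])
    then have o: "continuous_on {0..1} (\<lambda>x. complex_of_real (f x) * complex_of_real (p (mode 1 x)))"
       "\<And>k. integral {0..1} (\<lambda>x. complex_of_real (f x) * complex_of_real (p (mode 1 x)) * mode k x) = 0"
      using orthogonal_modes_mult_polynomial[OF p(1), of "\<lambda>x. complex_of_real (f x)"] cf
      by (auto intro!: continuous_intros)
    have "((\<lambda>x. complex_of_real (f x) * complex_of_real (p (mode 1 x))) has_integral 0) {0..1}"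
      using o(2)[of 0] integrable_integral[OF integrable_continuous_real[OF o(1)]] by simp
    from has_integral_linear[OF this bounded_linear_Re]
    have fp: "((\<lambda>x. f x * p (mode 1 x)) has_integral 0) {0..1}"
      by (simp add: o_def)
    have "((\<lambda>x. (f x)\<^sup>2 - f x * p (mode 1 x)) has_integral integral {0..1} (\<lambda>x. (f x)\<^sup>2) - 0) {0..1}"
      by (intro has_integral_diff fp integrable_integral integrable_continuous_real continuous_intros cf)
    moreover have "((\<lambda>x. e * \<bar>f x\<bar>) has_integral e * integral {0..1} (\<lambda>x. \<bar>f x\<bar>)) {0..1}"
      by (intro has_integral_mult_right integrable_integral integrable_continuous_real continuous_intros cf)
    moreover have "(f x)\<^sup>2 - f x * p (mode 1 x) \<le> e * \<bar>f x\<bar>" for x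
    proof -
      have "(f x)\<^sup>2 - f x * p (mode 1 x) = f x * (F (mode 1 x) - p (mode 1 x))"
        by (simp add: F(2) power2_eq_square algebra_simps)
      also have "\<dots> \<le> \<bar>f x\<bar> * \<bar>F (mode 1 x) - p (mode 1 x)\<bar>"
        by (simp flip: abs_mult)
      also have "\<dots> \<le> \<bar>f x\<bar> * e"
        using p(2)[of "mode 1 x"] by (intro mult_left_mono) auto
      finally show ?thesis by (simp add: mult.commute)
    qed
    ultimately have "integral {0..1} (\<lambda>x. (f x)\<^sup>2) - 0 \<le> e * integral {0..1} (\<lambda>x. \<bar>f x\<bar>)"
      by (rule has_integral_le)
    then show ?thesis by simp
  qed
  have "integral {0..1} (\<lambda>x. (f x)\<^sup>2) \<le> 0"
  proof (rule field_le_epsilon)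
    fix d :: real assume d: "d > 0"
    define I where "I = integral {0..1} (\<lambda>x. \<bar>f x\<bar>)"
    have I: "I \<ge> 0"
      unfolding I_def by (intro integral_nonneg integrable_continuous_real continuous_intros cf) auto
    have "integral {0..1} (\<lambda>x. (f x)\<^sup>2) \<le> (d / (1 + I)) * I"
      unfolding I_def by (rule small) (use d I in \<open>simp add: I_def\<close>)
    also have "\<dots> \<le> d"
      using d I by (simp add: field_simps)
    finally show "integral {0..1} (\<lambda>x. (f x)\<^sup>2) \<le> 0 + d" by simp
  qed
  moreover have "integral {0..1} (\<lambda>x. (f x)\<^sup>2) \<ge> 0"
    by (intro integral_nonneg integrable_continuous_real continuous_intros cf) auto
  ultimately have "integral {0..1} (\<lambda>x. (f x)\<^sup>2) = 0" by simp
  moreover have "continuous_on {0..1} (\<lambda>x. (f x)\<^sup>2)"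
    by (intro continuous_intros cf)
  ultimately have z: "f y = 0" if "y \<in> {0..1}" for y
    using integral_eq_0_iff[of 0 1 "\<lambda>x. (f x)\<^sup>2"] that by auto
  have "f (frac x) = 0"
    using frac_lt_1[of x] by (intro z) auto
  then show ?thesis
    using periodic_of_int[of f, OF per, of "frac x" "\<lfloor>x\<rfloor>"] by (simp add: frac_def)
qed

text \<open>The Wiener algebra of the circle. Its members are the continuous representatives, so that a
  function is the sum of its Fourier series at every point.\<close>

definition wiener :: "(real \<Rightarrow> real) \<Rightarrow> bool" where
  "wiener f \<longleftrightarrow> continuous_on UNIV f \<and> (\<forall>x. f (x + 1) = f x) \<and>
     (\<lambda>k. norm (\<F> f k)) summable_on UNIV"

lemma wienerD:
  assumes "wiener f"
  shows "continuous_on A f" "f (x + 1) = f x" "(\<lambda>k. norm (\<F> f k)) summable_on UNIV"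
  using assms continuous_on_subset unfolding wiener_def by blast+

lemma wiener_has_sum:
  assumes "wiener f"
  shows "((\<lambda>k. \<F> f k * mode k x) has_sum complex_of_real (f x)) UNIV"
proof -
  note f = wienerD[OF assms]
  define g where "g x = (\<Sum>\<^sub>\<infinity>k. \<F> f k * mode k x)" for x
  have gcont: "continuous_on A g" for A
    unfolding g_def[abs_def] by (rule continuous_on_mode_series[OF f(3)])
  have "cnj (g x) = g x" for x
  proof -
    have "cnj (g x) = (\<Sum>\<^sub>\<infinity>k. \<F> f (- k) * mode (- k) x)"
      unfolding g_def by (simp flip: infsum_cnj add: fourier_coeff_uminus cnj_mode)
    also have "\<dots> = g x"
      unfolding g_def
      by (rule infsum_reindex_bij_witness[of _ uminus uminus]) auto
    finally show ?thesis .
  qed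
  then have gR: "complex_of_real (Re (g x)) = g x" for x
    by (metis Reals_cnj_iff of_real_Re)
  have Rcont: "continuous_on A (\<lambda>x. Re (g x))" for A
    by (intro continuous_intros gcont)
  have gper: "g (x + 1) = g x" for x
    by (simp add: g_def mode_periodic)
  have "\<F> (\<lambda>x. Re (g x)) k = \<F> f k" for k
    using coeff_mode_series[OF f(3), of k]
    unfolding fourier_coeff_continuous[OF Rcont] gR by (simp add: g_def mult.commute)
  then have "\<F> (\<lambda>x. f x - Re (g x)) k = 0" for k
    by (subst fourier_coeff_diff) (auto intro!: set_integrable_continuous f Rcont)
  then have "f x - Re (g x) = 0"
    by (intro fourier_uniqueness[where f="\<lambda>x. f x - Re (g x)"])
       (auto intro!: continuous_intros f Rcont simp: f gper)
  then have "complex_of_real (f x) = g x"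
    by (metis gR right_minus_eq)
  then show ?thesis
    using abs_summable_mode[OF f(3), of x] by (simp add: g_def)
qed

lemma wiener_abs_le:
  assumes "wiener f"
  shows "\<bar>f x\<bar> \<le> (\<Sum>\<^sub>\<infinity>k. norm (\<F> f k))"
proof -
  have "norm (complex_of_real (f x)) \<le> (\<Sum>\<^sub>\<infinity>k. norm (\<F> f k * mode k x))"
    using norm_infsum_bound[of "\<lambda>k. \<F> f k * mode k x" UNIV] wienerD(3)[OF assms]
      infsumI[OF wiener_has_sum[OF assms, of x]]
    by (simp add: norm_mult)
  then show ?thesis
    by (simp add: norm_mult)
qed

text \<open>The series differentiated term by term is continuous, and its integral from \<open>a\<close> to \<open>b\<close> is \<open>f b - f a\<close>.\<close>

lemma wiener_deriv:
  assumes w: "wiener f" and sum: "(\<lambda>k. norm (of_int k * \<F> f k)) summable_on UNIV"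
  shows "(f has_real_derivative deriv f x) (at x)"
    and "\<F> (deriv f) k = 2 * pi * \<i> * of_int k * \<F> f k"
    and "wiener (deriv f)"
proof -
  note f = wienerD[OF w]
  define c where "c k = 2 * pi * \<i> * of_int k * \<F> f k" for k
  have c: "(\<lambda>k. norm (c k)) summable_on UNIV"
    using summable_on_cmult_right[OF sum, of "2 * pi"] by (simp add: c_def norm_mult mult.assoc)
  define G where "G x = (\<Sum>\<^sub>\<infinity>k. c k * mode k x)" for x
  have Gcont: "continuous_on A G" for A
    unfolding G_def[abs_def] by (rule continuous_on_mode_series[OF c])
  have int: "integral {a..b} G = of_real (f b) - of_real (f a)" if "a \<le> b" for a b
  proof -
    have "((\<lambda>k. c k * integral {a..b} (\<lambda>x. 1 * mode k x)) has_sum integral {a..b} (\<lambda>x. 1 * G x)) UNIV"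
      unfolding G_def by (intro integral_mode_series c continuous_intros)
    moreover have "c k * integral {a..b} (\<lambda>x. 1 * mode k x)
        = \<F> f k * mode k b - \<F> f k * mode k a" for k
    proof -
      have "((\<lambda>x. 2 * pi * \<i> * of_int k * mode k x) has_integral mode k b - mode k a) {a..b}"
        by (intro fundamental_theorem_of_calculus that mode_has_vector_derivative)
      from integral_unique[OF this] have "2 * pi * \<i> * of_int k * integral {a..b} (mode k) = mode k b - mode k a"
        by simp
      moreover have "c k * integral {a..b} (\<lambda>x. 1 * mode k x)
          = (2 * pi * \<i> * of_int k * integral {a..b} (mode k)) * \<F> f k"
        by (simp add: c_def mult_ac)
      ultimately show ?thesis
        by (simp only: right_diff_distrib mult.commute)
    qed
    moreover have "((\<lambda>k. \<F> f k * mode k b - \<F> f k * mode k a) has_sum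
        (of_real (f b) - of_real (f a))) UNIV"
      using has_sum_add[OF wiener_has_sum[OF w, of b] has_sum_uminusI[OF wiener_has_sum[OF w, of a]]]
      by simp
    ultimately show ?thesis
      using has_sum_unique by fastforce
  qed
  have d: "(f has_real_derivative Re (G x)) (at x)" for x
  proof -
    define a where "a = x - 1"
    have "((\<lambda>y. integral {a..y} G) has_vector_derivative G x) (at x within {a..x+1})"
      by (rule integral_has_vector_derivative[OF Gcont]) (auto simp: a_def)
    then have "((\<lambda>y. integral {a..y} G) has_vector_derivative G x) (at x)"
      by (simp add: at_within_Icc_at a_def)
    then have "((\<lambda>y. Re (integral {a..y} G)) has_vector_derivative Re (G x)) (at x)"
      by (rule bounded_linear.has_vector_derivative[OF bounded_linear_Re])
    then have "((\<lambda>y. f a + Re (integral {a..y} G)) has_real_derivative Re (G x)) (at x)"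
      by (auto intro!: derivative_eq_intros simp: has_real_derivative_iff_has_vector_derivative)
    then show ?thesis
      by (rule has_field_derivative_transform_within[where d=1])
         (auto simp: a_def int dist_real_def)
  qed
  have dG: "deriv f = (\<lambda>x. Re (G x))"
    using d by (auto simp: fun_eq_iff intro!: DERIV_imp_deriv)
  show "(f has_real_derivative deriv f x) (at x)"
    unfolding dG by (rule d)
  have cont: "continuous_on UNIV (deriv f)"
    unfolding dG by (intro continuous_intros Gcont)
  show *: "\<F> (deriv f) k = 2 * pi * \<i> * of_int k * \<F> f k" for k
    by (rule fourier_coeff_deriv[OF _ _ cont]) (use f(2)[of 0] d dG in auto)
  have "deriv f (x + 1) = deriv f x" for x
    by (simp add: dG G_def mode_periodic)
  then show "wiener (deriv f)"
    using cont c unfolding wiener_def * c_def by simp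
qed

lemma parseval:
  assumes w: "wiener f" and g: "continuous_on UNIV g"
  shows "((\<lambda>k. cnj (\<F> f k) * \<F> g k) has_sum
           complex_of_real (integral {0..1} (\<lambda>x. f x * g x))) UNIV"
proof -
  have cg: "continuous_on {0..1} g"
    using g continuous_on_subset by blast
  have "((\<lambda>k. \<F> f k * integral {0..1} (\<lambda>x. complex_of_real (g x) * mode k x)) has_sum
            integral {0..1} (\<lambda>x. complex_of_real (g x) * (\<Sum>\<^sub>\<infinity>k. \<F> f k * mode k x))) UNIV"
    by (intro integral_mode_series wienerD(3)[OF w] continuous_intros cg)
  moreover have "integral {0..1} (\<lambda>x. complex_of_real (g x) * mode k x) = cnj (\<F> g k)" for k
    using fourier_coeff_uminus[of g k] by (simp add: fourier_coeff_continuous[OF g])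
  moreover have "integral {0..1} (\<lambda>x. complex_of_real (g x) * (\<Sum>\<^sub>\<infinity>k. \<F> f k * mode k x))
      = complex_of_real (integral {0..1} (\<lambda>x. f x * g x))"
  proof -
    have "((\<lambda>x. complex_of_real (f x * g x)) has_integral complex_of_real (integral {0..1} (\<lambda>x. f x * g x))) {0..1}"
      by (intro has_integral_of_real integrable_integral integrable_continuous_real continuous_intros
          cg wienerD(1)[OF w])
    then show ?thesis
      using infsumI[OF wiener_has_sum[OF w]] by (simp add: integral_unique mult.commute)
  qed
  ultimately have "((\<lambda>k. cnj (\<F> f k * cnj (\<F> g k))) has_sum
      cnj (complex_of_real (integral {0..1} (\<lambda>x. f x * g x)))) UNIV"
    unfolding has_sum_cnj_iff by simp
  then show ?thesis by simp
qed

lemma fourier_coeff_mult: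
  assumes w: "wiener f" and g: "continuous_on UNIV g"
  shows "((\<lambda>m. \<F> f m * \<F> g (k - m)) has_sum
           \<F> (\<lambda>x. f x * g x) k) UNIV"
proof -
  have cg: "continuous_on {0..1} g"
    using g continuous_on_subset by blast
  have "((\<lambda>m. \<F> f m * integral {0..1} (\<lambda>x. complex_of_real (g x) * mode (- k) x * mode m x)) has_sum
      integral {0..1} (\<lambda>x. complex_of_real (g x) * mode (- k) x * (\<Sum>\<^sub>\<infinity>m. \<F> f m * mode m x))) UNIV"
    by (intro integral_mode_series wienerD(3)[OF w] continuous_intros cg)
  moreover have "integral {0..1} (\<lambda>x. complex_of_real (g x) * mode (- k) x * mode m x) = \<F> g (k - m)" for m
    unfolding fourier_coeff_continuous[OF g] by (simp add: mult.assoc flip: mode_add)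
  moreover have "\<F> (\<lambda>x. f x * g x) k
     = integral {0..1} (\<lambda>x. complex_of_real (g x) * mode (- k) x * (\<Sum>\<^sub>\<infinity>m. \<F> f m * mode m x))"
    using infsumI[OF wiener_has_sum[OF w]]
    by (subst fourier_coeff_continuous) (auto intro!: continuous_intros g wienerD(1)[OF w] simp: mult_ac)
  ultimately show ?thesis by simp
qed

section \<open>Trilinear sums over the integers\<close>

text \<open>Summability is part of the statement because a divergent sum has the value \<open>0\<close> by convention, so
  that a bound for the value alone would be void.\<close>

definition sum_bounded_by :: "('a \<Rightarrow> real) \<Rightarrow> real \<Rightarrow> bool" where
  "sum_bounded_by F B \<longleftrightarrow> F summable_on UNIV \<and> infsum F UNIV \<le> B"

lemma sum_bounded_by_mono:
  assumes "sum_bounded_by G B" "\<And>x. 0 \<le> F x" "\<And>x. F x \<le> G x" "B \<le> C"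
  shows "sum_bounded_by F C"
proof -
  have F: "F summable_on UNIV"
    using assms by (auto simp: sum_bounded_by_def intro: summable_on_comparison_test)
  have "infsum F UNIV \<le> infsum G UNIV"
    using assms F by (intro infsum_mono) (auto simp: sum_bounded_by_def)
  then show ?thesis
    using assms F by (auto simp: sum_bounded_by_def)
qed

lemma sum_bounded_by_add:
  assumes "sum_bounded_by F A" "sum_bounded_by G B"
  shows "sum_bounded_by (\<lambda>x. F x + G x) (A + B)"
  using assms by (auto simp: sum_bounded_by_def infsum_add intro: summable_on_add)

lemma sum_bounded_by_cmult:
  assumes "sum_bounded_by F A" "0 \<le> c"
  shows "sum_bounded_by (\<lambda>x. c * F x) (c * A)"
  using assms
  by (auto simp: sum_bounded_by_def infsum_cmult_right' intro: summable_on_cmult_right mult_left_mono)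

lemma sum_bounded_by_reindex:
  assumes "sum_bounded_by F A" "bij h"
  shows "sum_bounded_by (\<lambda>x. F (h x)) A"
  using assms summable_on_reindex_bij_betw[of h UNIV UNIV F] infsum_reindex_bij_betw[of h UNIV UNIV F]
  by (simp add: sum_bounded_by_def)

lemma sum_bounded_by_norm_infsum:
  fixes f :: "'a \<Rightarrow> complex"
  assumes "sum_bounded_by (\<lambda>x. norm (f x)) B"
  shows "norm (infsum f UNIV) \<le> B"
  using assms norm_infsum_bound[of f UNIV] by (auto simp: sum_bounded_by_def)

lemma summable_on_shift_int:
  fixes f :: "int \<Rightarrow> 'a :: {topological_comm_monoid_add, t2_space}"
  shows "(\<lambda>k. f (m + k)) summable_on UNIV \<longleftrightarrow> f summable_on UNIV"
    and "(\<Sum>\<^sub>\<infinity>k. f (m + k)) = infsum f UNIV"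
proof -
  have "bij_betw (\<lambda>k. m + k) UNIV (UNIV :: int set)"
    by (rule bij_betwI[of _ _ _ "\<lambda>k. k - m"]) auto
  from summable_on_reindex_bij_betw[OF this, of f] infsum_reindex_bij_betw[OF this, of f]
  show "(\<lambda>k. f (m + k)) summable_on UNIV \<longleftrightarrow> f summable_on UNIV"
    "(\<Sum>\<^sub>\<infinity>k. f (m + k)) = infsum f UNIV"
    by simp_all
qed

text \<open>
  Young's inequality for \<open>\<ell>\<^sup>1 * \<ell>\<^sup>2 \<subseteq> \<ell>\<^sup>2\<close>, tested against \<open>\<ell>\<^sup>2\<close>. Bounding products by half the sum of
  the squares gives energies on the right-hand side, as Gronwall's inequality requires. The two
  variants that follow put the summable factor on another one of the three indices \<open>m\<close>, \<open>j\<close>, \<open>m + j\<close>.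
\<close>

lemma young_trilinear:
  fixes p x y :: "int \<Rightarrow> real"
  assumes p: "p summable_on UNIV" "\<And>k. 0 \<le> p k"
    and x: "(\<lambda>k. (x k)\<^sup>2) summable_on UNIV" and y: "(\<lambda>k. (y k)\<^sup>2) summable_on UNIV"
  shows "sum_bounded_by (\<lambda>(m, j). p m * (\<bar>x (m + j)\<bar> * \<bar>y j\<bar>))
    (infsum p UNIV * ((\<Sum>\<^sub>\<infinity>k. (x k)\<^sup>2) + (\<Sum>\<^sub>\<infinity>k. (y k)\<^sup>2)) / 2)"
proof -
  define S where "S = ((\<Sum>\<^sub>\<infinity>k. (x k)\<^sup>2) + (\<Sum>\<^sub>\<infinity>k. (y k)\<^sup>2)) / 2"
  define M where "M = (\<lambda>(m, j). p m * (((x (m + j))\<^sup>2 + (y j)\<^sup>2) / 2))"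
  have inner: "((\<lambda>j. M (m, j)) has_sum p m * S) UNIV" for m
  proof -
    have "((\<lambda>j. (x (m + j))\<^sup>2) has_sum (\<Sum>\<^sub>\<infinity>k. (x k)\<^sup>2)) UNIV"
      using x summable_on_shift_int[of "\<lambda>k. (x k)\<^sup>2" m] by (simp add: has_sum_iff)
    from has_sum_add[OF this has_sum_infsum[OF y]]
    have "((\<lambda>j. p m * (((x (m + j))\<^sup>2 + (y j)\<^sup>2) / 2)) has_sum p m * S) UNIV"
      unfolding S_def by (intro has_sum_cmult_right has_sum_divide_const)
    then show ?thesis
      by (simp add: M_def)
  qed
  have outer: "((\<lambda>m. p m * S) has_sum infsum p UNIV * S) UNIV"
    by (intro has_sum_cmult_left has_sum_infsum p)
  have "M summable_on UNIV \<times> UNIV"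
    by (rule summable_on_SigmaI[OF inner]) (use outer p in \<open>auto simp: summable_on_def M_def\<close>)
  with has_sum_SigmaI[OF inner outer] have "(M has_sum infsum p UNIV * S) UNIV"
    by simp
  then have "sum_bounded_by M (infsum p UNIV * S)"
    by (simp add: sum_bounded_by_def has_sum_iff)
  then show ?thesis
  proof (rule sum_bounded_by_mono)
    show "(case z of (m, j) \<Rightarrow> p m * (\<bar>x (m + j)\<bar> * \<bar>y j\<bar>)) \<le> M z" for z
    proof -
      have "\<bar>a\<bar> * \<bar>b\<bar> \<le> (a\<^sup>2 + b\<^sup>2) / 2" for a b :: real
        using sum_squares_bound[of "\<bar>a\<bar>" "\<bar>b\<bar>"] by simp
      then show ?thesis
        unfolding M_def case_prod_unfold by (intro mult_left_mono p)
    qed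
  qed (auto simp: S_def p intro!: mult_nonneg_nonneg)
qed

lemma young_trilinear_right:
  fixes p x y :: "int \<Rightarrow> real"
  assumes p: "p summable_on UNIV" "\<And>k. 0 \<le> p k"
    and x: "(\<lambda>k. (x k)\<^sup>2) summable_on UNIV" and y: "(\<lambda>k. (y k)\<^sup>2) summable_on UNIV"
  shows "sum_bounded_by (\<lambda>(m, j). p j * (\<bar>x (m + j)\<bar> * \<bar>y m\<bar>))
    (infsum p UNIV * ((\<Sum>\<^sub>\<infinity>k. (x k)\<^sup>2) + (\<Sum>\<^sub>\<infinity>k. (y k)\<^sup>2)) / 2)"
proof -
  have "bij (\<lambda>(m, j). (j, m) :: int \<times> int)"
    by (rule bij_betwI[of _ _ _ "\<lambda>(m, j). (j, m)"]) auto
  from sum_bounded_by_reindex[OF young_trilinear[OF assms] this] show ?thesis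
    by (simp add: case_prod_unfold add.commute)
qed

lemma young_trilinear_sum:
  fixes p x y :: "int \<Rightarrow> real"
  assumes p: "p summable_on UNIV" "\<And>k. 0 \<le> p k"
    and x: "(\<lambda>k. (x k)\<^sup>2) summable_on UNIV" and y: "(\<lambda>k. (y k)\<^sup>2) summable_on UNIV"
  shows "sum_bounded_by (\<lambda>(m, j). p (m + j) * (\<bar>x m\<bar> * \<bar>y j\<bar>))
    (infsum p UNIV * ((\<Sum>\<^sub>\<infinity>k. (x k)\<^sup>2) + (\<Sum>\<^sub>\<infinity>k. (y k)\<^sup>2)) / 2)"
proof -
  have neg: "bij_betw uminus UNIV (UNIV :: int set)"
    by (rule bij_betwI[of _ _ _ uminus]) auto
  have "(\<lambda>k. p (- k)) summable_on UNIV" "(\<lambda>k. (y (- k))\<^sup>2) summable_on UNIV"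
    using summable_on_reindex_bij_betw[OF neg, of p] summable_on_reindex_bij_betw[OF neg, of "\<lambda>k. (y k)\<^sup>2"]
      p y by simp_all
  note Y = young_trilinear[of "\<lambda>k. p (- k)" "\<lambda>k. y (- k)" x, OF this(1) p(2) this(2) x]
  have "bij (\<lambda>(m, j). (- (m + j), m) :: int \<times> int)"
    by (rule bij_betwI[of _ _ _ "\<lambda>(a, b). (b, - a - b)"]) auto
  from sum_bounded_by_reindex[OF Y this] show ?thesis
    using infsum_reindex_bij_betw[OF neg, of p] infsum_reindex_bij_betw[OF neg, of "\<lambda>k. (y k)\<^sup>2"]
    by (simp add: case_prod_unfold mult_ac add_ac)
qed

text \<open>Pairing a sequence with a convolution, as a double sum over the two indices of the factors;
  the symmetries used below are bijections of these pairs.\<close>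

lemma has_sum_convolution_pairing:
  fixes a b c g :: "int \<Rightarrow> complex"
  assumes \<Phi>: "(\<lambda>(m, j). b (m + j) * (a m * c j)) summable_on UNIV"
    and g: "\<And>k. ((\<lambda>m. a m * c (k - m)) has_sum g k) UNIV"
  shows "((\<lambda>k. b k * g k) has_sum (\<Sum>\<^sub>\<infinity>(m, j). b (m + j) * (a m * c j))) UNIV"
proof -
  define S where "S = (\<Sum>\<^sub>\<infinity>(m, j). b (m + j) * (a m * c j))"
  have "((\<lambda>(m, j). b (m + j) * (a m * c j)) has_sum S) UNIV"
    using \<Phi> by (simp add: S_def)
  then have "((\<lambda>(k, m). b k * (a m * c (k - m))) has_sum S) UNIV"
    by (subst has_sum_reindex_bij_witness[where j="\<lambda>(k, m). (m, k - m)" and i="\<lambda>(m, j). (m + j, m)"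
        and T=UNIV and h="\<lambda>(m, j). b (m + j) * (a m * c j)" and s'=S]) auto
  then have "((\<lambda>(k, m). b k * (a m * c (k - m))) has_sum S) (UNIV \<times> UNIV)"
    by simp
  then have "((\<lambda>k. b k * g k) has_sum S) UNIV"
    by (rule has_sum_SigmaD) (auto intro!: has_sum_cmult_right g)
  then show ?thesis
    by (simp add: S_def)
qed

text \<open>
  In the pairing of \<open>c\<close> with \<open>a c'\<close> in a weighted \<open>\<ell>\<^sup>2\<close> space, \<open>a\<close> the sequence of a real function, the
  derivative is moved from \<open>c\<close> to \<open>a\<close>: exchanging the two occurrences of \<open>c\<close> (by
  \<open>(m, j) \<mapsto> (- m, m + j)\<close>) antisymmetrises the symbol.
\<close>

lemma transport_symmetrised:
  fixes a c g :: "int \<Rightarrow> complex" and \<omega> :: "int \<Rightarrow> real"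
  assumes a: "\<And>m. a (- m) = cnj (a m)"
    and \<Phi>: "(\<lambda>(m, j). norm (\<omega> (m + j) * cnj (c (m + j)) * (a m * (2 * pi * \<i> * of_int j * c j)))) summable_on UNIV"
    and g: "\<And>k. ((\<lambda>m. a m * (2 * pi * \<i> * of_int (k - m) * c (k - m))) has_sum g k) UNIV"
  obtains S where "((\<lambda>k. \<omega> k * cnj (c k) * g k) has_sum S) UNIV"
    "((\<lambda>(m, j). 2 * pi * \<i> * (\<omega> (m + j) * of_int j - \<omega> j * of_int (m + j)) *
        (cnj (c (m + j)) * a m * c j)) has_sum complex_of_real (2 * Re S)) UNIV"
proof -
  define F where "F = (\<lambda>(m, j). \<omega> (m + j) * cnj (c (m + j)) * (a m * (2 * pi * \<i> * of_int j * c j)))"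
  define S where "S = infsum F UNIV"
  have F: "F summable_on UNIV"
    by (rule abs_summable_summable) (use \<Phi> in \<open>simp add: F_def case_prod_unfold\<close>)
  have 1: "((\<lambda>k. \<omega> k * cnj (c k) * g k) has_sum S) UNIV"
    unfolding S_def F_def
    by (rule has_sum_convolution_pairing[where b="\<lambda>k. \<omega> k * cnj (c k)" and c="\<lambda>j. 2 * pi * \<i> * of_int j * c j"])
       (use F g in \<open>simp_all add: F_def\<close>)
  have "((\<lambda>z. cnj (F z)) has_sum cnj S) UNIV"
    using F by (simp add: S_def)
  then have "((\<lambda>z. cnj (F ((\<lambda>(m, j). (- m, m + j)) z))) has_sum cnj S) UNIV"
    by (subst has_sum_reindex_bij_witness[where j="\<lambda>(m, j). (- m, m + j)" and i="\<lambda>(m, j). (- m, m + j)"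
        and T=UNIV and h="\<lambda>z. cnj (F z)" and s'="cnj S"]) auto
  then have "((\<lambda>z. F z + cnj (F ((\<lambda>(m, j). (- m, m + j)) z))) has_sum (S + cnj S)) UNIV"
    using F by (intro has_sum_add) (auto simp: S_def)
  moreover have "(\<lambda>z. F z + cnj (F ((\<lambda>(m, j). (- m, m + j)) z)))
     = (\<lambda>(m, j). 2 * pi * \<i> * (\<omega> (m + j) * of_int j - \<omega> j * of_int (m + j)) *
        (cnj (c (m + j)) * a m * c j))"
    by (auto simp: fun_eq_iff F_def a algebra_simps)
  ultimately have "((\<lambda>(m, j). 2 * pi * \<i> * (\<omega> (m + j) * of_int j - \<omega> j * of_int (m + j)) *
        (cnj (c (m + j)) * a m * c j)) has_sum complex_of_real (2 * Re S)) UNIV"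
    by (simp add: complex_add_cnj)
  with 1 show thesis
    by (rule that)
qed

section \<open>The truncated weights\<close>

text \<open>The weight \<open>(1 + \<bar>k\<bar>)\<^sup>r\<close> truncated at the height \<open>N\<^sup>r\<close>. As a power of \<open>min (1 + \<bar>k\<bar>) N\<close> it keeps the triangle
  inequality and the Lipschitz estimate of the full weight, with constants that do not depend on \<open>N\<close>.\<close>

definition cutoff :: "real \<Rightarrow> real \<Rightarrow> int \<Rightarrow> real" where
  "cutoff r N k = min (1 + real_of_int \<bar>k\<bar>) N powr r"

context
  fixes r N :: real
  assumes r: "1 \<le> r" and N: "1 \<le> N"
begin

lemma cutoff_uminus: "cutoff r N (- k) = cutoff r N k"
  by (simp add: cutoff_def)

lemma cutoff_pos: "0 < cutoff r N k"
  using N by (auto simp: cutoff_def min_def)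

lemma cutoff_le: "cutoff r N k \<le> N powr r"
  using N r by (auto simp: cutoff_def intro!: powr_mono2)

lemma cutoff_triangle: "cutoff r N (j + m) \<le> 2 powr r * (cutoff r N j + cutoff r N m)"
proof -
  define b where "b k = min (1 + real_of_int \<bar>k\<bar>) N" for k
  have b: "0 \<le> b k" for k
    using N by (auto simp: b_def)
  have "b (j + m) \<le> 2 * max (b j) (b m)"
    using N by (auto simp: b_def min_def max_def)
  then have "b (j + m) powr r \<le> (2 * max (b j) (b m)) powr r"
    using b r by (intro powr_mono2) auto
  also have "\<dots> = 2 powr r * max (b j) (b m) powr r"
    by (simp add: powr_mult b le_max_iff_disj)
  also have "\<dots> \<le> 2 powr r * (b j powr r + b m powr r)"
    by (intro mult_left_mono) (auto simp: max_def)
  finally show ?thesis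
    by (simp add: cutoff_def b_def)
qed

text \<open>The mean value theorem bounds the difference of the weights by \<open>r \<bar>k - j\<bar> (1 + \<bar>j\<bar>)\<^bsup>r - 1\<^esup>\<close>, and the
  factor \<open>\<bar>k\<bar> \<le> \<bar>j\<bar>\<close> restores the missing power. Beyond the truncation both weights agree.\<close>

lemma cutoff_diff:
  assumes "\<bar>k\<bar> \<le> \<bar>j\<bar>"
  shows "\<bar>real_of_int k\<bar> * (cutoff r N j - cutoff r N k) \<le> r * \<bar>real_of_int (k - j)\<bar> * cutoff r N j"
proof (cases "1 + real_of_int \<bar>k\<bar> < N")
  case False
  moreover have "real_of_int \<bar>k\<bar> \<le> real_of_int \<bar>j\<bar>"
    using assms by linarith
  ultimately have "cutoff r N j = cutoff r N k"
    unfolding cutoff_def by (simp add: min_absorb2)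
  then show ?thesis
    using r cutoff_pos[of j] by simp
next
  case True
  define x y where "x = min (1 + real_of_int \<bar>j\<bar>) N" and "y = 1 + real_of_int \<bar>k\<bar>"
  have y: "cutoff r N k = y powr r" and x: "cutoff r N j = x powr r"
    using True by (auto simp: cutoff_def x_def y_def)
  have xy: "0 < y" "y \<le> x" "\<bar>real_of_int k\<bar> \<le> x" "x - y \<le> \<bar>real_of_int (k - j)\<bar>"
    using True assms by (auto simp: x_def y_def)
  have "x powr r - y powr r \<le> r * (x - y) * x powr (r - 1)"
  proof (cases "x = y")
    case False
    then have "y < x" using xy by simp
    have "\<exists>z. y < z \<and> z < x \<and> x powr r - y powr r = (x - y) * (r * z powr (r - 1))"
      by (rule MVT2[OF \<open>y < x\<close>]) (use xy in \<open>auto intro!: derivative_eq_intros\<close>)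
    then obtain z where z: "y < z" "z < x" "x powr r - y powr r = (x - y) * (r * z powr (r - 1))"
      by blast
    have "z powr (r - 1) \<le> x powr (r - 1)"
      using z xy r by (intro powr_mono2) auto
    then have "(x - y) * (r * z powr (r - 1)) \<le> (x - y) * (r * x powr (r - 1))"
      using xy r by (intro mult_left_mono) auto
    then show ?thesis
      using z by (simp add: mult_ac)
  qed simp
  then have "\<bar>real_of_int k\<bar> * (cutoff r N j - cutoff r N k) \<le> x * (r * (x - y) * x powr (r - 1))"
    unfolding x y using xy r by (intro mult_mono) (auto intro!: powr_mono2)
  also have "\<dots> = r * (x - y) * x powr r"
    using xy powr_add[of x 1 "r - 1"] by simp
  also have "\<dots> \<le> r * \<bar>real_of_int (k - j)\<bar> * cutoff r N j"
    unfolding x using xy r by (intro mult_right_mono mult_left_mono) auto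
  finally show ?thesis .
qed

text \<open>
  The commutator estimate: the symbol \<open>\<omega>(k) j - \<omega>(j) k\<close> with \<open>\<omega> = cutoff\<^sup>2\<close> gains the factor
  \<open>k - j\<close>, with a constant that does not depend on \<open>N\<close>.
\<close>

lemma cutoff_commutator:
  shows "\<bar>(cutoff r N k)\<^sup>2 * real_of_int j - (cutoff r N j)\<^sup>2 * real_of_int k\<bar>
    \<le> (1 + 2 * r) * 2 powr r * \<bar>real_of_int (k - j)\<bar> * (cutoff r N k * cutoff r N j
        + cutoff r N (k - j) * cutoff r N k + cutoff r N (k - j) * cutoff r N j)"
proof -
  \<comment> \<open>Both sides are symmetric in \<open>k\<close> and \<open>j\<close>, so the factor \<open>k\<close> may be taken to be the smaller one.\<close>
  have main: "\<bar>(cutoff r N k)\<^sup>2 * real_of_int j - (cutoff r N j)\<^sup>2 * real_of_int k\<bar>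
    \<le> (1 + 2 * r) * 2 powr r * \<bar>real_of_int (k - j)\<bar> * (cutoff r N k * cutoff r N j
        + cutoff r N (k - j) * cutoff r N k + cutoff r N (k - j) * cutoff r N j)"
    if le: "\<bar>k\<bar> \<le> \<bar>j\<bar>" for k j :: int
  proof -
    define A B D where "A = cutoff r N k" and "B = cutoff r N j" and "D = cutoff r N (k - j)"
    define c where "c = 2 powr r"
    define m where "m = \<bar>real_of_int (k - j)\<bar>"
    have c: "1 \<le> c"
      using r ge_one_powr_ge_zero[of 2 r] by (simp add: c_def)
    have pos: "0 < A" "0 < B" "0 < D" "0 \<le> m" "A \<le> B"
      using cutoff_pos le r N by (auto simp: A_def B_def D_def m_def cutoff_def intro!: powr_mono2)
    have A: "A \<le> c * (B + D)"
      using cutoff_triangle[of j "k - j"] by (simp add: A_def B_def D_def c_def)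
    have B: "B \<le> c * (A + D)"
      using cutoff_triangle[of k "j - k"] cutoff_uminus[of "k - j"] by (simp add: A_def B_def D_def c_def)
    have k: "\<bar>real_of_int k\<bar> * (B - A) \<le> r * m * B"
      using cutoff_diff[OF le] by (simp add: A_def B_def m_def)
    have "\<bar>A\<^sup>2 * real_of_int j - B\<^sup>2 * real_of_int k\<bar> = \<bar>A\<^sup>2 * real_of_int (j - k) - real_of_int k * ((B - A) * (A + B))\<bar>"
      by (simp add: power2_eq_square algebra_simps)
    also have "\<dots> \<le> \<bar>A\<^sup>2 * real_of_int (j - k)\<bar> + \<bar>real_of_int k * ((B - A) * (A + B))\<bar>"
      by (rule abs_triangle_ineq4)
    also have "\<dots> = m * (A * A) + (\<bar>real_of_int k\<bar> * (B - A)) * (A + B)"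
      using pos by (simp add: abs_mult m_def power2_eq_square)
    also have "\<dots> \<le> m * (A * (c * (B + D))) + (r * m * B) * (A + c * (A + D))"
    proof (rule add_mono)
      show "m * (A * A) \<le> m * (A * (c * (B + D)))"
        using pos A by (intro mult_left_mono) auto
      show "\<bar>real_of_int k\<bar> * (B - A) * (A + B) \<le> r * m * B * (A + c * (A + D))"
        by (rule mult_mono[OF k]) (use pos B r in auto)
    qed
    also have "\<dots> \<le> (1 + 2 * r) * c * m * (A * B + D * A + D * B)"
    proof -
      have "m * (A * (c * (B + D))) \<le> c * m * (A * B + D * A + D * B)"
        using pos c by (simp add: algebra_simps)
      moreover have "(r * m * B) * (A + c * (A + D)) \<le> 2 * r * c * m * (A * B + D * A + D * B)"
      proof -
        have "A + c * (A + D) \<le> c * A + c * (A + D)"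
          using c pos by simp
        then have "(r * m * B) * (A + c * (A + D)) \<le> (r * m * B) * (c * A + c * (A + D))"
          using r pos by (intro mult_left_mono) auto
        also have "\<dots> = r * c * m * (2 * (A * B) + D * B)"
          by (simp add: algebra_simps)
        also have "\<dots> \<le> r * c * m * (2 * (A * B + D * A + D * B))"
          using r c pos by (intro mult_left_mono) auto
        finally show ?thesis by (simp add: mult_ac)
      qed
      ultimately show ?thesis
        by (simp add: algebra_simps)
    qed
    finally show ?thesis
      by (simp add: A_def B_def D_def c_def m_def)
  qed
  show ?thesis
  proof (cases "\<bar>k\<bar> \<le> \<bar>j\<bar>")
    case True
    then show ?thesis by (rule main)
  next
    case False
    then have "\<bar>j\<bar> \<le> \<bar>k\<bar>" by simp
    from main[OF this] show ?thesis
      using cutoff_uminus[of "k - j"] by (simp add: abs_minus_commute mult_ac add_ac)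
  qed
qed

end

section \<open>Sobolev spaces of sequences\<close>

definition bracket :: "int \<Rightarrow> real" where
  "bracket k = 1 + (2 * pi * of_int k)\<^sup>2"

definition hseq :: "real \<Rightarrow> (int \<Rightarrow> complex) \<Rightarrow> bool" where
  "hseq r c \<longleftrightarrow> (\<lambda>k. bracket k powr r * (cmod (c k))\<^sup>2) summable_on UNIV"

definition hnorm :: "real \<Rightarrow> (int \<Rightarrow> complex) \<Rightarrow> real" where
  "hnorm r c = sqrt (\<Sum>\<^sub>\<infinity>k. bracket k powr r * (cmod (c k))\<^sup>2)"

lemma sobolev_hseq: "f \<in> sobolev r \<Longrightarrow> hseq r (\<F> f)"
  by (simp add: sobolev_def hseq_def sobolev_summand_def[abs_def] bracket_def)

lemma sobolev_norm_eq: "sobolev_norm r f = hnorm r (\<F> f)"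
  by (simp add: sobolev_norm_def hnorm_def sobolev_summand_def bracket_def)

lemma bracket_ge_1: "1 \<le> bracket k"
  by (simp add: bracket_def)

lemma bracket_pos [simp]: "0 < bracket k"
  using bracket_ge_1[of k] by simp

lemma bracket_neq_0 [simp]: "bracket k \<noteq> 0"
  using bracket_pos[of k] by (rule less_imp_neq[THEN not_sym])

lemma bracket_powr_mono: "p \<le> q \<Longrightarrow> bracket k powr p \<le> bracket k powr q"
  using bracket_ge_1 by (rule powr_mono[rotated])

lemma bracket_ge: "(1 + real_of_int \<bar>k\<bar>)\<^sup>2 \<le> 2 * bracket k"
proof -
  have "real_of_int \<bar>k\<bar> * 1 \<le> real_of_int \<bar>k\<bar> * (2 * pi)"
    using pi_gt3 by (intro mult_left_mono) auto
  then have "(real_of_int \<bar>k\<bar>)\<^sup>2 \<le> (2 * pi * real_of_int \<bar>k\<bar>)\<^sup>2"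
    by (intro power_mono) (auto simp: mult_ac)
  moreover have "(2 * pi * real_of_int \<bar>k\<bar>)\<^sup>2 = (2 * pi * real_of_int k)\<^sup>2"
    by (simp add: power_mult_distrib)
  moreover have "2 * real_of_int \<bar>k\<bar> \<le> 1 + (real_of_int \<bar>k\<bar>)\<^sup>2"
    using sum_squares_bound[of 1 "real_of_int \<bar>k\<bar>"] by simp
  ultimately show ?thesis
    by (simp add: bracket_def power2_sum)
qed

lemma summable_on_int_even:
  fixes f :: "int \<Rightarrow> real"
  assumes "(\<lambda>n. f (int n)) summable_on UNIV" "\<And>k. f (- k) = f k"
  shows "f summable_on UNIV"
proof -
  have p: "f summable_on range int"
    using assms(1) summable_on_reindex[of int UNIV f] by (simp add: o_def)
  moreover have "f summable_on range (\<lambda>n. - int n)"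
    using assms summable_on_reindex[of "\<lambda>n. - int n" UNIV f] by (simp add: o_def inj_def)
  ultimately have "f summable_on (range int \<union> range (\<lambda>n. - int n))"
    by (rule summable_on_union)
  also have "range int \<union> range (\<lambda>n. - int n) = UNIV"
    by (auto intro: int_cases2)
  finally show ?thesis .
qed

lemma summable_bracket_powr:
  assumes "q < - 1 / 2"
  shows "(\<lambda>k. bracket k powr q) summable_on UNIV"
proof (rule summable_on_int_even)
  have "summable (\<lambda>n. of_nat n powr (2 * q) :: real)"
    using assms by (subst summable_real_powr_iff) simp
  then have "summable (\<lambda>n. of_nat (Suc n) powr (2 * q) :: real)"
    by (subst summable_Suc_iff)
  then have "(\<lambda>n. 2 powr (- q) * of_nat (Suc n) powr (2 * q) :: real) summable_on UNIV"
    by (intro summable_on_cmult_right) (subst summable_on_UNIV_nonneg_real_iff, auto)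
  then show "(\<lambda>n. bracket (int n) powr q) summable_on UNIV"
  proof (rule summable_on_comparison_test)
    fix n :: nat
    have "(1 + real n)\<^sup>2 \<le> 2 * bracket (int n)"
      using bracket_ge[of "int n"] by simp
    then have "(2 * bracket (int n)) powr q \<le> ((1 + real n)\<^sup>2) powr q"
      using assms by (intro powr_mono2') auto
    also have "\<dots> = (1 + real n) powr (2 * q)"
      by (simp add: powr_powr flip: powr_numeral)
    finally have "2 powr (- q) * (2 powr q * bracket (int n) powr q) \<le> 2 powr (- q) * (1 + real n) powr (2 * q)"
      by (intro mult_left_mono) (auto simp: powr_mult less_imp_le)
    then show "bracket (int n) powr q \<le> 2 powr (- q) * of_nat (Suc n) powr (2 * q)"
      by (simp add: powr_minus field_simps)
  qed simp
qed (simp add: bracket_def)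

lemma hseq_mono:
  assumes "hseq r c" "p \<le> r"
  shows "hseq p c"
  using assms(1) unfolding hseq_def
  by (rule summable_on_comparison_test) (auto intro!: mult_right_mono bracket_powr_mono assms(2))

lemma weight_constant_nonneg:
  assumes "\<And>k. 0 \<le> w k" "\<And>k. w k \<le> C * bracket k powr p"
  shows "0 \<le> C"
  using order_trans[OF assms] zero_le_mult_iff[of C]
  by (metis bracket_pos powr_gt_zero less_irrefl linorder_not_less)

lemma hseq_weighted:
  assumes "hseq r c" "\<And>k. 0 \<le> w k" "\<And>k. w k \<le> C * bracket k powr r"
  shows "sum_bounded_by (\<lambda>k. w k * (cmod (c k))\<^sup>2) (C * (hnorm r c)\<^sup>2)"
proof (rule sum_bounded_by_mono)
  have "(hnorm r c)\<^sup>2 = (\<Sum>\<^sub>\<infinity>k. bracket k powr r * (cmod (c k))\<^sup>2)"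
    unfolding hnorm_def by (intro real_sqrt_pow2 infsum_nonneg) auto
  then have "sum_bounded_by (\<lambda>k. bracket k powr r * (cmod (c k))\<^sup>2) ((hnorm r c)\<^sup>2)"
    using assms(1) by (simp add: sum_bounded_by_def hseq_def)
  moreover have "0 \<le> C"
    by (rule weight_constant_nonneg[OF assms(2,3)])
  ultimately show "sum_bounded_by (\<lambda>k. C * (bracket k powr r * (cmod (c k))\<^sup>2)) (C * (hnorm r c)\<^sup>2)"
    by (rule sum_bounded_by_cmult)
  show "w k * (cmod (c k))\<^sup>2 \<le> C * (bracket k powr r * (cmod (c k))\<^sup>2)" for k
    using mult_right_mono[OF assms(3)[of k], of "(cmod (c k))\<^sup>2"] by (simp add: mult_ac)
qed (auto intro!: mult_nonneg_nonneg assms)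

lemma hnorm_nonneg [simp]: "0 \<le> hnorm r c"
  unfolding hnorm_def by (intro real_sqrt_ge_zero infsum_nonneg) auto

text \<open>
  The Sobolev embedding into the weighted Wiener algebras: \<open>2 x y \<le> x\<^sup>2 + y\<^sup>2\<close> splits the summand into
  that of the norm and \<open>bracket k powr (2 q - r)\<close>, which is summable as its exponent is below \<open>- 1 / 2\<close>.
\<close>

lemma hseq_weighted_l1:
  assumes "hseq r c" "2 * q - r < - 1 / 2"
  shows "sum_bounded_by (\<lambda>k. bracket k powr q * cmod (c k))
    (((hnorm r c)\<^sup>2 + (\<Sum>\<^sub>\<infinity>k. bracket k powr (2 * q - r))) / 2)"
proof (rule sum_bounded_by_mono)
  have "sum_bounded_by (\<lambda>k. bracket k powr r * (cmod (c k))\<^sup>2) (1 * (hnorm r c)\<^sup>2)"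
    by (rule hseq_weighted[OF assms(1)]) auto
  moreover have "sum_bounded_by (\<lambda>k. bracket k powr (2 * q - r)) (\<Sum>\<^sub>\<infinity>k. bracket k powr (2 * q - r))"
    using summable_bracket_powr[OF assms(2)] by (simp add: sum_bounded_by_def)
  ultimately show "sum_bounded_by (\<lambda>k. 1 / 2 * (bracket k powr r * (cmod (c k))\<^sup>2 + bracket k powr (2 * q - r)))
      (1 / 2 * (1 * (hnorm r c)\<^sup>2 + (\<Sum>\<^sub>\<infinity>k. bracket k powr (2 * q - r))))"
    by (intro sum_bounded_by_cmult sum_bounded_by_add) auto
  show "bracket k powr q * cmod (c k) \<le> 1 / 2 * (bracket k powr r * (cmod (c k))\<^sup>2 + bracket k powr (2 * q - r))" for k
  proof -
    define x y where "x = bracket k powr (r / 2) * cmod (c k)" and "y = bracket k powr (q - r / 2)"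
    have "2 * x * y \<le> x\<^sup>2 + y\<^sup>2"
      by (rule sum_squares_bound)
    moreover have "x * y = bracket k powr q * cmod (c k)"
      using powr_add[of "bracket k" "r / 2" "q - r / 2"] by (simp add: x_def y_def)
    moreover have "x\<^sup>2 = bracket k powr r * (cmod (c k))\<^sup>2"
      using powr_add[of "bracket k" "r / 2" "r / 2"] by (simp add: x_def power2_eq_square mult_ac)
    moreover have "y\<^sup>2 = bracket k powr (2 * q - r)"
      using powr_add[of "bracket k" "q - r / 2" "q - r / 2"] by (simp add: y_def power2_eq_square)
    ultimately show ?thesis by simp
  qed
qed auto

lemma abs_le_bracket_powr: "\<bar>real_of_int k\<bar> \<le> bracket k powr (1 / 2)" "\<bar>2 * pi * real_of_int k\<bar> \<le> bracket k powr (1 / 2)"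
proof -
  show *: "\<bar>2 * pi * real_of_int k\<bar> \<le> bracket k powr (1 / 2)"
    by (simp add: powr_half_sqrt less_imp_le real_le_rsqrt bracket_def)
  have "\<bar>real_of_int k\<bar> * 1 \<le> \<bar>real_of_int k\<bar> * (2 * pi)"
    using pi_gt3 by (intro mult_left_mono) auto
  then show "\<bar>real_of_int k\<bar> \<le> bracket k powr (1 / 2)"
    using * by (simp add: abs_mult mult_ac)
qed

lemma hseq_summable:
  assumes "hseq r c"
  shows "1 / 2 < r \<Longrightarrow> (\<lambda>k. norm (c k)) summable_on UNIV"
    and "3 / 2 < r \<Longrightarrow> (\<lambda>k. norm (of_int k * c k)) summable_on UNIV"
    and "5 / 2 < r \<Longrightarrow> (\<lambda>k. norm (of_int k * (of_int k * c k))) summable_on UNIV"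
proof -
  show "(\<lambda>k. norm (c k)) summable_on UNIV" if "1 / 2 < r"
    using hseq_weighted_l1[OF assms, of 0] that by (simp add: sum_bounded_by_def)
  show "(\<lambda>k. norm (of_int k * c k)) summable_on UNIV" if "3 / 2 < r"
  proof (rule summable_on_comparison_test)
    show "(\<lambda>k. bracket k powr (1 / 2) * cmod (c k)) summable_on UNIV"
      using hseq_weighted_l1[OF assms, of "1 / 2"] that by (simp add: sum_bounded_by_def)
  qed (auto simp: norm_mult intro!: mult_right_mono abs_le_bracket_powr)
  show "(\<lambda>k. norm (of_int k * (of_int k * c k))) summable_on UNIV" if "5 / 2 < r"
  proof (rule summable_on_comparison_test)
    show "(\<lambda>k. bracket k powr 1 * cmod (c k)) summable_on UNIV"
      using hseq_weighted_l1[OF assms, of 1] that by (simp add: sum_bounded_by_def)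
    show "norm (of_int k * (of_int k * c k)) \<le> bracket k powr 1 * cmod (c k)" for k
    proof -
      have "\<bar>real_of_int k\<bar> * \<bar>real_of_int k\<bar> \<le> bracket k powr (1 / 2) * bracket k powr (1 / 2)"
        by (intro mult_mono abs_le_bracket_powr) auto
      also have "\<dots> = bracket k powr 1"
        by (simp flip: powr_add)
      finally have "\<bar>real_of_int k\<bar> * \<bar>real_of_int k\<bar> * cmod (c k) \<le> bracket k powr 1 * cmod (c k)"
        by (intro mult_right_mono) auto
      then show ?thesis
        by (simp add: norm_mult mult.assoc)
    qed
  qed auto
qed

lemma sobolev_wiener:
  assumes "f \<in> sobolev r" "1 / 2 < r" "continuous_on UNIV f"
  shows "wiener f"
  using assms hseq_summable(1)[OF sobolev_hseq] by (auto simp: wiener_def sobolev_def)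

lemma sobolev_integrable:
  assumes "f \<in> sobolev r"
  shows "set_integrable lborel {0..1} f"
proof -
  have m: "f \<in> borel_measurable borel" and i: "set_integrable lborel {0..1} (\<lambda>x. (f x)\<^sup>2)"
    using assms by (auto simp: sobolev_def)
  have "set_integrable lborel {0..1} (\<lambda>x. 1 + (f x)\<^sup>2)"
    by (intro set_integral_add i borel_integrable_atLeastAtMost' continuous_intros)
  then show ?thesis
    unfolding set_integrable_def
  proof (rule Bochner_Integration.integrable_bound)
    have "\<bar>f x\<bar> \<le> 1 + (f x)\<^sup>2" for x
      using sum_squares_bound[of 1 "\<bar>f x\<bar>"] by simp
    then show "AE x in lborel. norm (indicat_real {0..1} x *\<^sub>R f x) \<le> norm (indicat_real {0..1} x *\<^sub>R (1 + (f x)\<^sup>2))"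
      by (intro AE_I2) (auto simp: indicator_def)
  qed (use m in measurable)
qed

lemma hseq_diff:
  assumes "hseq r a" "hseq r b"
  shows "hseq r (\<lambda>k. a k - b k)"
proof -
  have "(\<lambda>k. 2 * (bracket k powr r * (cmod (a k))\<^sup>2) + 2 * (bracket k powr r * (cmod (b k))\<^sup>2)) summable_on UNIV"
    using assms by (intro summable_on_add summable_on_cmult_right) (auto simp: hseq_def)
  then show ?thesis
    unfolding hseq_def
  proof (rule summable_on_comparison_test)
    fix k
    have "(cmod (a k - b k))\<^sup>2 \<le> (cmod (a k) + cmod (b k))\<^sup>2"
      by (intro power_mono norm_triangle_ineq4) auto
    also have "\<dots> \<le> 2 * (cmod (a k))\<^sup>2 + 2 * (cmod (b k))\<^sup>2"
      using sum_squares_bound[of "cmod (a k)" "cmod (b k)"] by (simp add: power2_sum)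
    finally have "bracket k powr r * (cmod (a k - b k))\<^sup>2 \<le> bracket k powr r * (2 * (cmod (a k))\<^sup>2 + 2 * (cmod (b k))\<^sup>2)"
      by (intro mult_left_mono) auto
    then show "bracket k powr r * (cmod (a k - b k))\<^sup>2 \<le> 2 * (bracket k powr r * (cmod (a k))\<^sup>2) + 2 * (bracket k powr r * (cmod (b k))\<^sup>2)"
      by (simp add: algebra_simps)
  qed auto
qed

lemma hseq_cmult:
  assumes "hseq r a"
  shows "hseq r (\<lambda>k. z * a k)"
  using summable_on_cmult_right[OF assms[unfolded hseq_def], of "(cmod z)\<^sup>2"]
  by (simp add: hseq_def norm_mult power_mult_distrib mult_ac)

lemma cauchy_schwarz_infsum:
  fixes x y :: "'a \<Rightarrow> real"
  assumes x: "(\<lambda>k. (x k)\<^sup>2) summable_on UNIV" and y: "(\<lambda>k. (y k)\<^sup>2) summable_on UNIV"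
  shows "sum_bounded_by (\<lambda>k. \<bar>x k\<bar> * \<bar>y k\<bar>) (sqrt (\<Sum>\<^sub>\<infinity>k. (x k)\<^sup>2) * sqrt (\<Sum>\<^sub>\<infinity>k. (y k)\<^sup>2))"
proof -
  have le: "(\<Sum>k\<in>F. \<bar>x k\<bar> * \<bar>y k\<bar>) \<le> sqrt (\<Sum>\<^sub>\<infinity>k. (x k)\<^sup>2) * sqrt (\<Sum>\<^sub>\<infinity>k. (y k)\<^sup>2)" if "finite F" for F
  proof -
    have "(\<Sum>k\<in>F. \<bar>x k\<bar> * \<bar>y k\<bar>) \<le> L2_set x F * L2_set y F"
      by (rule L2_set_mult_ineq)
    also have "\<dots> \<le> sqrt (\<Sum>\<^sub>\<infinity>k. (x k)\<^sup>2) * sqrt (\<Sum>\<^sub>\<infinity>k. (y k)\<^sup>2)"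
      unfolding L2_set_def
      by (intro mult_mono real_sqrt_le_mono finite_sum_le_infsum assms that)
         (auto intro!: real_sqrt_ge_zero infsum_nonneg sum_nonneg)
    finally show ?thesis .
  qed
  have "(\<lambda>k. \<bar>x k\<bar> * \<bar>y k\<bar>) summable_on UNIV"
    by (rule nonneg_bdd_above_summable_on) (auto intro!: bdd_aboveI2 le)
  then show ?thesis
    unfolding sum_bounded_by_def using infsum_le_finite_sums[OF _ le] by blast
qed

text \<open>The duality of \<open>H\<^sup>r\<^sup>+\<^sup>1\<close> and \<open>H\<^sup>r\<close> with respect to a form of order \<open>2 r + 1\<close>, by the Cauchy--Schwarz inequality.\<close>

lemma hseq_pairing:
  assumes a: "hseq (r + 1) a" and b: "hseq r b"
    and w: "\<And>k. 0 \<le> w k" "\<And>k. w k \<le> C * bracket k powr (r + 1 / 2)"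
  shows "sum_bounded_by (\<lambda>k. w k * (cmod (a k) * cmod (b k))) (C * (hnorm (r + 1) a * hnorm r b))"
proof (rule sum_bounded_by_mono)
  define x y where "x k = bracket k powr ((r + 1) / 2) * cmod (a k)" and "y k = bracket k powr (r / 2) * cmod (b k)" for k
  have x: "(x k)\<^sup>2 = bracket k powr (r + 1) * (cmod (a k))\<^sup>2" for k
    using powr_add[of "bracket k" "(r + 1) / 2" "(r + 1) / 2"] by (simp add: x_def power2_eq_square mult_ac)
  have y: "(y k)\<^sup>2 = bracket k powr r * (cmod (b k))\<^sup>2" for k
    using powr_add[of "bracket k" "r / 2" "r / 2"] by (simp add: y_def power2_eq_square mult_ac)
  have C: "0 \<le> C"
    by (rule weight_constant_nonneg[OF w])
  have "sum_bounded_by (\<lambda>k. \<bar>x k\<bar> * \<bar>y k\<bar>) (hnorm (r + 1) a * hnorm r b)"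
    using cauchy_schwarz_infsum[of x y] a b unfolding x y hseq_def hnorm_def by simp
  then show "sum_bounded_by (\<lambda>k. C * (\<bar>x k\<bar> * \<bar>y k\<bar>)) (C * (hnorm (r + 1) a * hnorm r b))"
    using C by (rule sum_bounded_by_cmult)
  show "w k * (cmod (a k) * cmod (b k)) \<le> C * (\<bar>x k\<bar> * \<bar>y k\<bar>)" for k
  proof -
    have "bracket k powr (r + 1 / 2) = bracket k powr ((r + 1) / 2) * bracket k powr (r / 2)"
      by (simp add: field_simps flip: powr_add)
    moreover have "\<bar>x k\<bar> * \<bar>y k\<bar> = x k * y k"
      by (simp add: x_def y_def)
    ultimately show ?thesis
      using mult_right_mono[OF w(2)[of k], of "cmod (a k) * cmod (b k)"]
      by (simp add: x_def y_def mult_ac)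
  qed
qed (auto intro!: mult_nonneg_nonneg w)

section \<open>Differentiation of weighted energies\<close>

text \<open>
  A quadratic form whose weight interpolates between \<open>H\<^sup>r\<^sup>+\<^sup>1\<close> and \<open>H\<^sup>r\<close> is differentiable along a curve in
  \<open>C(I; H\<^sup>r\<^sup>+\<^sup>1) \<inter> C\<^sup>1(I; H\<^sup>r)\<close>: the difference of two squares is a product of a factor converging
  in \<open>H\<^sup>r\<^sup>+\<^sup>1\<close> and one whose quotient by the increment of time converges in \<open>H\<^sup>r\<close>.
\<close>

lemma weighted_energy_has_derivative:
  assumes v: "C0_sobolev (r + 1) I v" and v1: "C1_sobolev r I v v'" and t: "t \<in> I"
    and w: "\<And>k. 0 \<le> w k" "\<And>k. w k \<le> C * bracket k powr (r + 1 / 2)"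
  shows "((\<lambda>\<tau>. \<Sum>\<^sub>\<infinity>k. w k * (cmod (\<F> (v \<tau>) k))\<^sup>2) has_real_derivative
      2 * Re (\<Sum>\<^sub>\<infinity>k. w k * cnj (\<F> (v t) k) * \<F> (v' t) k)) (at t within I)"
proof -
  define c where "c \<tau> k = \<F> (v \<tau>) k" for \<tau> k
  define c' where "c' k = \<F> (v' t) k" for k
  define d where "d \<tau> k = c \<tau> k - c t k" for \<tau> k
  define e where "e \<tau> k = (c \<tau> k - c t k) / of_real (\<tau> - t) - c' k" for \<tau> k
  have sob: "v \<tau> \<in> sobolev (r + 1)" "v \<tau> \<in> sobolev r" if "\<tau> \<in> I" for \<tau>
    using v v1 that by (auto simp: C0_sobolev_def C1_sobolev_def)
  have sob': "v' t \<in> sobolev r"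
    using v1 t by (auto simp: C0_sobolev_def C1_sobolev_def)
  have hc: "hseq (r + 1) (c \<tau>)" "hseq r (c \<tau>)" if "\<tau> \<in> I" for \<tau>
    using sobolev_hseq[OF sob(1)[OF that]] sobolev_hseq[OF sob(2)[OF that]]
    by (simp_all add: c_def[abs_def])
  have hc': "hseq r c'"
    using sobolev_hseq[OF sob'] by (simp add: c'_def[abs_def])
  have hd: "hseq (r + 1) (d \<tau>)" if "\<tau> \<in> I" for \<tau>
    unfolding d_def by (intro hseq_diff hc that t)
  have he: "hseq r (e \<tau>)" if "\<tau> \<in> I" for \<tau>
  proof -
    have "hseq r (\<lambda>k. inverse (of_real (\<tau> - t)) * (c \<tau> k - c t k) - c' k)"
      by (intro hseq_diff hseq_cmult hc hc' that t)
    then show ?thesis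
      by (simp add: e_def[abs_def] field_simps)
  qed
  have D: "((\<lambda>\<tau>. hnorm (r + 1) (d \<tau>)) \<longlongrightarrow> 0) (at t within I)"
  proof -
    have "((\<lambda>\<tau>. sobolev_norm (r + 1) (\<lambda>x. v \<tau> x - v t x)) \<longlongrightarrow> 0) (at t within I)"
      using v t by (simp add: C0_sobolev_def)
    moreover have "sobolev_norm (r + 1) (\<lambda>x. v \<tau> x - v t x) = hnorm (r + 1) (d \<tau>)" if "\<tau> \<in> I" for \<tau>
    proof -
      have "\<F> (\<lambda>x. v \<tau> x - v t x) = d \<tau>"
        using fourier_coeff_diff[OF sobolev_integrable[OF sob(1)[OF that]] sobolev_integrable[OF sob(1)[OF t]]]
        by (simp add: fun_eq_iff d_def c_def)
      then show ?thesis
        by (simp add: sobolev_norm_eq)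
    qed
    then have "\<forall>\<^sub>F \<tau> in at t within I. sobolev_norm (r + 1) (\<lambda>x. v \<tau> x - v t x) = hnorm (r + 1) (d \<tau>)"
      by (auto simp: eventually_at_filter)
    ultimately show ?thesis
      by (rule Lim_transform_eventually)
  qed
  have E: "((\<lambda>\<tau>. hnorm r (e \<tau>)) \<longlongrightarrow> 0) (at t within I)"
  proof -
    have "((\<lambda>\<tau>. sobolev_norm r (\<lambda>x. (v \<tau> x - v t x) / (\<tau> - t) - v' t x)) \<longlongrightarrow> 0) (at t within I)"
      using v1 t by (simp add: C1_sobolev_def)
    moreover have "sobolev_norm r (\<lambda>x. (v \<tau> x - v t x) / (\<tau> - t) - v' t x) = hnorm r (e \<tau>)" if "\<tau> \<in> I" for \<tau>
    proof -
      have i: "set_integrable lborel {0..1} (v \<tau>)" "set_integrable lborel {0..1} (v t)" "set_integrable lborel {0..1} (v' t)"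
        using sob(1)[OF that] sob(1)[OF t] sob' sobolev_integrable by blast+
      have "(\<lambda>x. (v \<tau> x - v t x) / (\<tau> - t) - v' t x) = (\<lambda>x. inverse (\<tau> - t) * (v \<tau> x - v t x) - v' t x)"
        by (simp add: field_simps)
      moreover have "set_integrable lborel {0..1} (\<lambda>x. inverse (\<tau> - t) * (v \<tau> x - v t x))"
        by (intro set_integrable_mult_right set_integral_diff i)
      ultimately have "\<F> (\<lambda>x. (v \<tau> x - v t x) / (\<tau> - t) - v' t x) = e \<tau>"
        using i fourier_coeff_cmult[of "inverse (\<tau> - t)" "\<lambda>x. v \<tau> x - v t x"]
        by (simp add: fun_eq_iff fourier_coeff_diff e_def c_def c'_def field_simps)
      then show ?thesis
        by (simp add: sobolev_norm_eq)
    qed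
    then have "\<forall>\<^sub>F \<tau> in at t within I. sobolev_norm r (\<lambda>x. (v \<tau> x - v t x) / (\<tau> - t) - v' t x) = hnorm r (e \<tau>)"
      by (auto simp: eventually_at_filter)
    ultimately show ?thesis
      by (rule Lim_transform_eventually)
  qed
  define Q where "Q \<tau> = (\<Sum>\<^sub>\<infinity>k. w k * (cmod (c \<tau> k))\<^sup>2)" for \<tau>
  define L where "L = (\<Sum>\<^sub>\<infinity>k. w k * cnj (c t k) * c' k)"
  define B where "B \<tau> = 2 * (C * (hnorm (r + 1) (c t) * hnorm r (e \<tau>)))
      + (C * (hnorm (r + 1) (d \<tau>) * hnorm r (e \<tau>)) + C * (hnorm (r + 1) (d \<tau>) * hnorm r c'))" for \<tau>
  have C: "0 \<le> C"
    by (rule weight_constant_nonneg[OF w])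
  have Qs: "(\<lambda>k. w k * (cmod (c \<tau> k))\<^sup>2) summable_on UNIV" if "\<tau> \<in> I" for \<tau>
  proof -
    have "w k \<le> C * bracket k powr (r + 1)" for k
      using w(2)[of k] mult_left_mono[OF bracket_powr_mono[of "r + 1 / 2" "r + 1" k] C] by simp
    from hseq_weighted[OF hc(1)[OF that] w(1) this] show ?thesis
      by (simp add: sum_bounded_by_def)
  qed
  have Ls: "(\<lambda>k. w k * cnj (c t k) * c' k) summable_on UNIV"
  proof (rule abs_summable_summable)
    have "norm (w k * cnj (c t k) * c' k) = w k * (cmod (c t k) * cmod (c' k))" for k
      by (simp add: norm_mult abs_of_nonneg[OF w(1)])
    then show "(\<lambda>k. norm (w k * cnj (c t k) * c' k)) summable_on UNIV"
      using hseq_pairing[OF hc(1)[OF t] hc' w] unfolding sum_bounded_by_def by simp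
  qed
  \<comment> \<open>With \<open>c \<tau> = c t + d\<close> and \<open>d = (\<tau> - t) (e + c')\<close> every term left over contains a factor \<open>e\<close> or \<open>d\<close>.\<close>
  have bound: "\<bar>(Q \<tau> - Q t) / (\<tau> - t) - 2 * Re L\<bar> \<le> B \<tau>" if \<tau>: "\<tau> \<in> I" "\<tau> \<noteq> t" for \<tau>
  proof -
    define R where "R k = w k * (((cmod (c \<tau> k))\<^sup>2 - (cmod (c t k))\<^sup>2) / (\<tau> - t) - 2 * Re (cnj (c t k) * c' k))" for k
    have "((\<lambda>k. (w k * (cmod (c \<tau> k))\<^sup>2 - w k * (cmod (c t k))\<^sup>2) / (\<tau> - t) - 2 * Re (w k * cnj (c t k) * c' k)) has_sum
        ((Q \<tau> - Q t) / (\<tau> - t) - 2 * Re L)) UNIV"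
      unfolding Q_def L_def
      using has_sum_add[OF has_sum_divide_const[OF has_sum_add[OF has_sum_infsum[OF Qs[OF \<tau>(1)]]
              has_sum_uminusI[OF has_sum_infsum[OF Qs[OF t]]]], of "\<tau> - t"]
            has_sum_uminusI[OF has_sum_cmult_right[OF has_sum_Re[OF has_sum_infsum[OF Ls]], of 2]]]
      by (simp only: diff_conv_add_uminus)
    moreover have "(\<lambda>k. (w k * (cmod (c \<tau> k))\<^sup>2 - w k * (cmod (c t k))\<^sup>2) / (\<tau> - t) - 2 * Re (w k * cnj (c t k) * c' k)) = R"
    proof
      fix k
      have "Re (w k * cnj (c t k) * c' k) = w k * Re (cnj (c t k) * c' k)"
        by (simp add: algebra_simps)
      then show "(w k * (cmod (c \<tau> k))\<^sup>2 - w k * (cmod (c t k))\<^sup>2) / (\<tau> - t) - 2 * Re (w k * cnj (c t k) * c' k) = R k"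
        unfolding R_def by (simp only: right_diff_distrib times_divide_eq_right mult.left_commute)
    qed
    ultimately have R: "(R has_sum ((Q \<tau> - Q t) / (\<tau> - t) - 2 * Re L)) UNIV"
      by simp
    have "sum_bounded_by (\<lambda>k. 2 * (w k * (cmod (c t k) * cmod (e \<tau> k)))
        + (w k * (cmod (d \<tau> k) * cmod (e \<tau> k)) + w k * (cmod (d \<tau> k) * cmod (c' k)))) (B \<tau>)"
      unfolding B_def
      by (intro sum_bounded_by_add sum_bounded_by_cmult hseq_pairing w hc hd he hc' t \<tau>) auto
    then have "sum_bounded_by (\<lambda>k. \<bar>R k\<bar>) (B \<tau>)"
    proof (rule sum_bounded_by_mono)
      fix k
      define z where "z = complex_of_real (\<tau> - t)"
      have z: "z \<noteq> 0" using \<tau> by (simp add: z_def)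
      have ed: "d \<tau> k = z * (e \<tau> k + c' k)"
        using z by (simp add: e_def d_def z_def)
      have "(cmod (c \<tau> k))\<^sup>2 - (cmod (c t k))\<^sup>2 = 2 * Re (cnj (c t k) * d \<tau> k) + Re (cnj (d \<tau> k) * d \<tau> k)"
        unfolding cmod_power2 d_def by (simp add: power2_eq_square algebra_simps)
      also have "\<dots> = (\<tau> - t) * (2 * Re (cnj (c t k) * (e \<tau> k + c' k)) + Re (cnj (d \<tau> k) * (e \<tau> k + c' k)))"
        by (subst (1 3) ed) (simp add: z_def algebra_simps)
      finally have "((cmod (c \<tau> k))\<^sup>2 - (cmod (c t k))\<^sup>2) / (\<tau> - t)
          = 2 * Re (cnj (c t k) * (e \<tau> k + c' k)) + Re (cnj (d \<tau> k) * (e \<tau> k + c' k))"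
        using \<tau> by simp
      then have "R k = w k * (2 * Re (cnj (c t k) * e \<tau> k) + (Re (cnj (d \<tau> k) * e \<tau> k) + Re (cnj (d \<tau> k) * c' k)))"
        unfolding R_def by (simp only:) (simp add: algebra_simps)
      also have "\<bar>\<dots>\<bar> \<le> w k * (2 * (cmod (c t k) * cmod (e \<tau> k)) + (cmod (d \<tau> k) * cmod (e \<tau> k) + cmod (d \<tau> k) * cmod (c' k)))"
      proof -
        have *: "\<bar>Re (cnj x * y)\<bar> \<le> cmod x * cmod y" for x y
          using abs_Re_le_cmod[of "cnj x * y"] by (simp add: norm_mult)
        show ?thesis
          unfolding abs_mult abs_of_nonneg[OF w(1)]
          using *[of "c t k" "e \<tau> k"] *[of "d \<tau> k" "e \<tau> k"] *[of "d \<tau> k" "c' k"]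
          by (intro mult_left_mono w) linarith
      qed
      finally show "\<bar>R k\<bar> \<le> 2 * (w k * (cmod (c t k) * cmod (e \<tau> k)))
        + (w k * (cmod (d \<tau> k) * cmod (e \<tau> k)) + w k * (cmod (d \<tau> k) * cmod (c' k)))"
        by (simp add: algebra_simps)
    qed auto
    moreover have "\<bar>infsum R UNIV\<bar> \<le> (\<Sum>\<^sub>\<infinity>k. \<bar>R k\<bar>)"
      using norm_infsum_bound[of R UNIV] calculation by (simp add: sum_bounded_by_def)
    ultimately show ?thesis
      using infsumI[OF R] by (simp add: sum_bounded_by_def)
  qed
  have "(B \<longlongrightarrow> 2 * (C * (hnorm (r + 1) (c t) * 0)) + (C * (0 * 0) + C * (0 * hnorm r c'))) (at t within I)"
    unfolding B_def by (intro tendsto_intros D E)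
  then have "(B \<longlongrightarrow> 0) (at t within I)"
    by simp
  moreover have "\<forall>\<^sub>F \<tau> in at t within I. norm ((Q \<tau> - Q t) / (\<tau> - t) - 2 * Re L) \<le> B \<tau>"
    using bound by (auto simp: eventually_at_filter)
  ultimately have "((\<lambda>\<tau>. (Q \<tau> - Q t) / (\<tau> - t) - 2 * Re L) \<longlongrightarrow> 0) (at t within I)"
    by (rule Lim_null_comparison[rotated])
  then have "((\<lambda>\<tau>. (Q \<tau> - Q t) / (\<tau> - t)) \<longlongrightarrow> 2 * Re L) (at t within I)"
    by (rule LIM_zero_cancel)
  then show ?thesis
    unfolding has_field_derivative_iff Q_def L_def c_def c'_def .
qed

lemma gronwall:
  fixes E :: "real \<Rightarrow> real"
  assumes "a \<le> b" and E: "\<And>t. t \<in> {a..b} \<Longrightarrow> (E has_real_derivative E' t) (at t within {a..b})"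
    and le: "\<And>t. t \<in> {a..b} \<Longrightarrow> E' t \<le> C * E t"
  shows "E b \<le> E a * exp (C * (b - a))"
proof (cases "a = b")
  case False
  then have ab: "a < b" using assms(1) by simp
  define F where "F t = E t * exp (- (C * t))" for t
  have F: "(F has_real_derivative (E' t - C * E t) * exp (- (C * t))) (at t within {a..b})" if "t \<in> {a..b}" for t
    unfolding F_def using E[OF that]
    by (auto intro!: derivative_eq_intros simp: algebra_simps)
  have "F b \<le> F a"
  proof (rule DERIV_nonpos_imp_decreasing_open[OF assms(1)])
    show "continuous_on {a..b} F"
      using F by (intro DERIV_continuous_on)
    fix t assume t: "a < t" "t < b"
    have "(F has_real_derivative (E' t - C * E t) * exp (- (C * t))) (at t)"
      using F[of t] t by (simp add: at_within_Icc_at)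
    moreover have "(E' t - C * E t) * exp (- (C * t)) \<le> 0"
      using le[of t] t by (intro mult_nonpos_nonneg) auto
    ultimately show "\<exists>y. (F has_real_derivative y) (at t) \<and> y \<le> 0"
      by blast
  qed
  then have "F b * exp (C * b) \<le> F a * exp (C * b)"
    by (intro mult_right_mono) auto
  then show ?thesis
    by (simp add: F_def mult.assoc right_diff_distrib flip: exp_add)
qed simp

section \<open>Energy estimates for transport and product terms\<close>

lemma summable_square_of_summable:
  fixes c :: "int \<Rightarrow> real"
  assumes c: "c summable_on UNIV" "\<And>k. 0 \<le> c k" and w: "\<And>k. \<bar>w k\<bar> \<le> W"
  shows "(\<lambda>k. (w k * c k)\<^sup>2) summable_on UNIV"
proof (rule summable_on_comparison_test)
  show "(\<lambda>k. W\<^sup>2 * infsum c UNIV * c k) summable_on UNIV"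
    by (intro summable_on_cmult_right c)
  show "(w k * c k)\<^sup>2 \<le> W\<^sup>2 * infsum c UNIV * c k" for k
  proof -
    have "c k \<le> infsum c UNIV"
      using finite_sum_le_infsum[OF c(1), of "{k}"] c(2) by simp
    then have *: "c k * c k \<le> infsum c UNIV * c k"
      by (intro mult_right_mono c)
    moreover have "(w k)\<^sup>2 \<le> W\<^sup>2"
      using power_mono[OF w[of k] abs_ge_zero, of 2] by simp
    ultimately have "(w k)\<^sup>2 * (c k * c k) \<le> W\<^sup>2 * (infsum c UNIV * c k)"
      using c(2) by (intro mult_mono[OF _ *]) auto
    then show ?thesis
      by (simp add: power2_eq_square mult_ac)
  qed
qed simp

definition wiener_norm :: "(real \<Rightarrow> real) \<Rightarrow> real" where
  "wiener_norm f = (\<Sum>\<^sub>\<infinity>k. norm (\<F> f k))"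

definition cutoff_energy :: "real \<Rightarrow> real \<Rightarrow> (real \<Rightarrow> real) \<Rightarrow> real" where
  "cutoff_energy r N f = (\<Sum>\<^sub>\<infinity>k. (cutoff r N k * norm (\<F> f k))\<^sup>2)"

lemma wiener_norm_nonneg: "0 \<le> wiener_norm f"
  unfolding wiener_norm_def by (intro infsum_nonneg) auto

lemma cutoff_energy_nonneg: "0 \<le> cutoff_energy r N f"
  unfolding cutoff_energy_def by (intro infsum_nonneg) auto

context
  fixes r N :: real
  assumes r: "1 \<le> r" and N: "1 \<le> N"
begin

lemma abs_cutoff: "\<bar>cutoff r N k\<bar> = cutoff r N k" "\<bar>cutoff r N k\<bar> \<le> N powr r"
  using cutoff_pos[OF r N, of k] cutoff_le[OF r N, of k] by auto

lemma summable_cutoff: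
  assumes "wiener f"
  shows "(\<lambda>k. (cutoff r N k * norm (\<F> f k))\<^sup>2) summable_on UNIV"
  by (rule summable_square_of_summable[OF wienerD(3)[OF assms] _ abs_cutoff(2)]) auto

text \<open>Transport does not lose a derivative: by antisymmetry the symbol of the form is the one of
  the commutator estimate, whose three terms are trilinear sums with the summable factor on
  the index of \<open>u\<^sub>x\<close>, of \<open>f\<close> and of the conjugate of \<open>f\<close>.\<close>

lemma cutoff_transport:
  assumes u: "wiener u" "(\<lambda>k. norm (of_int k * \<F> u k)) summable_on UNIV"
    and f: "wiener f" "(\<lambda>k. norm (of_int k * \<F> f k)) summable_on UNIV"
  obtains S where
    "((\<lambda>k. (cutoff r N k)\<^sup>2 * cnj (\<F> f k) * \<F> (\<lambda>x. u x * deriv f x) k) has_sum S) UNIV"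
    "\<bar>2 * Re S\<bar> \<le> (1 + 2 * r) * 2 powr r * (wiener_norm (deriv u) + wiener_norm f)
        * (cutoff_energy r N (deriv u) + cutoff_energy r N f)"
proof -
  define a c V where "a = \<F> u" and "c = \<F> f" and "V = \<F> (deriv u)"
  define \<alpha> where "\<alpha> = cutoff r N"
  define K where "K = (1 + 2 * r) * 2 powr r"
  have K: "0 \<le> K" using r by (simp add: K_def)
  note du = wiener_deriv[OF u] and df = wiener_deriv[OF f]
  have \<alpha>: "0 < \<alpha> k" "\<alpha> k \<le> N powr r" for k
    using cutoff_pos[OF r N] cutoff_le[OF r N] by (auto simp: \<alpha>_def)
  have c1: "(\<lambda>k. norm (c k)) summable_on UNIV" and a1: "(\<lambda>k. norm (a k)) summable_on UNIV"
    and V1: "(\<lambda>k. norm (V k)) summable_on UNIV"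
    using wienerD(3)[OF f(1)] wienerD(3)[OF u(1)] wienerD(3)[OF du(3)] by (auto simp: a_def c_def V_def)
  have c2: "(\<lambda>k. (\<alpha> k * norm (c k))\<^sup>2) summable_on UNIV" and V2: "(\<lambda>k. (\<alpha> k * norm (V k))\<^sup>2) summable_on UNIV"
    using summable_cutoff[OF f(1)] summable_cutoff[OF du(3)] by (auto simp: \<alpha>_def c_def V_def)
  have V: "V k = 2 * pi * \<i> * of_int k * a k" for k
    by (simp add: V_def a_def du(2))
  have sum\<Phi>: "(\<lambda>(m, j). norm ((\<alpha> (m + j))\<^sup>2 * cnj (c (m + j)) * (a m * (2 * pi * \<i> * of_int j * c j)))) summable_on UNIV"
  proof -
    have x: "(\<lambda>k. ((\<alpha> k)\<^sup>2 * norm (c k))\<^sup>2) summable_on UNIV"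
    proof (rule summable_square_of_summable[OF c1])
      show "\<bar>(\<alpha> k)\<^sup>2\<bar> \<le> (N powr r)\<^sup>2" for k
        using power_mono[OF \<alpha>(2), of k 2] less_imp_le[OF \<alpha>(1)] by simp
    qed auto
    have y: "(\<lambda>k. (2 * pi * norm (of_int k * c k))\<^sup>2) summable_on UNIV"
      by (rule summable_square_of_summable[where W="2 * pi"]) (use f in \<open>auto simp: c_def\<close>)
    show ?thesis
      using young_trilinear[OF a1 _ x y] unfolding sum_bounded_by_def case_prod_unfold
      by (simp add: norm_mult norm_power mult_ac)
  qed
  obtain S where S: "((\<lambda>k. (\<alpha> k)\<^sup>2 * cnj (c k) * \<F> (\<lambda>x. u x * deriv f x) k) has_sum S) UNIV"
    and \<Psi>: "((\<lambda>(m, j). 2 * pi * \<i> * ((\<alpha> (m + j))\<^sup>2 * of_int j - (\<alpha> j)\<^sup>2 * of_int (m + j)) *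
        (cnj (c (m + j)) * a m * c j)) has_sum complex_of_real (2 * Re S)) UNIV"
  proof (rule transport_symmetrised[where \<omega>="\<lambda>k. (\<alpha> k)\<^sup>2"])
    show "a (- m) = cnj (a m)" for m
      by (simp add: a_def fourier_coeff_uminus)
    show "(\<lambda>(m, j). norm (complex_of_real ((\<alpha> (m + j))\<^sup>2) * cnj (c (m + j)) * (a m * (2 * pi * \<i> * of_int j * c j)))) summable_on UNIV"
      using sum\<Phi> by simp
    show "((\<lambda>m. a m * (2 * pi * \<i> * of_int (k - m) * c (k - m))) has_sum \<F> (\<lambda>x. u x * deriv f x) k) UNIV" for k
      using fourier_coeff_mult[OF u(1) wienerD(1)[OF df(3)], of k] by (simp add: df(2) a_def c_def)
  qed (use that in auto)
  have "sum_bounded_by (\<lambda>z. norm ((\<lambda>(m, j). 2 * pi * \<i> * ((\<alpha> (m + j))\<^sup>2 * of_int j - (\<alpha> j)\<^sup>2 * of_int (m + j)) *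
        (cnj (c (m + j)) * a m * c j)) z))
      (K * ((wiener_norm (deriv u) + wiener_norm f) * (cutoff_energy r N (deriv u) + cutoff_energy r N f)))"
  proof (rule sum_bounded_by_mono)
    define M where "M = (\<lambda>(m, j). norm (V m) * (\<bar>\<alpha> (m + j) * norm (c (m + j))\<bar> * \<bar>\<alpha> j * norm (c j)\<bar>)
        + (norm (c j) * (\<bar>\<alpha> (m + j) * norm (c (m + j))\<bar> * \<bar>\<alpha> m * norm (V m)\<bar>)
        + norm (c (m + j)) * (\<bar>\<alpha> m * norm (V m)\<bar> * \<bar>\<alpha> j * norm (c j)\<bar>)))"
    have "sum_bounded_by M (wiener_norm (deriv u) * (cutoff_energy r N f + cutoff_energy r N f) / 2
       + (wiener_norm f * (cutoff_energy r N f + cutoff_energy r N (deriv u)) / 2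
       + wiener_norm f * (cutoff_energy r N (deriv u) + cutoff_energy r N f) / 2))"
      unfolding M_def case_prod_unfold
      using sum_bounded_by_add[OF young_trilinear[OF V1 _ c2 c2]
          sum_bounded_by_add[OF young_trilinear_right[OF c1 _ c2 V2] young_trilinear_sum[OF c1 _ V2 c2]]]
      unfolding case_prod_unfold wiener_norm_def cutoff_energy_def \<alpha>_def c_def V_def by simp
    then show "sum_bounded_by (\<lambda>z. K * M z) (K * (wiener_norm (deriv u) * (cutoff_energy r N f + cutoff_energy r N f) / 2
       + (wiener_norm f * (cutoff_energy r N f + cutoff_energy r N (deriv u)) / 2
       + wiener_norm f * (cutoff_energy r N (deriv u) + cutoff_energy r N f) / 2)))"
      by (rule sum_bounded_by_cmult[OF _ K])
    show "K * (wiener_norm (deriv u) * (cutoff_energy r N f + cutoff_energy r N f) / 2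
       + (wiener_norm f * (cutoff_energy r N f + cutoff_energy r N (deriv u)) / 2
       + wiener_norm f * (cutoff_energy r N (deriv u) + cutoff_energy r N f) / 2))
      \<le> K * ((wiener_norm (deriv u) + wiener_norm f) * (cutoff_energy r N (deriv u) + cutoff_energy r N f))"
      using wiener_norm_nonneg[of "deriv u"] cutoff_energy_nonneg[of r N "deriv u"] K
      by (intro mult_left_mono) (simp_all add: field_simps)
    show "norm ((\<lambda>(m, j). 2 * pi * \<i> * ((\<alpha> (m + j))\<^sup>2 * of_int j - (\<alpha> j)\<^sup>2 * of_int (m + j)) *
        (cnj (c (m + j)) * a m * c j)) z) \<le> K * M z" for z
    proof (cases z)
      case (Pair m j)
      have "\<bar>(\<alpha> (m + j))\<^sup>2 * real_of_int j - (\<alpha> j)\<^sup>2 * real_of_int (m + j)\<bar>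
          \<le> K * \<bar>real_of_int m\<bar> * (\<alpha> (m + j) * \<alpha> j + \<alpha> m * \<alpha> (m + j) + \<alpha> m * \<alpha> j)"
        using cutoff_commutator[OF r N, of "m + j" j] by (simp add: \<alpha>_def K_def)
      then have "2 * pi * \<bar>(\<alpha> (m + j))\<^sup>2 * real_of_int j - (\<alpha> j)\<^sup>2 * real_of_int (m + j)\<bar>
            * (norm (c (m + j)) * norm (a m) * norm (c j))
          \<le> 2 * pi * (K * \<bar>real_of_int m\<bar> * (\<alpha> (m + j) * \<alpha> j + \<alpha> m * \<alpha> (m + j) + \<alpha> m * \<alpha> j))
            * (norm (c (m + j)) * norm (a m) * norm (c j))"
        by (intro mult_right_mono mult_left_mono) auto
      also have "\<dots> = K * (norm (V m) * (\<alpha> (m + j) * \<alpha> j + \<alpha> m * \<alpha> (m + j) + \<alpha> m * \<alpha> j)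
            * (norm (c (m + j)) * norm (c j)))"
        by (simp add: V norm_mult mult_ac)
      also have "\<dots> = K * M z"
        by (simp add: M_def Pair abs_mult abs_of_pos[OF \<alpha>(1)] algebra_simps)
      finally have *: "2 * pi * \<bar>(\<alpha> (m + j))\<^sup>2 * real_of_int j - (\<alpha> j)\<^sup>2 * real_of_int (m + j)\<bar>
            * (norm (c (m + j)) * norm (a m) * norm (c j)) \<le> K * M z" .
      have "norm (complex_of_real ((\<alpha> (m + j))\<^sup>2) * of_int j - complex_of_real ((\<alpha> j)\<^sup>2) * of_int (m + j))
         = \<bar>(\<alpha> (m + j))\<^sup>2 * real_of_int j - (\<alpha> j)\<^sup>2 * real_of_int (m + j)\<bar>"
      proof -
        have "complex_of_real ((\<alpha> (m + j))\<^sup>2) * of_int j - complex_of_real ((\<alpha> j)\<^sup>2) * of_int (m + j)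
          = complex_of_real ((\<alpha> (m + j))\<^sup>2 * real_of_int j - (\<alpha> j)\<^sup>2 * real_of_int (m + j))"
          by simp
        then show ?thesis
          by (simp only: norm_of_real)
      qed
      then show ?thesis
        using * by (simp add: Pair norm_mult)
    qed
  qed auto
  from sum_bounded_by_norm_infsum[OF this]
  have "\<bar>2 * Re S\<bar> \<le> K * ((wiener_norm (deriv u) + wiener_norm f) * (cutoff_energy r N (deriv u) + cutoff_energy r N f))"
    using infsumI[OF \<Psi>] by (simp del: Re_complex_of_real)
  then show thesis
    using S that[of S] by (simp add: \<alpha>_def c_def K_def mult.assoc)
qed

text \<open>Products are tame: the weight of the sum of two frequencies is dominated by the sum of the
  weights, so only one factor at a time is measured in the energy.\<close>

lemma cutoff_product:
  assumes f: "wiener f" and g: "wiener g" and h: "wiener h"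
  obtains S where
    "((\<lambda>k. (cutoff r N k)\<^sup>2 * cnj (\<F> h k) * \<F> (\<lambda>x. f x * g x) k) has_sum S) UNIV"
    "\<bar>Re S\<bar> \<le> 2 powr r * (wiener_norm f + wiener_norm g)
        * (cutoff_energy r N h + cutoff_energy r N f + cutoff_energy r N g)"
proof -
  define \<alpha> where "\<alpha> = cutoff r N"
  define a b c where "a = \<F> f" and "b = \<F> g" and "c = \<F> h"
  have \<alpha>: "0 < \<alpha> k" for k
    using cutoff_pos[OF r N] by (auto simp: \<alpha>_def)
  have l1: "(\<lambda>k. norm (a k)) summable_on UNIV" "(\<lambda>k. norm (b k)) summable_on UNIV"
    using wienerD(3)[OF f] wienerD(3)[OF g] by (auto simp: a_def b_def)
  have l2: "(\<lambda>k. (\<alpha> k * norm (a k))\<^sup>2) summable_on UNIV" "(\<lambda>k. (\<alpha> k * norm (b k))\<^sup>2) summable_on UNIV"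
      "(\<lambda>k. (\<alpha> k * norm (c k))\<^sup>2) summable_on UNIV"
    using summable_cutoff[OF f] summable_cutoff[OF g] summable_cutoff[OF h]
    by (auto simp: \<alpha>_def a_def b_def c_def)
  define M where "M = (\<lambda>(m, j). norm (b j) * (\<bar>\<alpha> (m + j) * norm (c (m + j))\<bar> * \<bar>\<alpha> m * norm (a m)\<bar>)
        + norm (a m) * (\<bar>\<alpha> (m + j) * norm (c (m + j))\<bar> * \<bar>\<alpha> j * norm (b j)\<bar>))"
  define \<Phi> where "\<Phi> = (\<lambda>(m, j). (\<alpha> (m + j))\<^sup>2 * cnj (c (m + j)) * (a m * b j))"
  have "sum_bounded_by (\<lambda>z. norm (\<Phi> z))
     (2 powr r * ((wiener_norm f + wiener_norm g) * (cutoff_energy r N h + cutoff_energy r N f + cutoff_energy r N g)))"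
  proof (rule sum_bounded_by_mono)
    have "sum_bounded_by M (wiener_norm g * (cutoff_energy r N h + cutoff_energy r N f) / 2
        + wiener_norm f * (cutoff_energy r N h + cutoff_energy r N g) / 2)"
      unfolding M_def case_prod_unfold
      using sum_bounded_by_add[OF young_trilinear_right[OF l1(2) _ l2(3) l2(1)] young_trilinear[OF l1(1) _ l2(3) l2(2)]]
      unfolding case_prod_unfold wiener_norm_def cutoff_energy_def \<alpha>_def a_def b_def c_def by simp
    then show "sum_bounded_by (\<lambda>z. 2 powr r * M z) (2 powr r * (wiener_norm g * (cutoff_energy r N h + cutoff_energy r N f) / 2
        + wiener_norm f * (cutoff_energy r N h + cutoff_energy r N g) / 2))"
      by (rule sum_bounded_by_cmult) auto
    have "0 \<le> wiener_norm f * cutoff_energy r N h" "0 \<le> wiener_norm f * cutoff_energy r N f"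
      "0 \<le> wiener_norm f * cutoff_energy r N g" "0 \<le> wiener_norm g * cutoff_energy r N h"
      "0 \<le> wiener_norm g * cutoff_energy r N f" "0 \<le> wiener_norm g * cutoff_energy r N g"
      using wiener_norm_nonneg cutoff_energy_nonneg by simp_all
    then show "2 powr r * (wiener_norm g * (cutoff_energy r N h + cutoff_energy r N f) / 2
        + wiener_norm f * (cutoff_energy r N h + cutoff_energy r N g) / 2)
      \<le> 2 powr r * ((wiener_norm f + wiener_norm g) * (cutoff_energy r N h + cutoff_energy r N f + cutoff_energy r N g))"
      by (intro mult_left_mono) (simp_all add: field_simps)
    show "norm (\<Phi> z) \<le> 2 powr r * M z" for z
    proof (cases z)
      case (Pair m j)
      have "\<alpha> (m + j) \<le> 2 powr r * (\<alpha> m + \<alpha> j)"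
        using cutoff_triangle[OF r N, of m j] by (simp add: \<alpha>_def)
      then have "\<alpha> (m + j) * (\<alpha> (m + j) * (norm (c (m + j)) * norm (a m) * norm (b j)))
         \<le> (2 powr r * (\<alpha> m + \<alpha> j)) * (\<alpha> (m + j) * (norm (c (m + j)) * norm (a m) * norm (b j)))"
        using \<alpha>[of "m + j"] by (intro mult_right_mono) auto
      also have "\<dots> = 2 powr r * M z"
        by (simp add: M_def Pair abs_mult abs_of_pos[OF \<alpha>] algebra_simps)
      also have "\<alpha> (m + j) * (\<alpha> (m + j) * (norm (c (m + j)) * norm (a m) * norm (b j))) = norm (\<Phi> z)"
        by (simp add: \<Phi>_def Pair norm_mult norm_power abs_of_pos[OF \<alpha>]) (simp add: power2_eq_square)
      finally show ?thesis .
    qed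
  qed auto
  note B = this
  have "\<Phi> summable_on UNIV"
    by (rule abs_summable_summable) (use B sum_bounded_by_def in blast)
  then have "((\<lambda>k. ((\<alpha> k)\<^sup>2 * cnj (c k)) * \<F> (\<lambda>x. f x * g x) k) has_sum infsum \<Phi> UNIV) UNIV"
    unfolding \<Phi>_def using fourier_coeff_mult[OF f wienerD(1)[OF g]]
    by (intro has_sum_convolution_pairing[where b="\<lambda>k. (\<alpha> k)\<^sup>2 * cnj (c k)" and c=b]) (auto simp: a_def b_def)
  moreover have "\<bar>Re (infsum \<Phi> UNIV)\<bar> \<le> 2 powr r * ((wiener_norm f + wiener_norm g) * (cutoff_energy r N h + cutoff_energy r N f + cutoff_energy r N g))"
    using abs_Re_le_cmod[of "infsum \<Phi> UNIV"] sum_bounded_by_norm_infsum[OF B] by linarith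
  ultimately show thesis
    using that[of "infsum \<Phi> UNIV"] by (simp add: \<alpha>_def c_def mult.assoc)
qed

end

text \<open>For the exact weight \<open>(2 \<pi> k)\<^sup>2\<close> the antisymmetrised symbol is the product of the three derivatives,
  and the form is an integral. The unsymmetrised double sum has three derivatives on the two
  factors \<open>f\<close>; it converges absolutely in \<open>H\<^bsup>3/2\<^esup>\<close>, since half a derivative can be shifted from one of
  them to the other at the expense of one on \<open>u\<close>.\<close>

lemma gradient_transport:
  assumes u: "wiener u" "(\<lambda>k. norm (of_int k * \<F> u k)) summable_on UNIV"
    and f: "wiener f" "(\<lambda>k. norm (of_int k * \<F> f k)) summable_on UNIV"
    and H: "hseq (3 / 2) (\<F> f)"
  obtains S where
    "((\<lambda>k. (2 * pi * real_of_int k)\<^sup>2 * cnj (\<F> f k) * \<F> (\<lambda>x. u x * deriv f x) k) has_sum S) UNIV"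
    "2 * Re S = integral {0..1} (\<lambda>x. deriv u x * (deriv f x)\<^sup>2)"
proof -
  define a c V D where "a = \<F> u" and "c = \<F> f"
    and "V = \<F> (deriv u)" and "D = \<F> (deriv f)"
  define \<omega> where "\<omega> k = (2 * pi * real_of_int k)\<^sup>2" for k
  note du = wiener_deriv[OF u] and df = wiener_deriv[OF f]
  have V: "V k = 2 * pi * \<i> * of_int k * a k" and D: "D k = 2 * pi * \<i> * of_int k * c k" for k
    by (simp_all add: V_def a_def du(2) D_def c_def df(2))
  define x where "x k = \<bar>2 * pi * real_of_int k\<bar> powr (3 / 2) * norm (c k)" for k
  have x2: "(\<lambda>k. (x k)\<^sup>2) summable_on UNIV"
  proof -
    have "\<bar>2 * pi * real_of_int k\<bar> powr 3 \<le> 1 * bracket k powr (3 / 2)" for k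
    proof -
      have "\<bar>2 * pi * real_of_int k\<bar> powr 3 \<le> (bracket k powr (1 / 2)) powr 3"
        by (intro powr_mono2 abs_le_bracket_powr) auto
      then show ?thesis by (simp add: powr_powr)
    qed
    then have "sum_bounded_by (\<lambda>k. \<bar>2 * pi * real_of_int k\<bar> powr 3 * (cmod (c k))\<^sup>2) (1 * (hnorm (3 / 2) c)\<^sup>2)"
      using H by (intro hseq_weighted) (auto simp: c_def)
    moreover have "(x k)\<^sup>2 = \<bar>2 * pi * real_of_int k\<bar> powr 3 * (cmod (c k))\<^sup>2" for k
      using powr_add[of "\<bar>2 * pi * real_of_int k\<bar>" "3 / 2" "3 / 2"] by (simp add: x_def power2_eq_square mult_ac)
    ultimately show ?thesis
      by (simp add: sum_bounded_by_def)
  qed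
  have p: "(\<lambda>k. norm (a k) + norm (of_int k * a k)) summable_on UNIV"
    using u wienerD(3)[OF u(1)] by (intro summable_on_add) (auto simp: a_def)
  have sum\<Phi>: "(\<lambda>(m, j). norm (\<omega> (m + j) * cnj (c (m + j)) * (a m * (2 * pi * \<i> * of_int j * c j)))) summable_on UNIV"
  proof -
    have "sum_bounded_by (\<lambda>(m, j). (norm (a m) + norm (of_int m * a m)) * (\<bar>x (m + j)\<bar> * \<bar>x j\<bar>))
       ((\<Sum>\<^sub>\<infinity>k. norm (a k) + norm (of_int k * a k)) * ((\<Sum>\<^sub>\<infinity>k. (x k)\<^sup>2) + (\<Sum>\<^sub>\<infinity>k. (x k)\<^sup>2)) / 2)"
      by (rule young_trilinear[OF p _ x2 x2]) auto
    then have "sum_bounded_by (\<lambda>(m, j). norm (\<omega> (m + j) * cnj (c (m + j)) * (a m * (2 * pi * \<i> * of_int j * c j))))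
       ((\<Sum>\<^sub>\<infinity>k. norm (a k) + norm (of_int k * a k)) * ((\<Sum>\<^sub>\<infinity>k. (x k)\<^sup>2) + (\<Sum>\<^sub>\<infinity>k. (x k)\<^sup>2)) / 2)"
    proof (rule sum_bounded_by_mono)
      fix z :: "int \<times> int"
      obtain m j where z: "z = (m, j)" by (cases z)
      define k q where "k = \<bar>2 * pi * real_of_int (m + j)\<bar>" and "q = \<bar>2 * pi * real_of_int j\<bar>"
      have le: "k powr 2 * q \<le> (1 + \<bar>real_of_int m\<bar>) * (k powr (3 / 2) * q powr (3 / 2))"
      proof (cases "j = 0")
        case False
        then have j: "1 \<le> \<bar>real_of_int j\<bar>" by linarith
        have "\<bar>real_of_int (m + j)\<bar> \<le> \<bar>real_of_int m\<bar> * 1 + \<bar>real_of_int j\<bar>"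
          by simp
        also have "\<dots> \<le> \<bar>real_of_int m\<bar> * \<bar>real_of_int j\<bar> + \<bar>real_of_int j\<bar>"
          using j by (intro add_mono mult_left_mono) auto
        finally have "2 * pi * \<bar>real_of_int (m + j)\<bar>
            \<le> 2 * pi * (\<bar>real_of_int m\<bar> * \<bar>real_of_int j\<bar> + \<bar>real_of_int j\<bar>)"
          by (intro mult_left_mono) auto
        moreover have "k = 2 * pi * \<bar>real_of_int (m + j)\<bar>" "q = 2 * pi * \<bar>real_of_int j\<bar>"
          unfolding k_def q_def abs_mult by simp_all
        moreover have "(1 + M) * (2 * pi * J) = 2 * pi * (M * J + J)" for M J :: real
          by (simp add: algebra_simps)
        ultimately have "k \<le> (1 + \<bar>real_of_int m\<bar>) * q"
          by presburger
        then have "k powr (1 / 2) \<le> ((1 + \<bar>real_of_int m\<bar>) * q) powr (1 / 2)"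
          by (intro powr_mono2) (auto simp: k_def)
        also have "\<dots> = (1 + \<bar>real_of_int m\<bar>) powr (1 / 2) * q powr (1 / 2)"
          by (rule powr_mult)
        also have "\<dots> \<le> (1 + \<bar>real_of_int m\<bar>) powr 1 * q powr (1 / 2)"
          by (intro mult_right_mono powr_mono) auto
        finally have "k powr (3 / 2) * q * k powr (1 / 2) \<le> k powr (3 / 2) * q * ((1 + \<bar>real_of_int m\<bar>) * q powr (1 / 2))"
          by (intro mult_left_mono) (auto simp: q_def)
        moreover have "k powr 2 = k powr (3 / 2) * k powr (1 / 2)" "q powr (3 / 2) = q * q powr (1 / 2)"
          using powr_add[of k "3 / 2" "1 / 2"] powr_add[of q 1 "1 / 2"] by (simp_all add: q_def)
        ultimately show ?thesis
          by (simp add: mult_ac)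
      qed (simp add: q_def)
      have "norm (\<omega> (m + j) * cnj (c (m + j)) * (a m * (2 * pi * \<i> * of_int j * c j)))
          = (k powr 2 * q) * (norm (c (m + j)) * norm (a m) * norm (c j))"
      proof -
        have "0 \<le> k"
          by (simp add: k_def)
        then have "k powr 2 = k\<^sup>2"
          by (cases "k = 0") (simp_all add: powr_numeral)
        then have "norm (complex_of_real (\<omega> (m + j))) = k powr 2"
          unfolding norm_of_real by (simp add: \<omega>_def k_def)
        moreover have "norm (2 * pi * \<i> * of_int j * c j) = q * norm (c j)"
          by (simp add: norm_mult q_def abs_mult)
        ultimately show ?thesis
          unfolding norm_mult by (simp only: complex_mod_cnj mult_ac)
      qed
      also have "\<dots> \<le> ((1 + \<bar>real_of_int m\<bar>) * (k powr (3 / 2) * q powr (3 / 2))) * (norm (c (m + j)) * norm (a m) * norm (c j))"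
        by (intro mult_right_mono le) auto
      also have "\<dots> = (norm (a m) + norm (of_int m * a m)) * (\<bar>x (m + j)\<bar> * \<bar>x j\<bar>)"
        by (simp add: x_def k_def q_def norm_mult algebra_simps)
      finally show "(case z of (m, j) \<Rightarrow> norm (\<omega> (m + j) * cnj (c (m + j)) * (a m * (2 * pi * \<i> * of_int j * c j))))
         \<le> (case z of (m, j) \<Rightarrow> (norm (a m) + norm (of_int m * a m)) * (\<bar>x (m + j)\<bar> * \<bar>x j\<bar>))"
        by (simp add: z)
    qed auto
    then show ?thesis
      by (simp add: sum_bounded_by_def)
  qed
  obtain S where S: "((\<lambda>k. \<omega> k * cnj (c k) * \<F> (\<lambda>x. u x * deriv f x) k) has_sum S) UNIV"
    and \<Psi>: "((\<lambda>(m, j). 2 * pi * \<i> * (\<omega> (m + j) * of_int j - \<omega> j * of_int (m + j)) *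
        (cnj (c (m + j)) * a m * c j)) has_sum complex_of_real (2 * Re S)) UNIV"
  proof (rule transport_symmetrised[OF _ sum\<Phi>])
    show "a (- m) = cnj (a m)" for m
      by (simp add: a_def fourier_coeff_uminus)
    show "((\<lambda>m. a m * (2 * pi * \<i> * of_int (k - m) * c (k - m))) has_sum \<F> (\<lambda>x. u x * deriv f x) k) UNIV" for k
      using fourier_coeff_mult[OF u(1) wienerD(1)[OF df(3)], of k] by (simp add: df(2) a_def c_def)
  qed (use that in auto)
  have "2 * pi * \<i> * (\<omega> (m + j) * of_int j - \<omega> j * of_int (m + j)) * (cnj (c (m + j)) * a m * c j)
      = cnj (D (m + j)) * (V m * D j)" for m j
    by (simp add: D V \<omega>_def power2_eq_square algebra_simps)
  then have "((\<lambda>(m, j). cnj (D (m + j)) * (V m * D j)) has_sum complex_of_real (2 * Re S)) UNIV"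
    using \<Psi> by simp
  then have "(\<lambda>(m, j). cnj (D (m + j)) * (V m * D j)) summable_on UNIV"
    "(\<Sum>\<^sub>\<infinity>(m, j). cnj (D (m + j)) * (V m * D j)) = complex_of_real (2 * Re S)"
    by (auto simp: has_sum_iff)
  with has_sum_convolution_pairing[where b="\<lambda>k. cnj (D k)" and a=V and c=D
      and g="\<F> (\<lambda>x. deriv u x * deriv f x)"]
  have "((\<lambda>k. cnj (D k) * \<F> (\<lambda>x. deriv u x * deriv f x) k) has_sum complex_of_real (2 * Re S)) UNIV"
    using fourier_coeff_mult[OF du(3) wienerD(1)[OF df(3)]] by (simp add: V_def D_def)
  moreover have "((\<lambda>k. cnj (D k) * \<F> (\<lambda>x. deriv u x * deriv f x) k) has_sum
      complex_of_real (integral {0..1} (\<lambda>x. deriv f x * (deriv u x * deriv f x)))) UNIV"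
    unfolding D_def by (intro parseval df(3) continuous_intros wienerD(1)[OF du(3)] wienerD(1)[OF df(3)])
  ultimately have "complex_of_real (2 * Re S) = complex_of_real (integral {0..1} (\<lambda>x. deriv f x * (deriv u x * deriv f x)))"
    by (rule has_sum_unique)
  then have "2 * Re S = integral {0..1} (\<lambda>x. deriv f x * (deriv u x * deriv f x))"
    unfolding of_real_eq_iff .
  then have "2 * Re S = integral {0..1} (\<lambda>x. deriv u x * (deriv f x)\<^sup>2)"
    by (simp add: power2_eq_square mult_ac)
  then show thesis
    using S that[of S] by (simp add: \<omega>_def c_def)
qed

section \<open>The system at a fixed time\<close>

lemma hseq_deriv:
  assumes "hseq (r + 1) c"
  shows "hseq r (\<lambda>k. 2 * pi * \<i> * of_int k * c k)"
proof -
  have "bracket k powr r * (2 * pi * of_int k)\<^sup>2 \<le> 1 * bracket k powr (r + 1)" for k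
    using mult_left_mono[of "(2 * pi * of_int k)\<^sup>2" "bracket k" "bracket k powr r"]
    by (simp add: powr_add bracket_def)
  then have "sum_bounded_by (\<lambda>k. (bracket k powr r * (2 * pi * of_int k)\<^sup>2) * (cmod (c k))\<^sup>2) (1 * (hnorm (r + 1) c)\<^sup>2)"
    by (intro hseq_weighted assms) auto
  then show ?thesis
    by (simp add: hseq_def sum_bounded_by_def norm_mult power_mult_distrib mult_ac)
qed

text \<open>The regularity and the equations of a solution at one instant; \<open>b\<close> is the value of \<open>h\<close>, and
  \<open>u'\<close>, \<open>\<rho>'\<close> are the time derivatives.\<close>

locale hs_slice =
  fixes s \<kappa> b :: real and u \<rho> u' \<rho>' :: "real \<Rightarrow> real"
  assumes s: "5 / 2 < s" and \<kappa>: "0 \<le> \<kappa>"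
    and u: "u \<in> sobolev s" "continuous_on UNIV u"
    and \<rho>: "\<rho> \<in> sobolev (s - 1)" "continuous_on UNIV \<rho>"
    and u': "u' \<in> sobolev (s - 1)" and \<rho>': "\<rho>' \<in> sobolev (s - 2)"
    and u_eq: "AE x in lborel. u' x + u x * deriv u x =
       dx_inv (\<lambda>y. \<kappa> / 2 * (\<rho> y)\<^sup>2 + (- 1 + 2) / 2 * (deriv u y)\<^sup>2 + hs_a (- 1) \<kappa> u \<rho>) x + b"
    and \<rho>_eq: "AE x in lborel. \<rho>' x + u x * deriv \<rho> x = - 1 * deriv u x * \<rho> x"
begin

abbreviation "v \<equiv> deriv u"
abbreviation "w \<equiv> deriv (deriv u)"
abbreviation "\<eta> \<equiv> deriv \<rho>"

lemma u_wiener: "wiener u" "(\<lambda>k. norm (of_int k * \<F> u k)) summable_on UNIV"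
  using sobolev_wiener[OF u(1) _ u(2)] hseq_summable(2)[OF sobolev_hseq[OF u(1)]] s by auto

lemma \<rho>_wiener: "wiener \<rho>" "(\<lambda>k. norm (of_int k * \<F> \<rho> k)) summable_on UNIV"
  using sobolev_wiener[OF \<rho>(1) _ \<rho>(2)] hseq_summable(2)[OF sobolev_hseq[OF \<rho>(1)]] s by auto

lemmas du = wiener_deriv[OF u_wiener]
lemmas d\<rho> = wiener_deriv[OF \<rho>_wiener]

lemma v_wiener: "wiener v" "(\<lambda>k. norm (of_int k * \<F> v k)) summable_on UNIV"
proof -
  show "wiener v" by (rule du(3))
  have "(\<lambda>k. norm (of_int k * (of_int k * \<F> u k))) summable_on UNIV"
    using hseq_summable(3)[OF sobolev_hseq[OF u(1)]] s by auto
  then have "(\<lambda>k. (2 * pi) * norm (of_int k * (of_int k * \<F> u k))) summable_on UNIV"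
    by (rule summable_on_cmult_right)
  then show "(\<lambda>k. norm (of_int k * \<F> v k)) summable_on UNIV"
    unfolding du(2) by (simp add: norm_mult mult_ac)
qed

lemmas dv = wiener_deriv[OF v_wiener]

lemma cont: "continuous_on A u" "continuous_on A v" "continuous_on A w" "continuous_on A \<rho>" "continuous_on A \<eta>"
  using wienerD(1)[OF u_wiener(1)] wienerD(1)[OF v_wiener(1)] wienerD(1)[OF dv(3)]
    wienerD(1)[OF \<rho>_wiener(1)] wienerD(1)[OF d\<rho>(3)] .

lemma periodic: "u 1 = u 0" "v 1 = v 0" "w 1 = w 0" "\<rho> 1 = \<rho> 0" "\<eta> 1 = \<eta> 0"
  using wienerD(2)[OF u_wiener(1), of 0] wienerD(2)[OF v_wiener(1), of 0] wienerD(2)[OF dv(3), of 0]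
    wienerD(2)[OF \<rho>_wiener(1), of 0] wienerD(2)[OF d\<rho>(3), of 0] by simp_all

text \<open>The integrand on the right-hand side of the equation for \<open>u\<close>.\<close>

definition G :: "real \<Rightarrow> real" where
  "G y = \<kappa> / 2 * (\<rho> y)\<^sup>2 + (- 1 + 2) / 2 * (v y)\<^sup>2 + hs_a (- 1) \<kappa> u \<rho>"

text \<open>The part of \<open>v\<^sub>t\<close> that remains besides the transport term \<open>- u v\<^sub>x\<close> and the constant \<open>a\<close>.\<close>

definition q :: "real \<Rightarrow> real" where
  "q x = \<kappa> / 2 * (\<rho> x * \<rho> x) - 1 / 2 * (v x * v x)"

lemma G_cont: "continuous_on A G"
  unfolding G_def[abs_def] by (intro continuous_intros cont)

lemma q_cont: "continuous_on A q"
  unfolding q_def[abs_def] by (intro continuous_intros cont)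

lemma LBINT_0: "0 \<le> x \<Longrightarrow> continuous_on UNIV f \<Longrightarrow> (LBINT y=0..ereal x. f y) = integral {0..x} (f :: real \<Rightarrow> real)"
  unfolding zero_ereal_def by (rule interval_integral_eq_integral) (auto intro: set_integrable_continuous)

lemma LBINT_01: "continuous_on UNIV f \<Longrightarrow> (LBINT y=0..1. f y) = integral {0..1} (f :: real \<Rightarrow> real)"
  using LBINT_0[of 1 f] by (simp add: one_ereal_def)

text \<open>The constant \<open>a\<close> makes the mean of \<open>G\<close> vanish, whence the primitive is periodic.\<close>

lemma dx_inv_G: "dx_inv G 0 = 0" "dx_inv G 1 = 0" "(dx_inv G has_real_derivative G x) (at x)"
proof -
  show "dx_inv G 0 = 0"
    by (simp add: dx_inv_def zero_ereal_def)
  have const: "((\<lambda>x. c) has_integral (1 - 0) *\<^sub>R c) {0..1::real}" for c :: real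
    using has_integral_const_real[of c 0 1] by simp
  have "(G has_integral \<kappa> / 2 * integral {0..1} (\<lambda>y. (\<rho> y)\<^sup>2) + (- 1 + 2) / 2 * integral {0..1} (\<lambda>y. (v y)\<^sup>2)
      + (1 - 0) *\<^sub>R hs_a (- 1) \<kappa> u \<rho>) {0..1}"
    unfolding G_def[abs_def]
    by (intro has_integral_add has_integral_mult_right integrable_integral integrable_continuous_real
        const continuous_intros cont)
  moreover have "hs_a (- 1) \<kappa> u \<rho> = - (\<kappa> / 2) * integral {0..1} (\<lambda>y. (\<rho> y)\<^sup>2) - (- 1 + 2) / 2 * integral {0..1} (\<lambda>y. (v y)\<^sup>2)"
    unfolding hs_a_def by (subst (1 2) LBINT_01) (auto intro!: continuous_intros cont)
  ultimately have "(G has_integral 0) {0..1}"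
    by simp
  then show "dx_inv G 1 = 0"
    using LBINT_01[OF G_cont] by (simp add: dx_inv_def one_ereal_def integral_unique)
  define l where "l = - \<bar>x\<bar> - 1"
  define m where "m = \<bar>x\<bar> + 1"
  have "((\<lambda>z. LBINT y=0..z. G y) has_vector_derivative G x) (at x within {l..m})"
    using interval_integral_FTC2[of l 0 m G x] G_cont by (simp add: l_def m_def zero_ereal_def)
  then have "((\<lambda>z. LBINT y=0..z. G y) has_vector_derivative G x) (at x)"
    by (subst (asm) at_within_Icc_at) (auto simp: l_def m_def)
  then show "(dx_inv G has_real_derivative G x) (at x)"
    by (simp add: dx_inv_def[abs_def] has_real_derivative_iff_has_vector_derivative)
qed

lemma dx_inv_G_cont: "continuous_on A (dx_inv G)"
  using dx_inv_G(3) by (meson DERIV_continuous_on has_field_derivative_at_within)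

lemma coeff_u':
  "\<F> u' k = \<F> (dx_inv G) k - \<F> (\<lambda>x. u x * v x) k
     + (if k = 0 then of_real b else 0)"
proof -
  have c: "continuous_on UNIV (\<lambda>x. dx_inv G x - u x * v x)"
    by (intro continuous_intros dx_inv_G_cont cont)
  have "\<F> u' k = \<F> (\<lambda>x. (dx_inv G x - u x * v x) + b) k"
  proof (rule fourier_coeff_cong_AE)
    show "AE x in lborel. u' x = dx_inv G x - u x * v x + b"
      using u_eq by (simp add: G_def[abs_def] algebra_simps)
    show "(\<lambda>x. dx_inv G x - u x * v x + b) \<in> borel_measurable borel"
      by (intro borel_measurable_continuous_onI continuous_intros dx_inv_G_cont cont)
  qed (use u' in \<open>auto simp: sobolev_def\<close>)
  also have "\<dots> = \<F> (\<lambda>x. dx_inv G x - u x * v x) k + \<F> (\<lambda>x. b) k"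
    by (intro fourier_coeff_add set_integrable_continuous c continuous_intros)
  also have "\<F> (\<lambda>x. dx_inv G x - u x * v x) k = \<F> (dx_inv G) k - \<F> (\<lambda>x. u x * v x) k"
    by (intro fourier_coeff_diff set_integrable_continuous continuous_intros dx_inv_G_cont cont)
  finally show ?thesis
    by (simp add: fourier_coeff_const)
qed

text \<open>
  The equation for \<open>v = u\<^sub>x\<close>: \<open>v\<^sub>t = - u v\<^sub>x - v\<^sup>2 / 2 + \<kappa> \<rho>\<^sup>2 / 2 + a\<close>. The constant \<open>a\<close> only enters
  the coefficient of index \<open>0\<close>.
\<close>

lemma coeff_deriv_u':
  assumes "k \<noteq> 0"
  shows "2 * pi * \<i> * of_int k * \<F> u' k = \<F> q k - \<F> (\<lambda>x. u x * w x) k"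
proof -
  have F: "\<F> G k = 2 * pi * \<i> * of_int k * \<F> (dx_inv G) k"
    by (rule fourier_coeff_deriv[OF _ dx_inv_G(3) G_cont]) (simp add: dx_inv_G)
  have "((\<lambda>x. u x * v x) has_real_derivative (v x * v x + u x * w x)) (at x)" for x
    using DERIV_mult[OF du(1)[of x] dv(1)[of x]] by (simp add: algebra_simps)
  then have P: "\<F> (\<lambda>x. v x * v x + u x * w x) k = 2 * pi * \<i> * of_int k * \<F> (\<lambda>x. u x * v x) k"
    by (intro fourier_coeff_deriv continuous_intros cont) (simp_all add: periodic)
  have "G = (\<lambda>x. (q x + v x * v x) + hs_a (- 1) \<kappa> u \<rho>)"
    by (auto simp: fun_eq_iff G_def q_def power2_eq_square)
  then have "\<F> G k = \<F> (\<lambda>x. q x + v x * v x) k + \<F> (\<lambda>x. hs_a (- 1) \<kappa> u \<rho>) k"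
    by (simp only:) (intro fourier_coeff_add set_integrable_continuous continuous_intros q_cont cont)
  also have "\<F> (\<lambda>x. q x + v x * v x) k = \<F> q k + \<F> (\<lambda>x. v x * v x) k"
    by (intro fourier_coeff_add set_integrable_continuous continuous_intros q_cont cont)
  finally have G: "\<F> G k = \<F> q k + \<F> (\<lambda>x. v x * v x) k"
    using assms by (simp add: fourier_coeff_const)
  have "\<F> (\<lambda>x. v x * v x + u x * w x) k = \<F> (\<lambda>x. v x * v x) k + \<F> (\<lambda>x. u x * w x) k"
    by (intro fourier_coeff_add set_integrable_continuous continuous_intros cont)
  moreover have "2 * pi * \<i> * of_int k * \<F> u' k
      = \<F> G k - \<F> (\<lambda>x. v x * v x + u x * w x) k"
    unfolding F P coeff_u' using assms by (simp add: right_diff_distrib)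
  ultimately show ?thesis
    using G by simp
qed

lemma coeff_\<rho>':
  "\<F> \<rho>' k = - \<F> (\<lambda>x. u x * \<eta> x) k - \<F> (\<lambda>x. v x * \<rho> x) k"
proof -
  have "\<F> \<rho>' k = \<F> (\<lambda>x. (- 1) * (u x * \<eta> x) - v x * \<rho> x) k"
  proof (rule fourier_coeff_cong_AE)
    show "AE x in lborel. \<rho>' x = (- 1) * (u x * \<eta> x) - v x * \<rho> x"
      using \<rho>_eq by eventually_elim linarith
    show "(\<lambda>x. (- 1) * (u x * \<eta> x) - v x * \<rho> x) \<in> borel_measurable borel"
      by (intro borel_measurable_continuous_onI continuous_intros cont)
  qed (use \<rho>' in \<open>auto simp: sobolev_def\<close>)
  also have "\<dots> = \<F> (\<lambda>x. (- 1) * (u x * \<eta> x)) k - \<F> (\<lambda>x. v x * \<rho> x) k"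
    by (intro fourier_coeff_diff set_integrable_continuous continuous_intros cont)
  finally show ?thesis
    unfolding fourier_coeff_cmult by simp
qed

text \<open>The equation for \<open>\<rho>\<close> is the conservation law \<open>\<rho>\<^sub>t = - (u \<rho>)\<^sub>x\<close>.\<close>

lemma mean_\<rho>': "\<F> \<rho>' 0 = 0"
proof -
  have "((\<lambda>x. u x * \<rho> x) has_real_derivative (u x * \<eta> x + v x * \<rho> x)) (at x)" for x
    using DERIV_mult[OF du(1)[of x] d\<rho>(1)[of x]] by (simp add: algebra_simps)
  then have "\<F> (\<lambda>x. u x * \<eta> x + v x * \<rho> x) 0 = 2 * pi * \<i> * of_int 0 * \<F> (\<lambda>x. u x * \<rho> x) 0"
    by (intro fourier_coeff_deriv continuous_intros cont) (simp_all add: periodic)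
  moreover have "\<F> (\<lambda>x. u x * \<eta> x + v x * \<rho> x) 0 = \<F> (\<lambda>x. u x * \<eta> x) 0 + \<F> (\<lambda>x. v x * \<rho> x) 0"
    by (intro fourier_coeff_add set_integrable_continuous continuous_intros cont)
  ultimately have "\<F> (\<lambda>x. u x * \<eta> x) 0 + \<F> (\<lambda>x. v x * \<rho> x) 0 = 0"
    by simp
  then show ?thesis
    unfolding coeff_\<rho>' by (metis add.inverse_inverse diff_conv_add_uminus minus_add_distrib neg_equal_0_iff_equal)
qed

text \<open>The transport term \<open>u u\<^sub>x\<close> is a derivative and has mean zero; what is left is the mean of a
  primitive of \<open>G\<close>, and \<open>\<bar>G\<bar>\<close> is bounded in terms of the suprema of \<open>\<bar>\<rho>\<bar>\<close> and \<open>\<bar>v\<bar>\<close>.\<close>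

lemma mean_u': "cmod (\<F> u' 0) \<le> \<kappa> * (wiener_norm \<rho>)\<^sup>2 + (wiener_norm v)\<^sup>2 + \<bar>b\<bar>"
proof -
  define B where "B = \<kappa> / 2 * (wiener_norm \<rho>)\<^sup>2 + 1 / 2 * (wiener_norm v)\<^sup>2"
  have sq: "(\<rho> x)\<^sup>2 \<le> (wiener_norm \<rho>)\<^sup>2" "(v x)\<^sup>2 \<le> (wiener_norm v)\<^sup>2" for x
    using power_mono[OF wiener_abs_le[OF \<rho>_wiener(1), of x] abs_ge_zero, of 2]
      power_mono[OF wiener_abs_le[OF v_wiener(1), of x] abs_ge_zero, of 2]
    by (simp_all add: wiener_norm_def)
  have g: "0 \<le> \<kappa> / 2 * (\<rho> x)\<^sup>2 + 1 / 2 * (v x)\<^sup>2" "\<kappa> / 2 * (\<rho> x)\<^sup>2 + 1 / 2 * (v x)\<^sup>2 \<le> B" for x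
    unfolding B_def using \<kappa> sq by (auto intro!: add_mono mult_left_mono)
  have I: "0 \<le> integral {0..1} (\<lambda>x. (\<rho> x)\<^sup>2)" "integral {0..1} (\<lambda>x. (\<rho> x)\<^sup>2) \<le> (wiener_norm \<rho>)\<^sup>2"
    "0 \<le> integral {0..1} (\<lambda>x. (v x)\<^sup>2)" "integral {0..1} (\<lambda>x. (v x)\<^sup>2) \<le> (wiener_norm v)\<^sup>2"
    using integral_bound[of 0 1 "\<lambda>x. (\<rho> x)\<^sup>2" "(wiener_norm \<rho>)\<^sup>2"] integral_bound[of 0 1 "\<lambda>x. (v x)\<^sup>2" "(wiener_norm v)\<^sup>2"] sq
    by (auto intro!: integral_nonneg integrable_continuous_real continuous_intros cont dest!: abs_le_D1)
  have a: "hs_a (- 1) \<kappa> u \<rho> = - (\<kappa> / 2 * integral {0..1} (\<lambda>y. (\<rho> y)\<^sup>2)) - 1 / 2 * integral {0..1} (\<lambda>y. (v y)\<^sup>2)"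
    unfolding hs_a_def by (subst (1 2) LBINT_01) (auto intro!: continuous_intros cont)
  have "0 \<le> \<kappa> / 2 * integral {0..1} (\<lambda>y. (\<rho> y)\<^sup>2)" "\<kappa> / 2 * integral {0..1} (\<lambda>y. (\<rho> y)\<^sup>2) \<le> \<kappa> / 2 * (wiener_norm \<rho>)\<^sup>2"
    using \<kappa> I by (auto intro!: mult_left_mono)
  then have a: "- B \<le> hs_a (- 1) \<kappa> u \<rho>" "hs_a (- 1) \<kappa> u \<rho> \<le> 0"
    using I unfolding a B_def by linarith+
  have B: "0 \<le> B"
    using g[of 0] by linarith
  have G: "norm (G x) \<le> B" for x
    using g[of x] a by (simp add: G_def abs_le_iff)
  have F: "norm (dx_inv G x) \<le> B" if "x \<in> {0..1}" for x
  proof -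
    have "dx_inv G x = integral {0..x} G"
      unfolding dx_inv_def by (rule LBINT_0) (use that G_cont in auto)
    then have "norm (dx_inv G x) \<le> B * (x - 0)"
      using integral_bound[of 0 x G B] G G_cont that by auto
    also have "\<dots> \<le> B"
      using that B mult_left_mono[of x 1 B] by simp
    finally show ?thesis .
  qed
  have "cmod (\<F> (dx_inv G) 0) \<le> B"
    unfolding fourier_coeff_continuous[OF dx_inv_G_cont]
    using integral_bound[of 0 1 "\<lambda>x. complex_of_real (dx_inv G x) * mode (- 0) x" B] F
    by (auto intro!: continuous_intros dx_inv_G_cont simp: norm_mult)
  moreover have "\<F> (\<lambda>x. u x * v x) 0 = 0"
  proof -
    have "((\<lambda>x. 1 / 2 * (u x * u x)) has_real_derivative (u x * v x)) (at x)" for x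
      using DERIV_cmult[OF DERIV_mult[OF du(1)[of x] du(1)[of x]], of "1 / 2"] by (simp add: algebra_simps)
    then have "\<F> (\<lambda>x. u x * v x) 0 = 2 * pi * \<i> * of_int 0 * \<F> (\<lambda>x. 1 / 2 * (u x * u x)) 0"
      by (intro fourier_coeff_deriv continuous_intros cont) (simp_all add: periodic)
    then show ?thesis by simp
  qed
  ultimately have "cmod (\<F> u' 0) \<le> B + \<bar>b\<bar>"
    using norm_triangle_ineq[of "\<F> (dx_inv G) 0" "of_real b"] by (simp add: coeff_u')
  also have "B \<le> \<kappa> * (wiener_norm \<rho>)\<^sup>2 + (wiener_norm v)\<^sup>2"
    using mult_nonneg_nonneg[OF \<kappa> zero_le_power2[of "wiener_norm \<rho>"]] zero_le_power2[of "wiener_norm v"]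
    unfolding B_def by linarith
  finally show ?thesis by simp
qed

lemma coeff_pairing_u:
  "(2 * pi * real_of_int k)\<^sup>2 * cnj (\<F> u k) * \<F> u' k
     = cnj (\<F> v k) * \<F> q k - cnj (\<F> v k) * \<F> (\<lambda>x. u x * w x) k"
proof (cases "k = 0")
  case False
  have "(2 * pi * real_of_int k)\<^sup>2 * cnj (\<F> u k) * \<F> u' k
    = cnj (\<F> v k) * (2 * pi * \<i> * of_int k * \<F> u' k)"
    by (simp add: du(2) power2_eq_square mult_ac)
  then show ?thesis
    unfolding coeff_deriv_u'[OF False] by (simp only: right_diff_distrib)
qed (simp add: du(2))

text \<open>
  The identity \<open>d/dt \<integral> (u\<^sub>x\<^sub>x\<^sup>2 + \<kappa> \<rho>\<^sub>x\<^sup>2) = - 3 \<integral> u\<^sub>x (u\<^sub>x\<^sub>x\<^sup>2 + \<kappa> \<rho>\<^sub>x\<^sup>2)\<close>: the coupling terms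
  \<open>2 \<kappa> \<integral> \<rho> \<rho>\<^sub>x u\<^sub>x\<^sub>x\<close> of the two equations cancel.
\<close>

lemma gradient_energy_identity:
  "2 * Re (\<Sum>\<^sub>\<infinity>k. ((2 * pi * real_of_int k) ^ 4) * cnj (\<F> u k) * \<F> u' k)
    + \<kappa> * (2 * Re (\<Sum>\<^sub>\<infinity>k. ((2 * pi * real_of_int k)\<^sup>2) * cnj (\<F> \<rho> k) * \<F> \<rho>' k))
   = - 3 * integral {0..1} (\<lambda>x. v x * ((w x)\<^sup>2 + \<kappa> * (\<eta> x)\<^sup>2))"
proof -
  have hv: "hseq (3 / 2) (\<F> v)"
  proof -
    have "hseq (3 / 2 + 1) (\<F> u)"
      by (rule hseq_mono[OF sobolev_hseq[OF u(1)]]) (use s in simp)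
    moreover have "\<F> v = (\<lambda>k. 2 * pi * \<i> * of_int k * \<F> u k)"
      by (simp add: fun_eq_iff du(2))
    ultimately show ?thesis
      using hseq_deriv by simp
  qed
  have h\<rho>: "hseq (3 / 2) (\<F> \<rho>)"
    by (rule hseq_mono[OF sobolev_hseq[OF \<rho>(1)]]) (use s in simp)
  obtain S where S: "((\<lambda>k. (2 * pi * real_of_int k)\<^sup>2 * cnj (\<F> v k) * \<F> (\<lambda>x. u x * w x) k) has_sum S) UNIV"
    "2 * Re S = integral {0..1} (\<lambda>x. v x * (w x)\<^sup>2)"
    using gradient_transport[OF u_wiener v_wiener hv] by blast
  obtain R where R: "((\<lambda>k. (2 * pi * real_of_int k)\<^sup>2 * cnj (\<F> \<rho> k) * \<F> (\<lambda>x. u x * \<eta> x) k) has_sum R) UNIV"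
    "2 * Re R = integral {0..1} (\<lambda>x. v x * (\<eta> x)\<^sup>2)"
    using gradient_transport[OF u_wiener \<rho>_wiener h\<rho>] by blast
  define q' where "q' x = \<kappa> * (\<rho> x * \<eta> x) - v x * w x" for x
  have q': "continuous_on A q'" for A
    unfolding q'_def[abs_def] by (intro continuous_intros cont)
  have "(q has_real_derivative q' x) (at x)" for x
    unfolding q_def[abs_def] q'_def
    by (auto intro!: derivative_eq_intros d\<rho>(1) dv(1) simp: algebra_simps)
  then have cq: "\<F> q' k = 2 * pi * \<i> * of_int k * \<F> q k" for k
    by (intro fourier_coeff_deriv q') (simp_all add: q_def periodic)
  have "((\<lambda>x. v x * \<rho> x) has_real_derivative (w x * \<rho> x + v x * \<eta> x)) (at x)" for x
    using DERIV_mult[OF dv(1)[of x] d\<rho>(1)[of x]] by (simp add: algebra_simps)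
  then have cv: "\<F> (\<lambda>x. w x * \<rho> x + v x * \<eta> x) k = 2 * pi * \<i> * of_int k * \<F> (\<lambda>x. v x * \<rho> x) k" for k
    by (intro fourier_coeff_deriv continuous_intros cont) (simp_all add: periodic)
  have Pq: "((\<lambda>k. cnj (\<F> w k) * \<F> q' k) has_sum complex_of_real (integral {0..1} (\<lambda>x. w x * q' x))) UNIV"
    by (intro parseval dv(3) q')
  have Pv: "((\<lambda>k. cnj (\<F> \<eta> k) * \<F> (\<lambda>x. w x * \<rho> x + v x * \<eta> x) k) has_sum
      complex_of_real (integral {0..1} (\<lambda>x. \<eta> x * (w x * \<rho> x + v x * \<eta> x)))) UNIV"
    by (intro parseval d\<rho>(3) continuous_intros cont)
  have "(\<lambda>k. ((2 * pi * real_of_int k) ^ 4) * cnj (\<F> u k) * \<F> u' k)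
     = (\<lambda>k. cnj (\<F> w k) * \<F> q' k
         - (2 * pi * real_of_int k)\<^sup>2 * cnj (\<F> v k) * \<F> (\<lambda>x. u x * w x) k)"
  proof
    fix k
    have "((2 * pi * real_of_int k) ^ 4) * cnj (\<F> u k) * \<F> u' k
        = (2 * pi * real_of_int k)\<^sup>2 * ((2 * pi * real_of_int k)\<^sup>2 * cnj (\<F> u k) * \<F> u' k)"
      by (simp add: power4_eq_xxxx power2_eq_square mult_ac)
    also have "\<dots> = (2 * pi * real_of_int k)\<^sup>2 * (cnj (\<F> v k) * \<F> q k)
         - (2 * pi * real_of_int k)\<^sup>2 * cnj (\<F> v k) * \<F> (\<lambda>x. u x * w x) k"
      unfolding coeff_pairing_u by (simp only: right_diff_distrib mult.assoc)
    also have "(2 * pi * real_of_int k)\<^sup>2 * (cnj (\<F> v k) * \<F> q k) = cnj (\<F> w k) * \<F> q' k"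
      by (simp add: dv(2) cq power2_eq_square mult_ac)
    finally show "((2 * pi * real_of_int k) ^ 4) * cnj (\<F> u k) * \<F> u' k
      = cnj (\<F> w k) * \<F> q' k
         - (2 * pi * real_of_int k)\<^sup>2 * cnj (\<F> v k) * \<F> (\<lambda>x. u x * w x) k" .
  qed
  then have 1: "(\<Sum>\<^sub>\<infinity>k. ((2 * pi * real_of_int k) ^ 4) * cnj (\<F> u k) * \<F> u' k)
     = complex_of_real (integral {0..1} (\<lambda>x. w x * q' x)) - S"
    using infsumI[OF has_sum_add[OF Pq has_sum_uminusI[OF S(1)]]] by simp
  have "(\<lambda>k. ((2 * pi * real_of_int k)\<^sup>2) * cnj (\<F> \<rho> k) * \<F> \<rho>' k)
     = (\<lambda>k. - (((2 * pi * real_of_int k)\<^sup>2 * cnj (\<F> \<rho> k) * \<F> (\<lambda>x. u x * \<eta> x) k)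
         + cnj (\<F> \<eta> k) * \<F> (\<lambda>x. w x * \<rho> x + v x * \<eta> x) k))"
    unfolding cv by (simp add: fun_eq_iff coeff_\<rho>' d\<rho>(2) power2_eq_square algebra_simps)
  then have 2: "(\<Sum>\<^sub>\<infinity>k. ((2 * pi * real_of_int k)\<^sup>2) * cnj (\<F> \<rho> k) * \<F> \<rho>' k)
     = - (R + complex_of_real (integral {0..1} (\<lambda>x. \<eta> x * (w x * \<rho> x + v x * \<eta> x))))"
    using infsumI[OF has_sum_uminusI[OF has_sum_add[OF R(1) Pv]]] by simp
  define I1 I2 I3 where "I1 = integral {0..1} (\<lambda>x. v x * (w x)\<^sup>2)"
    and "I2 = integral {0..1} (\<lambda>x. v x * (\<eta> x)\<^sup>2)" and "I3 = integral {0..1} (\<lambda>x. w x * \<rho> x * \<eta> x)"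
  have I: "((\<lambda>x. v x * (w x)\<^sup>2) has_integral I1) {0..1}" "((\<lambda>x. v x * (\<eta> x)\<^sup>2) has_integral I2) {0..1}"
    "((\<lambda>x. w x * \<rho> x * \<eta> x) has_integral I3) {0..1}"
    unfolding I1_def I2_def I3_def
    by (auto intro!: integrable_integral integrable_continuous_real continuous_intros cont)
  have "((\<lambda>x. \<kappa> * (w x * \<rho> x * \<eta> x) - v x * (w x)\<^sup>2) has_integral \<kappa> * I3 - I1) {0..1}"
    by (intro has_integral_diff has_integral_mult_right I)
  moreover have "(\<lambda>x. \<kappa> * (w x * \<rho> x * \<eta> x) - v x * (w x)\<^sup>2) = (\<lambda>x. w x * q' x)"
    by (simp add: fun_eq_iff q'_def power2_eq_square algebra_simps)
  ultimately have 3: "integral {0..1} (\<lambda>x. w x * q' x) = \<kappa> * I3 - I1"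
    by (simp add: integral_unique)
  have "((\<lambda>x. w x * \<rho> x * \<eta> x + v x * (\<eta> x)\<^sup>2) has_integral I3 + I2) {0..1}"
    by (intro has_integral_add I)
  moreover have "(\<lambda>x. w x * \<rho> x * \<eta> x + v x * (\<eta> x)\<^sup>2) = (\<lambda>x. \<eta> x * (w x * \<rho> x + v x * \<eta> x))"
    by (simp add: fun_eq_iff power2_eq_square algebra_simps)
  ultimately have 4: "integral {0..1} (\<lambda>x. \<eta> x * (w x * \<rho> x + v x * \<eta> x)) = I3 + I2"
    by (simp add: integral_unique)
  have "((\<lambda>x. v x * (w x)\<^sup>2 + \<kappa> * (v x * (\<eta> x)\<^sup>2)) has_integral I1 + \<kappa> * I2) {0..1}"
    by (intro has_integral_add has_integral_mult_right I)
  moreover have "(\<lambda>x. v x * (w x)\<^sup>2 + \<kappa> * (v x * (\<eta> x)\<^sup>2)) = (\<lambda>x. v x * ((w x)\<^sup>2 + \<kappa> * (\<eta> x)\<^sup>2))"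
    by (simp add: fun_eq_iff algebra_simps)
  ultimately have 5: "integral {0..1} (\<lambda>x. v x * ((w x)\<^sup>2 + \<kappa> * (\<eta> x)\<^sup>2)) = I1 + \<kappa> * I2"
    by (simp add: integral_unique)
  have SR: "Re S = I1 / 2" "Re R = I2 / 2"
    using S(2) R(2) by (simp_all add: I1_def I2_def)
  show ?thesis
    unfolding 1 2 3 4 5 by (simp add: SR algebra_simps)
qed

text \<open>
  Where \<open>v\<close> is bounded below by \<open>- M\<close>, the right-hand side of the identity is at most \<open>3 M\<close> times the
  integral of the squared gradients, which is the energy by Parseval's identity.
\<close>

lemma gradient_energy_decay:
  assumes M: "\<And>x. - M \<le> v x"
  shows "2 * Re (\<Sum>\<^sub>\<infinity>k. ((2 * pi * real_of_int k) ^ 4) * cnj (\<F> u k) * \<F> u' k)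
    + \<kappa> * (2 * Re (\<Sum>\<^sub>\<infinity>k. ((2 * pi * real_of_int k)\<^sup>2) * cnj (\<F> \<rho> k) * \<F> \<rho>' k))
   \<le> 3 * M * ((\<Sum>\<^sub>\<infinity>k. (2 * pi * real_of_int k) ^ 4 * (cmod (\<F> u k))\<^sup>2)
        + \<kappa> * (\<Sum>\<^sub>\<infinity>k. (2 * pi * real_of_int k)\<^sup>2 * (cmod (\<F> \<rho> k))\<^sup>2))"
proof -
  have sq: "(\<Sum>\<^sub>\<infinity>k. (cmod (\<F> f k))\<^sup>2) = integral {0..1} (\<lambda>x. (f x)\<^sup>2)" if "wiener f" for f
  proof -
    have "((\<lambda>k. Re (cnj (\<F> f k) * \<F> f k)) has_sum
        Re (complex_of_real (integral {0..1} (\<lambda>x. f x * f x)))) UNIV"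
      by (intro has_sum_Re parseval that wienerD(1)[OF that])
    moreover have "Re (cnj (\<F> f k) * \<F> f k) = (cmod (\<F> f k))\<^sup>2" for k
      unfolding cmod_power2 by (simp add: power2_eq_square)
    ultimately show ?thesis
      by (simp add: infsumI power2_eq_square)
  qed
  have "(2 * pi * real_of_int k) ^ 4 * (cmod (\<F> u k))\<^sup>2 = (cmod (\<F> w k))\<^sup>2" for k
    by (simp add: dv(2) du(2) norm_mult power_mult_distrib power4_eq_xxxx power2_eq_square mult_ac)
  then have W: "(\<Sum>\<^sub>\<infinity>k. (2 * pi * real_of_int k) ^ 4 * (cmod (\<F> u k))\<^sup>2) = integral {0..1} (\<lambda>x. (w x)\<^sup>2)"
    using sq[OF dv(3)] by simp
  have "(2 * pi * real_of_int k)\<^sup>2 * (cmod (\<F> \<rho> k))\<^sup>2 = (cmod (\<F> \<eta> k))\<^sup>2" for k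
    by (simp add: d\<rho>(2) norm_mult power_mult_distrib)
  then have H: "(\<Sum>\<^sub>\<infinity>k. (2 * pi * real_of_int k)\<^sup>2 * (cmod (\<F> \<rho> k))\<^sup>2) = integral {0..1} (\<lambda>x. (\<eta> x)\<^sup>2)"
    using sq[OF d\<rho>(3)] by simp
  have R: "((\<lambda>x. M * ((w x)\<^sup>2 + \<kappa> * (\<eta> x)\<^sup>2)) has_integral
      M * (integral {0..1} (\<lambda>x. (w x)\<^sup>2) + \<kappa> * integral {0..1} (\<lambda>x. (\<eta> x)\<^sup>2))) {0..1}"
    by (intro has_integral_mult_right has_integral_add integrable_integral integrable_continuous_real
        continuous_intros cont)
  have L: "((\<lambda>x. - (v x * ((w x)\<^sup>2 + \<kappa> * (\<eta> x)\<^sup>2))) has_integral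
      - integral {0..1} (\<lambda>x. v x * ((w x)\<^sup>2 + \<kappa> * (\<eta> x)\<^sup>2))) {0..1}"
    by (intro has_integral_neg integrable_integral integrable_continuous_real continuous_intros cont)
  have le: "- (v x * ((w x)\<^sup>2 + \<kappa> * (\<eta> x)\<^sup>2)) \<le> M * ((w x)\<^sup>2 + \<kappa> * (\<eta> x)\<^sup>2)" for x
    using mult_right_mono[OF M[of x], of "(w x)\<^sup>2 + \<kappa> * (\<eta> x)\<^sup>2"] \<kappa> by simp
  have "- integral {0..1} (\<lambda>x. v x * ((w x)\<^sup>2 + \<kappa> * (\<eta> x)\<^sup>2))
      \<le> M * (integral {0..1} (\<lambda>x. (w x)\<^sup>2) + \<kappa> * integral {0..1} (\<lambda>x. (\<eta> x)\<^sup>2))"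
    by (rule has_integral_le[OF L R le])
  then show ?thesis
    unfolding gradient_energy_identity W H by simp
qed

text \<open>The rate of growth of the truncated energies per unit of Wiener norm.\<close>

definition growth :: "real \<Rightarrow> real" where
  "growth r = (5 * (1 + 2 * r) + (10 + 4 * \<kappa>)) * 2 powr r"

text \<open>Apart from \<open>a\<close> there are five terms in the two equations: the two transport terms are
  commutators, and the other three are products. The energies are those of \<open>v\<close> and \<open>\<rho>\<close>; in terms of \<open>u\<close> the weight has the
  additional factor \<open>(2 \<pi> k)\<^sup>2\<close>.\<close>

lemma cutoff_energy_growth:
  assumes r: "1 \<le> r" and N: "1 \<le> N"
  shows "2 * Re (\<Sum>\<^sub>\<infinity>k. ((cutoff r N k)\<^sup>2 * (2 * pi * real_of_int k)\<^sup>2) * cnj (\<F> u k) * \<F> u' k)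
    + 2 * Re (\<Sum>\<^sub>\<infinity>k. ((cutoff r N k)\<^sup>2) * cnj (\<F> \<rho> k) * \<F> \<rho>' k)
   \<le> growth r * (wiener_norm v + wiener_norm \<rho>) * (cutoff_energy r N v + cutoff_energy r N \<rho>)"
proof -
  obtain S1 where S1: "((\<lambda>k. (cutoff r N k)\<^sup>2 * cnj (\<F> v k) * \<F> (\<lambda>x. u x * w x) k) has_sum S1) UNIV"
    "\<bar>2 * Re S1\<bar> \<le> (1 + 2 * r) * 2 powr r * (wiener_norm v + wiener_norm v) * (cutoff_energy r N v + cutoff_energy r N v)"
    using cutoff_transport[OF r N u_wiener v_wiener] by blast
  obtain S2 where S2: "((\<lambda>k. (cutoff r N k)\<^sup>2 * cnj (\<F> v k) * \<F> (\<lambda>x. v x * v x) k) has_sum S2) UNIV"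
    "\<bar>Re S2\<bar> \<le> 2 powr r * (wiener_norm v + wiener_norm v) * (cutoff_energy r N v + cutoff_energy r N v + cutoff_energy r N v)"
    using cutoff_product[OF r N v_wiener(1) v_wiener(1) v_wiener(1)] by blast
  obtain S3 where S3: "((\<lambda>k. (cutoff r N k)\<^sup>2 * cnj (\<F> v k) * \<F> (\<lambda>x. \<rho> x * \<rho> x) k) has_sum S3) UNIV"
    "\<bar>Re S3\<bar> \<le> 2 powr r * (wiener_norm \<rho> + wiener_norm \<rho>) * (cutoff_energy r N v + cutoff_energy r N \<rho> + cutoff_energy r N \<rho>)"
    using cutoff_product[OF r N \<rho>_wiener(1) \<rho>_wiener(1) v_wiener(1)] by blast
  obtain S4 where S4: "((\<lambda>k. (cutoff r N k)\<^sup>2 * cnj (\<F> \<rho> k) * \<F> (\<lambda>x. u x * \<eta> x) k) has_sum S4) UNIV"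
    "\<bar>2 * Re S4\<bar> \<le> (1 + 2 * r) * 2 powr r * (wiener_norm v + wiener_norm \<rho>) * (cutoff_energy r N v + cutoff_energy r N \<rho>)"
    using cutoff_transport[OF r N u_wiener \<rho>_wiener] by blast
  obtain S5 where S5: "((\<lambda>k. (cutoff r N k)\<^sup>2 * cnj (\<F> \<rho> k) * \<F> (\<lambda>x. v x * \<rho> x) k) has_sum S5) UNIV"
    "\<bar>Re S5\<bar> \<le> 2 powr r * (wiener_norm v + wiener_norm \<rho>) * (cutoff_energy r N \<rho> + cutoff_energy r N v + cutoff_energy r N \<rho>)"
    using cutoff_product[OF r N v_wiener(1) \<rho>_wiener(1) \<rho>_wiener(1)] by blast
  have q: "\<F> q k = \<kappa> / 2 * \<F> (\<lambda>x. \<rho> x * \<rho> x) k - 1 / 2 * \<F> (\<lambda>x. v x * v x) k" for k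
  proof -
    have "\<F> q k = \<F> (\<lambda>x. \<kappa> / 2 * (\<rho> x * \<rho> x)) k - \<F> (\<lambda>x. 1 / 2 * (v x * v x)) k"
      unfolding q_def[abs_def] by (intro fourier_coeff_diff set_integrable_continuous continuous_intros cont)
    then show ?thesis
      unfolding fourier_coeff_cmult by simp
  qed
  have "((cutoff r N k)\<^sup>2 * (2 * pi * real_of_int k)\<^sup>2) * cnj (\<F> u k) * \<F> u' k
     = (\<kappa> / 2 * ((cutoff r N k)\<^sup>2 * cnj (\<F> v k) * \<F> (\<lambda>x. \<rho> x * \<rho> x) k)
        + - (1 / 2 * ((cutoff r N k)\<^sup>2 * cnj (\<F> v k) * \<F> (\<lambda>x. v x * v x) k)))
        + - ((cutoff r N k)\<^sup>2 * cnj (\<F> v k) * \<F> (\<lambda>x. u x * w x) k)" for k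
  proof -
    have "((cutoff r N k)\<^sup>2 * (2 * pi * real_of_int k)\<^sup>2) * cnj (\<F> u k) * \<F> u' k
       = (cutoff r N k)\<^sup>2 * ((2 * pi * real_of_int k)\<^sup>2 * cnj (\<F> u k) * \<F> u' k)"
      by (simp add: mult_ac)
    then show ?thesis
      unfolding coeff_pairing_u q by (simp add: algebra_simps)
  qed
  moreover have "((\<lambda>k. (\<kappa> / 2 * ((cutoff r N k)\<^sup>2 * cnj (\<F> v k) * \<F> (\<lambda>x. \<rho> x * \<rho> x) k)
        + - (1 / 2 * ((cutoff r N k)\<^sup>2 * cnj (\<F> v k) * \<F> (\<lambda>x. v x * v x) k)))
        + - ((cutoff r N k)\<^sup>2 * cnj (\<F> v k) * \<F> (\<lambda>x. u x * w x) k)) has_sum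
        ((\<kappa> / 2 * S3 + - (1 / 2 * S2)) + - S1)) UNIV"
    by (intro has_sum_add has_sum_uminusI has_sum_cmult_right S1 S2 S3)
  ultimately have 1: "(\<Sum>\<^sub>\<infinity>k. ((cutoff r N k)\<^sup>2 * (2 * pi * real_of_int k)\<^sup>2) * cnj (\<F> u k) * \<F> u' k)
      = (\<kappa> / 2 * S3 + - (1 / 2 * S2)) + - S1"
    by (simp add: infsumI)
  have "((cutoff r N k)\<^sup>2) * cnj (\<F> \<rho> k) * \<F> \<rho>' k
     = - ((cutoff r N k)\<^sup>2 * cnj (\<F> \<rho> k) * \<F> (\<lambda>x. u x * \<eta> x) k)
       + - ((cutoff r N k)\<^sup>2 * cnj (\<F> \<rho> k) * \<F> (\<lambda>x. v x * \<rho> x) k)" for k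
    unfolding coeff_\<rho>' by (simp add: algebra_simps)
  moreover have "((\<lambda>k. - ((cutoff r N k)\<^sup>2 * cnj (\<F> \<rho> k) * \<F> (\<lambda>x. u x * \<eta> x) k)
       + - ((cutoff r N k)\<^sup>2 * cnj (\<F> \<rho> k) * \<F> (\<lambda>x. v x * \<rho> x) k)) has_sum (- S4 + - S5)) UNIV"
    by (intro has_sum_add has_sum_uminusI S4 S5)
  ultimately have 2: "(\<Sum>\<^sub>\<infinity>k. ((cutoff r N k)\<^sup>2) * cnj (\<F> \<rho> k) * \<F> \<rho>' k) = - S4 + - S5"
    by (simp add: infsumI)
  define A E where "A = wiener_norm v + wiener_norm \<rho>" and "E = cutoff_energy r N v + cutoff_energy r N \<rho>"
  have A: "wiener_norm v \<le> A" "wiener_norm \<rho> \<le> A" "0 \<le> wiener_norm v" "0 \<le> wiener_norm \<rho>"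
    using wiener_norm_nonneg[of v] wiener_norm_nonneg[of \<rho>] by (simp_all add: A_def)
  have E: "cutoff_energy r N v \<le> E" "cutoff_energy r N \<rho> \<le> E" "0 \<le> cutoff_energy r N v" "0 \<le> cutoff_energy r N \<rho>"
    using cutoff_energy_nonneg[of r N v] cutoff_energy_nonneg[of r N \<rho>] by (simp_all add: E_def)
  have up: "C * X * Y \<le> C * (c * A) * (d * E)" if "X \<le> c * A" "Y \<le> d * E" "0 \<le> C" "0 \<le> X" "0 \<le> Y" "0 \<le> c" for C X Y c d
    using that A by (intro mult_mono mult_left_mono) auto
  have K: "0 \<le> (1 + 2 * r) * 2 powr r" "0 \<le> 2 powr r"
    using r by auto
  have B1: "\<bar>2 * Re S1\<bar> \<le> (1 + 2 * r) * 2 powr r * (2 * A) * (2 * E)"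
    by (rule order_trans[OF S1(2)], rule up) (use A E K in linarith)+
  have B2: "\<bar>Re S2\<bar> \<le> 2 powr r * (2 * A) * (3 * E)"
    by (rule order_trans[OF S2(2)], rule up) (use A E K in linarith)+
  have B3: "\<bar>Re S3\<bar> \<le> 2 powr r * (2 * A) * (2 * E)"
    by (rule order_trans[OF S3(2)], rule up) (use A E K E_def in linarith)+
  have B4: "\<bar>2 * Re S4\<bar> \<le> (1 + 2 * r) * 2 powr r * (1 * A) * (1 * E)"
    by (rule order_trans[OF S4(2)], rule up) (use A E K E_def A_def in linarith)+
  have B5: "\<bar>Re S5\<bar> \<le> 2 powr r * (1 * A) * (2 * E)"
    by (rule order_trans[OF S5(2)], rule up) (use A E K E_def A_def in linarith)+
  have B3': "\<kappa> * Re S3 \<le> \<kappa> * (2 powr r * (2 * A) * (2 * E))"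
    using B3 \<kappa> by (intro mult_left_mono) auto
  have "2 * Re ((\<kappa> / 2 * S3 + - (1 / 2 * S2)) + - S1) + 2 * Re (- S4 + - S5)
     = \<kappa> * Re S3 - Re S2 - 2 * Re S1 - 2 * Re S4 - 2 * Re S5"
    by (simp add: algebra_simps)
  also have "\<dots> \<le> \<kappa> * (2 powr r * (2 * A) * (2 * E)) + 2 powr r * (2 * A) * (3 * E)
      + (1 + 2 * r) * 2 powr r * (2 * A) * (2 * E) + (1 + 2 * r) * 2 powr r * (1 * A) * (1 * E) + 2 * (2 powr r * (1 * A) * (2 * E))"
    using B1 B2 B3' B4 B5 by linarith
  also have "\<dots> = growth r * A * E"
    by (simp add: growth_def algebra_simps)
  finally show ?thesis
    unfolding 1 2 A_def E_def .
qed

end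

section \<open>Norms and energies\<close>

lemma infsum_delta:
  fixes f :: "int \<Rightarrow> 'a :: {semiring_1, topological_comm_monoid_add, t2_space}"
  shows "(\<Sum>\<^sub>\<infinity>k. (if k = 0 then 1 else 0) * f k) = f 0"
  by (rule infsumI, rule has_sum_finite_neutralI[of "{0}"]) auto

lemma of_real_delta: "complex_of_real (if P then 1 else 0) = (if P then 1 else 0)"
  by simp

lemma hnorm_sq: "(hnorm r c)\<^sup>2 = (\<Sum>\<^sub>\<infinity>k. bracket k powr r * (cmod (c k))\<^sup>2)"
  unfolding hnorm_def by (intro real_sqrt_pow2 infsum_nonneg) auto

lemma abs_bracket [simp]: "\<bar>bracket k\<bar> = bracket k"
  using bracket_pos[of k] by (simp add: abs_of_pos del: bracket_pos)

lemma bracket_le: "k \<noteq> 0 \<Longrightarrow> bracket k \<le> 2 * (2 * pi * of_int k)\<^sup>2"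
proof -
  assume "k \<noteq> 0"
  then have "1 \<le> \<bar>real_of_int k\<bar>" by linarith
  then have "1 * 1 \<le> (2 * pi) * \<bar>real_of_int k\<bar>"
    using pi_gt3 by (intro mult_mono) auto
  then have "1\<^sup>2 \<le> \<bar>2 * pi * real_of_int k\<bar>\<^sup>2"
    by (intro power_mono) (auto simp: abs_mult)
  then show ?thesis
    by (simp add: bracket_def)
qed

lemma cutoff_energy_le_hnorm:
  assumes f: "hseq r (\<F> f)" and r: "1 \<le> r" and N: "1 \<le> N"
  shows "cutoff_energy r N f \<le> 2 powr r * (hnorm r (\<F> f))\<^sup>2"
proof -
  have "(cutoff r N k)\<^sup>2 \<le> 2 powr r * bracket k powr r" for k
  proof -
    define m where "m = min (1 + real_of_int \<bar>k\<bar>) N"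
    have m: "0 < m" "m\<^sup>2 \<le> (1 + real_of_int \<bar>k\<bar>)\<^sup>2"
      using N by (auto simp: m_def intro!: power_mono)
    have "cutoff r N k = m powr r"
      by (simp add: cutoff_def m_def)
    then have "(cutoff r N k)\<^sup>2 = (m\<^sup>2) powr r"
      by (simp add: power2_eq_square powr_mult)
    also have "\<dots> \<le> (2 * bracket k) powr r"
      by (rule powr_mono2) (use r order_trans[OF m(2) bracket_ge] in auto)
    finally show ?thesis
      by (simp add: powr_mult)
  qed
  from hseq_weighted[OF f _ this] show ?thesis
    by (simp add: sum_bounded_by_def cutoff_energy_def power_mult_distrib)
qed

text \<open>A finite partial sum of the Sobolev norm is not affected by a truncation at a sufficiently
  large height; hence a bound on the truncated energies that is uniform in the height is a bound
  on the norm.\<close>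

lemma hnorm_le_cutoff_energy:
  assumes f: "wiener f" "hseq r (\<F> f)" and r: "1 \<le> r"
    and B: "\<And>N. 1 \<le> N \<Longrightarrow> cutoff_energy r N f \<le> B"
  shows "(hnorm r (\<F> f))\<^sup>2 \<le> ((2 * pi)\<^sup>2) powr r * B"
  unfolding hnorm_sq
proof (rule infsum_le_finite_sums)
  show "(\<lambda>k. bracket k powr r * (cmod (\<F> f k))\<^sup>2) summable_on UNIV"
    using f(2) by (simp add: hseq_def)
  fix F :: "int set" assume F: "finite F"
  define N where "N = 1 + (\<Sum>k\<in>F. real_of_int \<bar>k\<bar>)"
  have N: "1 \<le> N"
    by (simp add: N_def sum_nonneg)
  have "bracket k powr r * (cmod (\<F> f k))\<^sup>2
      \<le> ((2 * pi)\<^sup>2) powr r * (cutoff r N k * cmod (\<F> f k))\<^sup>2" if k: "k \<in> F" for k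
  proof -
    define m where "m = 1 + real_of_int \<bar>k\<bar>"
    have "real_of_int \<bar>k\<bar> \<le> (\<Sum>k\<in>F. real_of_int \<bar>k\<bar>)"
      by (rule member_le_sum[OF k]) (use F in auto)
    then have cut: "cutoff r N k = m powr r"
      by (simp add: cutoff_def N_def m_def)
    have "1 * 1 \<le> (2 * pi) * (2 * pi)"
      using pi_gt3 by (intro mult_mono) auto
    moreover have "real_of_int \<bar>k\<bar> * real_of_int \<bar>k\<bar> + 1 \<le> m * m"
      by (simp add: m_def algebra_simps)
    then have "(2 * pi)\<^sup>2 * (real_of_int \<bar>k\<bar> * real_of_int \<bar>k\<bar> + 1) \<le> (2 * pi)\<^sup>2 * (m * m)"
      by (intro mult_left_mono) auto
    ultimately have "bracket k \<le> (2 * pi)\<^sup>2 * (m * m)"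
      by (simp add: bracket_def power2_eq_square algebra_simps)
    then have "bracket k powr r \<le> ((2 * pi)\<^sup>2 * (m * m)) powr r"
      using r by (intro powr_mono2) (auto simp: less_imp_le)
    also have "\<dots> = ((2 * pi)\<^sup>2) powr r * (cutoff r N k)\<^sup>2"
      by (simp add: cut powr_mult power2_eq_square)
    finally have "bracket k powr r * (cmod (\<F> f k))\<^sup>2 \<le> ((2 * pi)\<^sup>2) powr r * (cutoff r N k)\<^sup>2 * (cmod (\<F> f k))\<^sup>2"
      by (intro mult_right_mono) auto
    then show ?thesis
      by (simp add: power_mult_distrib mult_ac)
  qed
  then have "(\<Sum>k\<in>F. bracket k powr r * (cmod (\<F> f k))\<^sup>2)
     \<le> ((2 * pi)\<^sup>2) powr r * (\<Sum>k\<in>F. (cutoff r N k * cmod (\<F> f k))\<^sup>2)"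
    unfolding sum_distrib_left by (rule sum_mono)
  also have "\<dots> \<le> ((2 * pi)\<^sup>2) powr r * cutoff_energy r N f"
    unfolding cutoff_energy_def
    by (intro mult_left_mono finite_sum_le_infsum summable_cutoff[OF r N f(1)] F) auto
  also have "\<dots> \<le> ((2 * pi)\<^sup>2) powr r * B"
    by (intro mult_left_mono B N) auto
  finally show "(\<Sum>k\<in>F. bracket k powr r * (cmod (\<F> f k))\<^sup>2) \<le> ((2 * pi)\<^sup>2) powr r * B" .
qed

definition bracket_sum :: "real \<Rightarrow> real" where
  "bracket_sum q = (\<Sum>\<^sub>\<infinity>k. bracket k powr q)"

lemma weight_le: "(2 * pi * real_of_int k)\<^sup>2 \<le> bracket k powr 1" "(2 * pi * real_of_int k) ^ 4 \<le> bracket k powr 2"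
proof -
  show *: "(2 * pi * real_of_int k)\<^sup>2 \<le> bracket k powr 1"
    by (simp add: bracket_def)
  have "((2 * pi * real_of_int k)\<^sup>2)\<^sup>2 \<le> (bracket k)\<^sup>2"
    by (intro power_mono) (auto simp: bracket_def)
  then show "(2 * pi * real_of_int k) ^ 4 \<le> bracket k powr 2"
    using powr_add[of "bracket k" 1 1] by (simp add: power2_eq_square mult.assoc power4_eq_xxxx)
qed

context hs_slice
begin

lemma hseq_u: "hseq s (\<F> u)" and hseq_\<rho>: "hseq (s - 1) (\<F> \<rho>)"
  using sobolev_hseq u(1) \<rho>(1) by auto

lemma hseq_v: "hseq (s - 1) (\<F> v)"
proof -
  have "\<F> v = (\<lambda>k. 2 * pi * \<i> * of_int k * \<F> u k)"
    by (simp add: fun_eq_iff du(2))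
  then show ?thesis
    using hseq_deriv[of "s - 1" "\<F> u"] hseq_u by simp
qed

lemma wiener_norm_v_le: "wiener_norm v \<le> ((hnorm s (\<F> u))\<^sup>2 + bracket_sum (1 - s)) / 2"
proof -
  have "2 * (1 / 2) - s < - 1 / 2"
    using s by simp
  from hseq_weighted_l1[OF hseq_u this]
  have "sum_bounded_by (\<lambda>k. bracket k powr (1 / 2) * cmod (\<F> u k))
      (((hnorm s (\<F> u))\<^sup>2 + bracket_sum (1 - s)) / 2)"
    by (simp add: bracket_sum_def)
  then have "sum_bounded_by (\<lambda>k. cmod (\<F> v k)) (((hnorm s (\<F> u))\<^sup>2 + bracket_sum (1 - s)) / 2)"
  proof (rule sum_bounded_by_mono)
    fix k
    have "cmod (\<F> v k) = \<bar>2 * pi * real_of_int k\<bar> * cmod (\<F> u k)"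
      by (simp add: du(2) norm_mult abs_mult)
    also have "\<dots> \<le> bracket k powr (1 / 2) * cmod (\<F> u k)"
      by (intro mult_right_mono abs_le_bracket_powr) auto
    finally show "cmod (\<F> v k) \<le> bracket k powr (1 / 2) * cmod (\<F> u k)" .
  qed auto
  then show ?thesis
    by (simp add: wiener_norm_def sum_bounded_by_def)
qed

lemma abs_v_le: "\<bar>v x\<bar> \<le> ((hnorm s (\<F> u))\<^sup>2 + bracket_sum (1 - s)) / 2"
  using wiener_abs_le[OF v_wiener(1), of x] wiener_norm_v_le by (simp add: wiener_norm_def)

text \<open>One derivative in \<open>L\<^sup>2\<close> controls the Wiener norm up to the mean, and \<open>v\<close> has mean zero.\<close>

lemma wiener_norm_le_energy:
  shows "wiener_norm v \<le> (\<Sum>\<^sub>\<infinity>k. (2 * pi * real_of_int k) ^ 4 * (cmod (\<F> u k))\<^sup>2) + bracket_sum (- 1) / 2"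
    and "wiener_norm \<rho> \<le> (cmod (\<F> \<rho> 0))\<^sup>2 / 2
        + (\<Sum>\<^sub>\<infinity>k. (2 * pi * real_of_int k)\<^sup>2 * (cmod (\<F> \<rho> k))\<^sup>2) + bracket_sum (- 1) / 2"
proof -
  have l1: "wiener_norm f \<le> ((hnorm 1 (\<F> f))\<^sup>2 + bracket_sum (- 1)) / 2" if "hseq 1 (\<F> f)" for f
    using hseq_weighted_l1[OF that, of 0] by (simp add: sum_bounded_by_def wiener_norm_def bracket_sum_def)
  have h: "hseq 1 (\<F> v)" "hseq 1 (\<F> \<rho>)"
    using hseq_mono[OF hseq_v, of 1] hseq_mono[OF hseq_\<rho>, of 1] s by auto
  have V: "(2 * pi * real_of_int k) ^ 4 * (cmod (\<F> u k))\<^sup>2 = (2 * pi * real_of_int k)\<^sup>2 * (cmod (\<F> v k))\<^sup>2" for k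
    by (simp add: du(2) norm_mult power_mult_distrib power4_eq_xxxx power2_eq_square mult_ac)
  have le: "sum_bounded_by (\<lambda>k. (2 * pi * real_of_int k)\<^sup>2 * (cmod (c k))\<^sup>2) (1 * (hnorm 1 c)\<^sup>2)" if "hseq 1 c" for c
    by (rule hseq_weighted[OF that]) (use weight_le(1) in auto)
  have "(hnorm 1 (\<F> v))\<^sup>2 \<le> (\<Sum>\<^sub>\<infinity>k. 2 * ((2 * pi * real_of_int k)\<^sup>2 * (cmod (\<F> v k))\<^sup>2))"
    unfolding hnorm_sq
  proof (rule infsum_mono)
    show "bracket k powr 1 * (cmod (\<F> v k))\<^sup>2 \<le> 2 * ((2 * pi * real_of_int k)\<^sup>2 * (cmod (\<F> v k))\<^sup>2)" for k
      using mult_right_mono[OF bracket_le[of k], of "(cmod (\<F> v k))\<^sup>2"]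
      by (cases "k = 0") (simp_all add: du(2)[of 0] mult.assoc)
  qed (use h(1) le[OF h(1)] in \<open>auto simp: hseq_def sum_bounded_by_def intro: summable_on_cmult_right\<close>)
  then show "wiener_norm v \<le> (\<Sum>\<^sub>\<infinity>k. (2 * pi * real_of_int k) ^ 4 * (cmod (\<F> u k))\<^sup>2) + bracket_sum (- 1) / 2"
    unfolding V using l1[OF h(1)] by (simp add: infsum_cmult_right')
  have d: "(\<lambda>k. (if k = 0 then 1 else 0) * (cmod (\<F> \<rho> k))\<^sup>2) summable_on (UNIV :: int set)"
    by (rule finite_nonzero_values_imp_summable_on) (rule finite_subset[of _ "{0}"], auto)
  have e: "(\<lambda>k. 2 * ((2 * pi * real_of_int k)\<^sup>2 * (cmod (\<F> \<rho> k))\<^sup>2)) summable_on UNIV"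
    using le[OF h(2)] by (auto simp: sum_bounded_by_def intro: summable_on_cmult_right)
  have "(hnorm 1 (\<F> \<rho>))\<^sup>2 \<le> (\<Sum>\<^sub>\<infinity>k. (if k = 0 then 1 else 0) * (cmod (\<F> \<rho> k))\<^sup>2
      + 2 * ((2 * pi * real_of_int k)\<^sup>2 * (cmod (\<F> \<rho> k))\<^sup>2))"
    unfolding hnorm_sq
  proof (rule infsum_mono)
    show "bracket k powr 1 * (cmod (\<F> \<rho> k))\<^sup>2 \<le> (if k = 0 then 1 else 0) * (cmod (\<F> \<rho> k))\<^sup>2
      + 2 * ((2 * pi * real_of_int k)\<^sup>2 * (cmod (\<F> \<rho> k))\<^sup>2)" for k
      using mult_right_mono[OF bracket_le[of k], of "(cmod (\<F> \<rho> k))\<^sup>2"]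
      by (cases "k = 0") (simp_all add: bracket_def[of 0] mult.assoc)
  qed (use h(2) d e in \<open>auto simp: hseq_def intro!: summable_on_add\<close>)
  also have "\<dots> = (cmod (\<F> \<rho> 0))\<^sup>2 + 2 * (\<Sum>\<^sub>\<infinity>k. (2 * pi * real_of_int k)\<^sup>2 * (cmod (\<F> \<rho> k))\<^sup>2)"
    by (simp only: infsum_add[OF d e] infsum_delta infsum_cmult_right')
  finally show "wiener_norm \<rho> \<le> (cmod (\<F> \<rho> 0))\<^sup>2 / 2
        + (\<Sum>\<^sub>\<infinity>k. (2 * pi * real_of_int k)\<^sup>2 * (cmod (\<F> \<rho> k))\<^sup>2) + bracket_sum (- 1) / 2"
    using l1[OF h(2)] by (simp add: field_simps)
qed

lemma hnorm_u_le: "(hnorm s (\<F> u))\<^sup>2 \<le> (cmod (\<F> u 0))\<^sup>2 + 2 * (hnorm (s - 1) (\<F> v))\<^sup>2"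
proof -
  have d: "(\<lambda>k. (if k = 0 then 1 else 0) * (cmod (\<F> u k))\<^sup>2) summable_on (UNIV :: int set)"
    by (rule finite_nonzero_values_imp_summable_on) (rule finite_subset[of _ "{0}"], auto)
  have e: "(\<lambda>k. 2 * (bracket k powr (s - 1) * (cmod (\<F> v k))\<^sup>2)) summable_on UNIV"
    using hseq_v by (auto simp: hseq_def intro: summable_on_cmult_right)
  have "(hnorm s (\<F> u))\<^sup>2 \<le> (\<Sum>\<^sub>\<infinity>k. (if k = 0 then 1 else 0) * (cmod (\<F> u k))\<^sup>2
      + 2 * (bracket k powr (s - 1) * (cmod (\<F> v k))\<^sup>2))"
    unfolding hnorm_sq
  proof (rule infsum_mono)
    show "bracket k powr s * (cmod (\<F> u k))\<^sup>2 \<le> (if k = 0 then 1 else 0) * (cmod (\<F> u k))\<^sup>2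
      + 2 * (bracket k powr (s - 1) * (cmod (\<F> v k))\<^sup>2)" for k
    proof (cases "k = 0")
      case False
      have "bracket k powr s * (cmod (\<F> u k))\<^sup>2 = bracket k powr (s - 1) * bracket k * (cmod (\<F> u k))\<^sup>2"
        using powr_add[of "bracket k" "s - 1" 1] by simp
      also have "\<dots> \<le> bracket k powr (s - 1) * (2 * (2 * pi * of_int k)\<^sup>2) * (cmod (\<F> u k))\<^sup>2"
        using bracket_le[OF False] by (intro mult_right_mono mult_left_mono) auto
      also have "\<dots> = 2 * (bracket k powr (s - 1) * (cmod (\<F> v k))\<^sup>2)"
        by (simp add: du(2) norm_mult power_mult_distrib)
      finally show ?thesis
        using False by simp
    qed (simp add: bracket_def)
  qed (use hseq_u d e in \<open>auto simp: hseq_def intro!: summable_on_add\<close>)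
  also have "\<dots> = (cmod (\<F> u 0))\<^sup>2 + 2 * (hnorm (s - 1) (\<F> v))\<^sup>2"
    by (simp only: infsum_add[OF d e] infsum_delta infsum_cmult_right' hnorm_sq)
  finally show ?thesis .
qed

end

section \<open>A priori bounds along the solution\<close>

locale hs_flow =
  fixes s \<kappa> :: real and h :: "real \<Rightarrow> real" and T :: ereal and u \<rho> u' \<rho>' :: "real \<Rightarrow> real \<Rightarrow> real"
  assumes s: "5 / 2 < s" and \<kappa>: "0 < \<kappa>"
    and u: "C0_sobolev s (time_interval T) u" "C1_sobolev (s - 1) (time_interval T) u u'"
    and \<rho>: "C0_sobolev (s - 1) (time_interval T) \<rho>" "C1_sobolev (s - 2) (time_interval T) \<rho> \<rho>'"
    and slice: "\<And>t. t \<in> time_interval T \<Longrightarrow> hs_slice s \<kappa> (h t) (u t) (\<rho> t) (u' t) (\<rho>' t)"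
begin

lemma subinterval: "a \<in> time_interval T \<Longrightarrow> b \<in> time_interval T \<Longrightarrow> t \<in> {a..b} \<Longrightarrow> t \<in> time_interval T"
  by (auto simp: time_interval_def intro: order.strict_trans1[of "ereal t" "ereal b"])

lemma energy_u:
  assumes "t \<in> time_interval T" "\<And>k. 0 \<le> w k" "\<And>k. w k \<le> C * bracket k powr (s - 1 / 2)"
  shows "((\<lambda>\<tau>. \<Sum>\<^sub>\<infinity>k. w k * (cmod (\<F> (u \<tau>) k))\<^sup>2) has_real_derivative
      2 * Re (\<Sum>\<^sub>\<infinity>k. w k * cnj (\<F> (u t) k) * \<F> (u' t) k)) (at t within time_interval T)"
  by (rule weighted_energy_has_derivative[where r="s - 1"]) (use assms u in \<open>auto simp: algebra_simps\<close>)

lemma energy_\<rho>: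
  assumes "t \<in> time_interval T" "\<And>k. 0 \<le> w k" "\<And>k. w k \<le> C * bracket k powr (s - 3 / 2)"
  shows "((\<lambda>\<tau>. \<Sum>\<^sub>\<infinity>k. w k * (cmod (\<F> (\<rho> \<tau>) k))\<^sup>2) has_real_derivative
      2 * Re (\<Sum>\<^sub>\<infinity>k. w k * cnj (\<F> (\<rho> t) k) * \<F> (\<rho>' t) k)) (at t within time_interval T)"
  by (rule weighted_energy_has_derivative[where r="s - 2"]) (use assms \<rho> in \<open>auto simp: algebra_simps\<close>)

lemma gronwall_flow:
  assumes "a \<in> time_interval T" "b \<in> time_interval T" "a \<le> b"
    and "\<And>t. t \<in> time_interval T \<Longrightarrow> (E has_real_derivative E' t) (at t within time_interval T)"
    and "\<And>t. t \<in> {a..b} \<Longrightarrow> E' t \<le> C * E t"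
  shows "E b \<le> E a * exp (C * (b - a))"
proof (rule gronwall[OF assms(3)])
  show "(E has_real_derivative E' t) (at t within {a..b})" if "t \<in> {a..b}" for t
    by (rule has_field_derivative_subset[OF assms(4)]) (use subinterval[OF assms(1,2)] that in auto)
qed (use assms in auto)

definition gradient_energy :: "real \<Rightarrow> real" where
  "gradient_energy t = (\<Sum>\<^sub>\<infinity>k. (2 * pi * real_of_int k) ^ 4 * (cmod (\<F> (u t) k))\<^sup>2)
      + \<kappa> * (\<Sum>\<^sub>\<infinity>k. (2 * pi * real_of_int k)\<^sup>2 * (cmod (\<F> (\<rho> t) k))\<^sup>2)"

lemma gradient_energy_le:
  assumes "a \<in> time_interval T" "b \<in> time_interval T" "a \<le> b"
    and M: "\<And>t x. t \<in> {a..b} \<Longrightarrow> - M \<le> deriv (u t) x"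
  shows "gradient_energy b \<le> gradient_energy a * exp (3 * M * (b - a))"
proof (rule gronwall_flow[OF assms(1-3)])
  fix t
  show "t \<in> time_interval T \<Longrightarrow> (gradient_energy has_real_derivative
      (2 * Re (\<Sum>\<^sub>\<infinity>k. ((2 * pi * real_of_int k) ^ 4) * cnj (\<F> (u t) k) * \<F> (u' t) k)
    + \<kappa> * (2 * Re (\<Sum>\<^sub>\<infinity>k. ((2 * pi * real_of_int k)\<^sup>2) * cnj (\<F> (\<rho> t) k) * \<F> (\<rho>' t) k))))
      (at t within time_interval T)"
    unfolding gradient_energy_def
    by (intro DERIV_add DERIV_cmult energy_u[where C=1] energy_\<rho>[where C=1])
       (use s in \<open>auto intro!: order_trans[OF weight_le(1)] order_trans[OF weight_le(2)] bracket_powr_mono\<close>)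
  show "t \<in> {a..b} \<Longrightarrow> (2 * Re (\<Sum>\<^sub>\<infinity>k. ((2 * pi * real_of_int k) ^ 4) * cnj (\<F> (u t) k) * \<F> (u' t) k)
    + \<kappa> * (2 * Re (\<Sum>\<^sub>\<infinity>k. ((2 * pi * real_of_int k)\<^sup>2) * cnj (\<F> (\<rho> t) k) * \<F> (\<rho>' t) k)))
     \<le> 3 * M * gradient_energy t"
    unfolding gradient_energy_def
    by (rule hs_slice.gradient_energy_decay[OF slice[OF subinterval[OF assms(1,2)]] M])
qed

lemma mean_\<rho>_le:
  assumes "a \<in> time_interval T" "b \<in> time_interval T" "a \<le> b"
  shows "(cmod (\<F> (\<rho> b) 0))\<^sup>2 \<le> (cmod (\<F> (\<rho> a) 0))\<^sup>2"
proof -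
  define E where "E t = (\<Sum>\<^sub>\<infinity>k. (if k = 0 then 1 else 0) * (cmod (\<F> (\<rho> t) k))\<^sup>2)" for t
  have E: "E t = (cmod (\<F> (\<rho> t) 0))\<^sup>2" for t
    unfolding E_def by (rule infsum_delta)
  have "E b \<le> E a * exp (0 * (b - a))"
  proof (rule gronwall_flow[OF assms])
    fix t
    show "t \<in> time_interval T \<Longrightarrow> (E has_real_derivative
       2 * Re (\<Sum>\<^sub>\<infinity>k. (if k = 0 then 1 else 0 :: real) * cnj (\<F> (\<rho> t) k) * \<F> (\<rho>' t) k)) (at t within time_interval T)"
      unfolding E_def[abs_def] by (rule energy_\<rho>[where C=1]) (use s in \<open>auto simp: bracket_def\<close>)
    show "2 * Re (\<Sum>\<^sub>\<infinity>k. (if k = 0 then 1 else 0 :: real) * cnj (\<F> (\<rho> t) k) * \<F> (\<rho>' t) k) \<le> 0 * E t"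
      if "t \<in> {a..b}"
      using hs_slice.mean_\<rho>'[OF slice[OF subinterval[OF assms(1,2) that]]]
        infsum_delta[of "\<lambda>k. cnj (\<F> (\<rho> t) k) * \<F> (\<rho>' t) k"]
      by (simp add: mult.assoc of_real_delta)
  qed
  then show ?thesis
    by (simp add: E)
qed

text \<open>With \<open>m\<close> the mean of \<open>u\<close>, \<open>d/dt \<bar>m\<bar>\<^sup>2 \<le> \<bar>m\<bar>\<^sup>2 + D\<^sup>2\<close>; adding the constant \<open>D\<^sup>2\<close> to the energy makes this
  inequality homogeneous.\<close>

lemma mean_u_le:
  assumes "a \<in> time_interval T" "b \<in> time_interval T" "a \<le> b"
    and D: "\<And>t. t \<in> {a..b} \<Longrightarrow> cmod (\<F> (u' t) 0) \<le> D"
  shows "(cmod (\<F> (u b) 0))\<^sup>2 + D\<^sup>2 \<le> ((cmod (\<F> (u a) 0))\<^sup>2 + D\<^sup>2) * exp (1 * (b - a))"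
proof -
  define E where "E t = (\<Sum>\<^sub>\<infinity>k. (if k = 0 then 1 else 0) * (cmod (\<F> (u t) k))\<^sup>2) + D\<^sup>2" for t
  have E: "E t = (cmod (\<F> (u t) 0))\<^sup>2 + D\<^sup>2" for t
    unfolding E_def infsum_delta ..
  have "E b \<le> E a * exp (1 * (b - a))"
  proof (rule gronwall_flow[OF assms(1-3)])
    fix t
    show "t \<in> time_interval T \<Longrightarrow> (E has_real_derivative
       2 * Re (\<Sum>\<^sub>\<infinity>k. (if k = 0 then 1 else 0 :: real) * cnj (\<F> (u t) k) * \<F> (u' t) k) + 0) (at t within time_interval T)"
      unfolding E_def[abs_def] by (intro DERIV_add DERIV_const energy_u[where C=1]) (use s in \<open>auto simp: bracket_def\<close>)
    show "2 * Re (\<Sum>\<^sub>\<infinity>k. (if k = 0 then 1 else 0 :: real) * cnj (\<F> (u t) k) * \<F> (u' t) k) + 0 \<le> 1 * E t"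
      if t: "t \<in> {a..b}"
    proof -
      define x y where "x = \<F> (u t) 0" and "y = \<F> (u' t) 0"
      have "(\<Sum>\<^sub>\<infinity>k. (if k = 0 then 1 else 0 :: real) * cnj (\<F> (u t) k) * \<F> (u' t) k) = cnj x * y"
        using infsum_delta[of "\<lambda>k. cnj (\<F> (u t) k) * \<F> (u' t) k"]
        by (simp add: mult.assoc of_real_delta x_def y_def)
      moreover have "Re (cnj x * y) \<le> cmod x * cmod y"
        using complex_Re_le_cmod[of "cnj x * y"] by (simp add: norm_mult)
      moreover have "2 * cmod x * cmod y \<le> (cmod x)\<^sup>2 + (cmod y)\<^sup>2"
        by (rule sum_squares_bound)
      moreover have "(cmod y)\<^sup>2 \<le> D\<^sup>2"
        unfolding y_def by (intro power_mono D t) auto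
      ultimately show ?thesis
        by (simp add: E x_def)
    qed
  qed
  then show ?thesis
    by (simp add: E)
qed

text \<open>The exponent is independent of \<open>N\<close>, so the estimate survives the limit \<open>N \<rightarrow> \<infinity>\<close>.\<close>

lemma cutoff_energy_le:
  assumes "a \<in> time_interval T" "b \<in> time_interval T" "a \<le> b" and N: "1 \<le> N"
    and B: "\<And>t. t \<in> {a..b} \<Longrightarrow> wiener_norm (deriv (u t)) + wiener_norm (\<rho> t) \<le> B"
  shows "cutoff_energy (s - 1) N (deriv (u b)) + cutoff_energy (s - 1) N (\<rho> b)
    \<le> (cutoff_energy (s - 1) N (deriv (u a)) + cutoff_energy (s - 1) N (\<rho> a))
       * exp (hs_slice.growth \<kappa> (s - 1) * B * (b - a))"
proof -
  define c where "c = cutoff (s - 1) N"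
  have r: "1 \<le> s - 1" using s by simp
  have c: "(c k)\<^sup>2 \<le> (N powr (s - 1))\<^sup>2" for k
    using cutoff_le[OF r N, of k] cutoff_pos[OF r N, of k] unfolding c_def by (intro power_mono) auto
  define E where "E t = (\<Sum>\<^sub>\<infinity>k. ((c k)\<^sup>2 * (2 * pi * real_of_int k)\<^sup>2) * (cmod (\<F> (u t) k))\<^sup>2)
      + (\<Sum>\<^sub>\<infinity>k. (c k)\<^sup>2 * (cmod (\<F> (\<rho> t) k))\<^sup>2)" for t
  have E: "E t = cutoff_energy (s - 1) N (deriv (u t)) + cutoff_energy (s - 1) N (\<rho> t)" if "t \<in> time_interval T" for t
  proof -
    have "((c k)\<^sup>2 * (2 * pi * real_of_int k)\<^sup>2) * (cmod (\<F> (u t) k))\<^sup>2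
        = (c k * cmod (\<F> (deriv (u t)) k))\<^sup>2" for k
      by (simp add: hs_slice.du(2)[OF slice[OF that]] norm_mult power_mult_distrib)
    then show ?thesis
      by (simp only: E_def cutoff_energy_def) (simp add: c_def power_mult_distrib)
  qed
  have "E b \<le> E a * exp (hs_slice.growth \<kappa> (s - 1) * B * (b - a))"
  proof (rule gronwall_flow[OF assms(1-3)])
    fix t
    have "(c k)\<^sup>2 * (2 * pi * real_of_int k)\<^sup>2 \<le> (N powr (s - 1))\<^sup>2 * bracket k powr (s - 1 / 2)" for k
      by (intro mult_mono c order_trans[OF weight_le(1)] bracket_powr_mono) (use s in auto)
    moreover have "(c k)\<^sup>2 \<le> (N powr (s - 1))\<^sup>2 * bracket k powr (s - 3 / 2)" for k
    proof -
      have "(c k)\<^sup>2 * 1 \<le> (N powr (s - 1))\<^sup>2 * bracket k powr (s - 3 / 2)"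
        by (intro mult_mono c ge_one_powr_ge_zero bracket_ge_1) (use s in auto)
      then show ?thesis by simp
    qed
    ultimately show "t \<in> time_interval T \<Longrightarrow> (E has_real_derivative
       (2 * Re (\<Sum>\<^sub>\<infinity>k. ((c k)\<^sup>2 * (2 * pi * real_of_int k)\<^sup>2) * cnj (\<F> (u t) k) * \<F> (u' t) k)
      + 2 * Re (\<Sum>\<^sub>\<infinity>k. ((c k)\<^sup>2) * cnj (\<F> (\<rho> t) k) * \<F> (\<rho>' t) k))) (at t within time_interval T)"
      unfolding E_def[abs_def]
      by (intro DERIV_add energy_u[where C="(N powr (s - 1))\<^sup>2"] energy_\<rho>[where C="(N powr (s - 1))\<^sup>2"]) auto
    show "2 * Re (\<Sum>\<^sub>\<infinity>k. ((c k)\<^sup>2 * (2 * pi * real_of_int k)\<^sup>2) * cnj (\<F> (u t) k) * \<F> (u' t) k)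
      + 2 * Re (\<Sum>\<^sub>\<infinity>k. ((c k)\<^sup>2) * cnj (\<F> (\<rho> t) k) * \<F> (\<rho>' t) k)
      \<le> hs_slice.growth \<kappa> (s - 1) * B * E t" if t: "t \<in> {a..b}"
    proof -
      have tI: "t \<in> time_interval T"
        by (rule subinterval[OF assms(1,2) t])
      have g: "0 \<le> hs_slice.growth \<kappa> (s - 1)"
        using s \<kappa> by (simp add: hs_slice.growth_def[OF slice[OF tI]])
      have "hs_slice.growth \<kappa> (s - 1) * (wiener_norm (deriv (u t)) + wiener_norm (\<rho> t)) * E t
          \<le> hs_slice.growth \<kappa> (s - 1) * B * E t"
        unfolding E[OF tI] using cutoff_energy_nonneg g
        by (intro mult_right_mono mult_left_mono B t add_nonneg_nonneg) auto
      then show ?thesis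
        using hs_slice.cutoff_energy_growth[OF slice[OF tI] r N] unfolding E[OF tI] c_def by linarith
    qed
  qed
  then show ?thesis
    using E assms(1,2) by simp
qed

text \<open>
  The chain of bounds: gradient energy \<open>E1\<close>, Wiener norms \<open>B1\<close> and \<open>B2\<close>, mean \<open>mu\<close> of \<open>u\<close>, truncated energies
  \<open>E2\<close> uniformly in the height, and finally the norm.
\<close>

theorem bounded_if_gradient_bounded_below:
  assumes T: "T = ereal T0" and h: "continuous_on {0..} h" and a: "0 \<le> a" "a < T0"
    and M: "0 \<le> M" "\<And>t x. t \<in> {a..<T0} \<Longrightarrow> - M \<le> deriv (u t) x"
  obtains P where "\<And>t. t \<in> {a..<T0} \<Longrightarrow> pair_norm s (u t) (\<rho> t) \<le> P"
proof -
  have I: "t \<in> time_interval T" if "t \<in> {a..<T0}" for t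
    using that a by (auto simp: time_interval_def T)
  have aI: "a \<in> time_interval T"
    using I a by simp
  have r: "1 \<le> s - 1" using s by simp
  define E1 where "E1 = gradient_energy a * exp (3 * M * (T0 - a))"
  define mr where "mr = (cmod (\<F> (\<rho> a) 0))\<^sup>2"
  define B1 where "B1 = E1 + bracket_sum (- 1) / 2"
  define B2 where "B2 = mr / 2 + E1 / \<kappa> + bracket_sum (- 1) / 2"
  obtain H where H: "\<And>t. t \<in> {0..T0} \<Longrightarrow> \<bar>h t\<bar> \<le> H"
  proof -
    have "compact (h ` {0..T0})"
      by (intro compact_continuous_image compact_Icc continuous_on_subset[OF h]) auto
    from compact_imp_bounded[OF this] obtain H where "\<forall>y\<in>h ` {0..T0}. norm y \<le> H"
      unfolding bounded_iff by blast
    then show thesis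
      by (intro that[of H]) auto
  qed
  define D where "D = \<kappa> * B2\<^sup>2 + B1\<^sup>2 + H"
  define mu where "mu = ((cmod (\<F> (u a) 0))\<^sup>2 + D\<^sup>2) * exp (T0 - a)"
  define G where "G = hs_slice.growth \<kappa> (s - 1) * (B1 + B2)"
  define E0 where "E0 = 2 powr (s - 1) * (hnorm (s - 1) (\<F> (deriv (u a))))\<^sup>2
      + 2 powr (s - 1) * (hnorm (s - 1) (\<F> (\<rho> a)))\<^sup>2"
  define E2 where "E2 = E0 * exp (\<bar>G\<bar> * (T0 - a))"
  have ge0: "0 \<le> gradient_energy t" for t
    unfolding gradient_energy_def using \<kappa> by (intro add_nonneg_nonneg mult_nonneg_nonneg infsum_nonneg) auto
  have E1: "gradient_energy t \<le> E1" if t: "t \<in> {a..<T0}" for t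
  proof -
    have "gradient_energy t \<le> gradient_energy a * exp (3 * M * (t - a))"
      by (rule gradient_energy_le[OF aI I[OF t]]) (use t M in auto)
    also have "\<dots> \<le> E1"
      unfolding E1_def using t M(1) ge0 by (intro mult_left_mono) (auto intro!: mult_left_mono)
    finally show ?thesis .
  qed
  have W: "wiener_norm (deriv (u t)) \<le> B1" "wiener_norm (\<rho> t) \<le> B2" if t: "t \<in> {a..<T0}" for t
  proof -
    define X Y where "X = (\<Sum>\<^sub>\<infinity>k. (2 * pi * real_of_int k) ^ 4 * (cmod (\<F> (u t) k))\<^sup>2)"
      and "Y = (\<Sum>\<^sub>\<infinity>k. (2 * pi * real_of_int k)\<^sup>2 * (cmod (\<F> (\<rho> t) k))\<^sup>2)"
    have XY: "0 \<le> X" "0 \<le> Y" "X + \<kappa> * Y \<le> E1"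
      using E1[OF t] unfolding X_def Y_def gradient_energy_def by (auto intro!: infsum_nonneg)
    have "0 \<le> \<kappa> * Y"
      using XY \<kappa> by simp
    then have "X \<le> E1"
      using XY by linarith
    then show "wiener_norm (deriv (u t)) \<le> B1"
      using hs_slice.wiener_norm_le_energy(1)[OF slice[OF I[OF t]]] unfolding B1_def X_def by linarith
    have "Y \<le> E1 / \<kappa>"
      using XY \<kappa> by (simp add: field_simps)
    moreover have "(cmod (\<F> (\<rho> t) 0))\<^sup>2 \<le> mr"
      unfolding mr_def by (rule mean_\<rho>_le[OF aI I[OF t]]) (use t in auto)
    ultimately show "wiener_norm (\<rho> t) \<le> B2"
      using hs_slice.wiener_norm_le_energy(2)[OF slice[OF I[OF t]]] unfolding B2_def Y_def by linarith
  qed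
  have mu: "(cmod (\<F> (u t) 0))\<^sup>2 \<le> mu" if t: "t \<in> {a..<T0}" for t
  proof -
    have "(cmod (\<F> (u t) 0))\<^sup>2 + D\<^sup>2 \<le> ((cmod (\<F> (u a) 0))\<^sup>2 + D\<^sup>2) * exp (1 * (t - a))"
    proof (rule mean_u_le[OF aI I[OF t]])
      fix \<tau> assume "\<tau> \<in> {a..t}"
      then have \<tau>: "\<tau> \<in> {a..<T0}" using t by auto
      have "\<kappa> * (wiener_norm (\<rho> \<tau>))\<^sup>2 \<le> \<kappa> * B2\<^sup>2" "(wiener_norm (deriv (u \<tau>)))\<^sup>2 \<le> B1\<^sup>2"
        using W[OF \<tau>] wiener_norm_nonneg \<kappa> by (auto intro!: mult_left_mono power_mono)
      moreover have "\<bar>h \<tau>\<bar> \<le> H"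
        using \<tau> a by (intro H) auto
      ultimately show "cmod (\<F> (u' \<tau>) 0) \<le> D"
        using hs_slice.mean_u'[OF slice[OF I[OF \<tau>]]] unfolding D_def by linarith
    qed (use t in auto)
    also have "\<dots> \<le> mu"
      unfolding mu_def using t by (intro mult_left_mono) auto
    finally show ?thesis
      using zero_le_power2[of D] by linarith
  qed
  have E2: "cutoff_energy (s - 1) N (deriv (u t)) + cutoff_energy (s - 1) N (\<rho> t) \<le> E2"
    if t: "t \<in> {a..<T0}" and N: "1 \<le> N" for t N
  proof -
    have "cutoff_energy (s - 1) N (deriv (u t)) + cutoff_energy (s - 1) N (\<rho> t)
      \<le> (cutoff_energy (s - 1) N (deriv (u a)) + cutoff_energy (s - 1) N (\<rho> a)) * exp (hs_slice.growth \<kappa> (s - 1) * (B1 + B2) * (t - a))"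
      by (rule cutoff_energy_le[OF aI I[OF t] _ N]) (use t in \<open>auto intro!: add_mono W\<close>)
    also have "\<dots> \<le> E0 * exp (\<bar>G\<bar> * (T0 - a))"
    proof (rule mult_mono)
      show "cutoff_energy (s - 1) N (deriv (u a)) + cutoff_energy (s - 1) N (\<rho> a) \<le> E0"
        unfolding E0_def
        by (intro add_mono cutoff_energy_le_hnorm hs_slice.hseq_v[OF slice[OF aI]] hs_slice.hseq_\<rho>[OF slice[OF aI]] r N)
      have "G * (t - a) \<le> \<bar>G\<bar> * (t - a)"
        using t by (intro mult_right_mono) auto
      also have "\<dots> \<le> \<bar>G\<bar> * (T0 - a)"
        using t by (intro mult_left_mono) auto
      finally show "exp (hs_slice.growth \<kappa> (s - 1) * (B1 + B2) * (t - a)) \<le> exp (\<bar>G\<bar> * (T0 - a))"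
        by (simp add: G_def)
    qed (auto simp: E0_def)
    finally show ?thesis
      by (simp add: E2_def)
  qed
  define P where "P = sqrt (mu + 2 * (((2 * pi)\<^sup>2) powr (s - 1) * E2) + ((2 * pi)\<^sup>2) powr (s - 1) * E2)"
  have "pair_norm s (u t) (\<rho> t) \<le> P" if t: "t \<in> {a..<T0}" for t
  proof -
    interpret S: hs_slice s \<kappa> "h t" "u t" "\<rho> t" "u' t" "\<rho>' t"
      by (rule slice[OF I[OF t]])
    have N: "cutoff_energy (s - 1) N (deriv (u t)) \<le> E2" "cutoff_energy (s - 1) N (\<rho> t) \<le> E2" if "1 \<le> N" for N
      using E2[OF t that] cutoff_energy_nonneg[of "s - 1" N "deriv (u t)"] cutoff_energy_nonneg[of "s - 1" N "\<rho> t"] by linarith+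
    have "(hnorm (s - 1) (\<F> (deriv (u t))))\<^sup>2 \<le> ((2 * pi)\<^sup>2) powr (s - 1) * E2"
      "(hnorm (s - 1) (\<F> (\<rho> t)))\<^sup>2 \<le> ((2 * pi)\<^sup>2) powr (s - 1) * E2"
      using hnorm_le_cutoff_energy[OF S.v_wiener(1) S.hseq_v r N(1)]
        hnorm_le_cutoff_energy[OF S.\<rho>_wiener(1) S.hseq_\<rho> r N(2)] by auto
    then show ?thesis
      unfolding pair_norm_def P_def sobolev_norm_eq
      using S.hnorm_u_le mu[OF t] by (intro real_sqrt_le_mono) linarith
  qed
  then show thesis
    by (rule that)
qed

end

section \<open>The blow-up criterion\<close>

lemma hs_solution_flow:
  assumes "5 / 2 < s" "0 < \<kappa>" and sol: "hs_solution (- 1) \<kappa> h s u0 \<rho>0 T u \<rho>"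
  obtains u' \<rho>' where "hs_flow s \<kappa> h T u \<rho> u' \<rho>'"
proof -
  from sol obtain u' \<rho>' where
    c: "\<forall>t\<in>time_interval T. continuous_on UNIV (u t) \<and> continuous_on UNIV (\<rho> t)"
    and C0: "C0_sobolev s (time_interval T) u" "C0_sobolev (s - 1) (time_interval T) \<rho>"
    and C1: "C1_sobolev (s - 1) (time_interval T) u u'" "C1_sobolev (s - 2) (time_interval T) \<rho> \<rho>'"
    and eq: "\<forall>t\<in>time_interval T.
           (AE x in lborel.
              u' t x + u t x * deriv (u t) x =
                dx_inv (\<lambda>y. \<kappa> / 2 * (\<rho> t y)\<^sup>2 + (- 1 + 2) / 2 * (deriv (u t) y)\<^sup>2
                              + hs_a (- 1) \<kappa> (u t) (\<rho> t)) x + h t) \<and>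
           (AE x in lborel.
              \<rho>' t x + u t x * deriv (\<rho> t) x = - 1 * deriv (u t) x * \<rho> t x)"
    unfolding hs_solution_def by blast
  have "hs_flow s \<kappa> h T u \<rho> u' \<rho>'"
  proof
    fix t assume t: "t \<in> time_interval T"
    show "u t \<in> sobolev s" "\<rho> t \<in> sobolev (s - 1)" "u' t \<in> sobolev (s - 1)" "\<rho>' t \<in> sobolev (s - 2)"
      using C0 C1 t by (auto simp: C0_sobolev_def C1_sobolev_def)
  qed (use assms(1,2) c C0 C1 eq in auto)
  then show thesis
    by (rule that)
qed

theorem theorem4p3:
  fixes \<alpha> \<kappa> s :: real and h u0 \<rho>0 :: "real \<Rightarrow> real"
    and T :: ereal and u \<rho> :: "real \<Rightarrow> real \<Rightarrow> real"
  assumes "\<alpha> = -1" and "\<kappa> > 0" and "s > 5 / 2"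
    and "continuous_on {0..} h"
    and "u0 \<in> sobolev s" and "\<rho>0 \<in> sobolev (s - 1)"
    and "T = max_existence_time \<alpha> \<kappa> h s u0 \<rho>0"
    and "hs_solution \<alpha> \<kappa> h s u0 \<rho>0 T u \<rho>"
  shows "blows_up_in_finite_time s T u \<rho> \<longleftrightarrow>
           T < \<infinity> \<and>
           Liminf (at_left (real_of_ereal T)) (\<lambda>t. INF x. ereal (deriv (u t) x)) = -\<infinity>"
proof (cases "T < \<infinity>")
  case False
  then show ?thesis
    by (simp add: blows_up_in_finite_time_def)
next
  case True
  have "hs_solution (- 1) \<kappa> h s u0 \<rho>0 T u \<rho>"
    using assms(1,8) by simp
  then obtain u' \<rho>' where "hs_flow s \<kappa> h T u \<rho> u' \<rho>'"
    by (rule hs_solution_flow[OF assms(3,2)])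
  then interpret hs_flow s \<kappa> h T u \<rho> u' \<rho>' .
  have "0 < T"
    using assms(8) by (simp add: hs_solution_def)
  with True obtain T0 where T: "T = ereal T0" and T0: "0 < T0"
    by (cases T) auto
  define L where "L = Liminf (at_left T0) (\<lambda>t. INF x. ereal (deriv (u t) x))"
  define U where "U = Limsup (at_left T0) (\<lambda>t. ereal (pair_norm s (u t) (\<rho> t)))"
  have "L = - \<infinity>" if "U = \<infinity>"
  proof (rule ccontr)
    assume "L \<noteq> - \<infinity>"
    then have "- \<infinity> < L" by simp
    then obtain c where c: "ereal c < L"
      using ereal_dense2 by blast
    have "\<forall>\<^sub>F t in at_left T0. ereal c < (INF x. ereal (deriv (u t) x))"
      using c unfolding L_def by (rule less_LiminfD)
    then obtain t1 where t1: "t1 < T0" "\<And>t. t1 < t \<Longrightarrow> t < T0 \<Longrightarrow> ereal c < (INF x. ereal (deriv (u t) x))"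
      unfolding eventually_at_left_field by blast
    \<comment> \<open>A starting time at which the solution exists and after which the lower bound holds.\<close>
    define a where "a = (max 0 t1 + T0) / 2"
    have a: "0 \<le> a" "t1 < a" "a < T0"
      using t1(1) T0 by (auto simp: a_def max_def)
    have "- max 0 (- c) \<le> deriv (u t) x" if t: "t \<in> {a..<T0}" for t x
    proof -
      have "ereal c < (INF x. ereal (deriv (u t) x))"
        using t a by (intro t1(2)) auto
      also have "\<dots> \<le> ereal (deriv (u t) x)"
        by (rule INF_lower) simp
      finally show ?thesis by simp
    qed
    then obtain P where P: "\<And>t. t \<in> {a..<T0} \<Longrightarrow> pair_norm s (u t) (\<rho> t) \<le> P"
      using bounded_if_gradient_bounded_below[OF T assms(4) a(1,3), of "max 0 (- c)"] by auto
    have "\<forall>\<^sub>F t in at_left T0. ereal (pair_norm s (u t) (\<rho> t)) \<le> ereal P"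
      unfolding eventually_at_left_field using a P by (intro exI[of _ a]) auto
    then have "U \<le> ereal P"
      unfolding U_def by (rule Limsup_bounded)
    then show False
      using that by simp
  qed
  moreover have "U = \<infinity>" if "L = - \<infinity>"
  proof (rule ccontr)
    assume "U \<noteq> \<infinity>"
    then have "U < \<infinity>" by simp
    then obtain P where "U < ereal P"
      using ereal_dense2 by blast
    then have "\<forall>\<^sub>F t in at_left T0. ereal (pair_norm s (u t) (\<rho> t)) < ereal P"
      unfolding U_def by (rule Limsup_lessD)
    moreover have "\<forall>\<^sub>F t in at_left T0. 0 < t \<and> t < T0"
      unfolding eventually_at_left_field using T0 by blast
    ultimately have "\<forall>\<^sub>F t in at_left T0. ereal (- ((P\<^sup>2 + bracket_sum (1 - s)) / 2)) \<le> (INF x. ereal (deriv (u t) x))"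
    proof eventually_elim
      case (elim t)
      then have "t \<in> time_interval T"
        by (auto simp: time_interval_def T)
      then interpret S: hs_slice s \<kappa> "h t" "u t" "\<rho> t" "u' t" "\<rho>' t"
        by (rule slice)
      have "(hnorm s (\<F> (u t)))\<^sup>2 \<le> (pair_norm s (u t) (\<rho> t))\<^sup>2"
        by (simp add: pair_norm_def sobolev_norm_eq)
      also have "\<dots> \<le> P\<^sup>2"
        using elim by (intro power_mono) (auto simp: pair_norm_def)
      finally have "- ((P\<^sup>2 + bracket_sum (1 - s)) / 2) \<le> deriv (u t) x" for x
        using S.abs_v_le[of x] by (simp add: abs_le_iff field_simps)
      then show ?case
        by (intro INF_greatest) auto
    qed
    then have "ereal (- ((P\<^sup>2 + bracket_sum (1 - s)) / 2)) \<le> L"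
      unfolding L_def by (rule Liminf_bounded)
    then show False
      using that by simp
  qed
  ultimately have "U = \<infinity> \<longleftrightarrow> L = - \<infinity>"
    by blast
  then show ?thesis
    unfolding blows_up_in_finite_time_def T L_def U_def by simp
qed

end
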